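(* Let $k$ be a field of characteristic $0$. For every dga $(A,\phi)$ over $k$ there exists a (cohomological) spectral sequence with $$E_2^{p,q}\simeq H^p\big(\textstyle\bigoplus HHP^q_*(A)\big)$$ that converges to the cyclic cohomology $HC^{p+q}_{dg}(A)$.
   Context: **Dgas.** A dga $(A,\phi)$ over $k$ is a unital associative graded $k$-algebra $A=\bigoplus_{m\ge 0}A^m$ with a $k$-linear map $\phi$ lowering degree by one such that $\phi^2=0$ and $\phi(xy)=\phi(x)y+(-1)^{|x|}x\phi(y)$, where $|x|$ is the degree of a homogeneous element. $(A^{\otimes n})^m$ is the total-degree-$m$ part of $A^{\otimes n}$, and $\phi^{\otimes n}$ denotes the induced differential $\phi^{\otimes n}(a_1\otimes\dots\otimes a_n)=\sum_i(-1)^{|a_1|+\dots+|a_{i-1}|}a_1\otimes\dots\otimes\phi(a_i)\otimes\dots\otimes a_n$. For $n,m\ge 0$ put $C^n(A)^m=\mathrm{Hom}_k((A^{\otimes n+1})^m,k)$. **Operators** (on homogeneous $a_i$, with $\gamma_n=|a_n|(|a_0|+\dots+|a_{n-1}|)$): - $\delta:C^n(A)^m\to C^n(A)^{m+1}$, $\delta f=(-1)^m f\circ\phi^{\otimes n+1}$. - $b:C^{n-1}(A)^m\to C^n(A)^m$, $b(f)(a_0\otimes\dots\otimes a_n)=\sum_{i=0}^{n-1}(-1)^i f(a_0\otimes\dots\otimes a_ia_{i+1}\otimes\dots\otimes a_n)+(-1)^{n+\gamma_n}f(a_na_0\otimes a_1\otimes\dots\otimes a_{n-1})$. - $\tau:C^n(A)^m\to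 C^n(A)^m$, $\tau(f)(a_0\otimes\dots\otimes a_n)=(-1)^{n+\gamma_n}f(a_n\otimes a_0\otimes\dots\otimes a_{n-1})$; $N=\sum_{i=0}^n\tau^i$ on $C^n(A)^m$. - $s:C^{n+1}(A)^m\to C^n(A)^m$, $s(f)(a_0\otimes\dots\otimes a_n)=(-1)^n f(a_0\otimes\dots\otimes a_n\otimes 1)$. - $B=Ns(\mathbf 1-\tau):C^{n+1}(A)^m\to C^n(A)^m$ (and $B=0$ on $C^0(A)^m$). **Cyclic cohomology.** $EC(A)$ is the tricomplex with $EC(A)^{p,q,r}=C^{q-p}(A)^r$ for $0\le p\le q$, $r\ge 0$, and $0$ otherwise. $\mathcal T(EC(A))^n=\bigoplus_{p+q+r=n}EC(A)^{p,q,r}$ has differential $b+B+(-1)^{q-p}\delta$, where $b$ raises $q$, $B$ raises $p$, $\delta$ raises $r$ by one. $HC^n_{dg}(A)=H^n(\mathcal T(EC(A)))$. **Partial Hochschild cohomology.** For fixed $n\ge 0$, $HHP^m_n(A)$ (the $n$-th partial Hochschild cohomology with coefficients in $A^*$) is the $m$-th cohomology of $C^0(A)^n\xrightarrow{b}C^1(A)^n\xrightarrow{b}C^2(A)^n\to\cdots$, with $C^m(A)^n$ in degree $m$; set $HHP^m_n(A)=0$ for $m<0$. For fixed $q$, $\bigoplus HHP^q_*(A)$ is the cochain complex whose degree-$p$ term is $\bigoplus_{i=0}^pHHP^{q-i}_{p-i}(A)$, that is $$HHP^q_0\to HHP^q_1\oplus HHP^{q-1}_0\to HHP^q_2\oplus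 HHP^{q-1}_1\oplus HHP^{q-2}_0\to\cdots,$$ with differential induced by $B+(-1)^n\delta$ on $C^n(A)^m$: the component induced by $B$ maps $HHP^{q-i}_{p-i}$ to $HHP^{q-i-1}_{p-i}$ (index $i+1$ in degree $p+1$) and the component induced by $\pm\delta$ maps $HHP^{q-i}_{p-i}$ to $HHP^{q-i}_{p+1-i}$ (index $i$ in degree $p+1$). **Convergence.** A spectral sequence $(E_r^{p,q},d_r)$, $d_r:E_r^{p,q}\to E_r^{p+r,q-r+1}$, converges to $H^*$ if there is a decreasing filtration of each $H^n$, finite in each degree, with $E_\infty^{p,q}\simeq F^pH^{p+q}/F^{p+1}H^{p+q}$. *)

theory Defs
  imports "HOL-Library.Poly_Mapping" "HOL-Algebra.Algebraic_Closure_Type"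
begin

text \<open>
  The ground field is a type \<open>'k\<close> of class \<open>field_char_0\<close>. Vector spaces that arise from
  constructions (tensor powers, duals, direct sums, cohomology) are records of HOL-Algebra's type
  \<open>module\<close> over the ring \<open>ring_of_type_algebra\<close> on the type \<open>'k\<close>; their multiplicative fields \<open>mult\<close>
  and \<open>one\<close> play no role and are left \<open>undefined\<close>.
\<close>

section \<open>Linear algebra\<close>

abbreviation is_vector_space :: "('k::field_char_0, 'v) module \<Rightarrow> bool" where
  "is_vector_space V \<equiv> Module.module (ring_of_type_algebra :: 'k ring) V"

abbreviation is_subspace :: "'v set \<Rightarrow> ('k::field_char_0, 'v) module \<Rightarrow> bool" where
  "is_subspace H V \<equiv> submodule H (ring_of_type_algebra :: 'k ring) V"

definition linear_hull :: "('k::field_char_0, 'v) module \<Rightarrow> 'v set \<Rightarrow> 'v set" where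
  "linear_hull V S = \<Inter> {H. is_subspace H V \<and> S \<subseteq> H}"

definition linear_maps :: "('k::field_char_0, 'v) module \<Rightarrow> ('k, 'w) module \<Rightarrow> ('v \<Rightarrow> 'w) set" where
  "linear_maps V W = {f.
     (\<forall>x\<in>carrier V. f x \<in> carrier W) \<and>
     (\<forall>x\<in>carrier V. \<forall>y\<in>carrier V. f (x \<oplus>\<^bsub>V\<^esub> y) = f x \<oplus>\<^bsub>W\<^esub> f y) \<and>
     (\<forall>c. \<forall>x\<in>carrier V. f (c \<odot>\<^bsub>V\<^esub> x) = c \<odot>\<^bsub>W\<^esub> f x)}"

definition isomorphic :: "('k::field_char_0, 'v) module \<Rightarrow> ('k, 'w) module \<Rightarrow> bool" where
  "isomorphic V W \<longleftrightarrow> (\<exists>f\<in>linear_maps V W. bij_betw f (carrier V) (carrier W))"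

definition quotient_space :: "('k::field_char_0, 'v) module \<Rightarrow> 'v set \<Rightarrow> ('k, 'v set) module" where
  "quotient_space V N =
     \<lparr> carrier = a_rcosets\<^bsub>V\<^esub> N, monoid.mult = undefined, one = undefined,
       ring.zero = N, add = set_add V,
       module.smult = (\<lambda>c Q. \<Union>x\<in>Q. (N +>\<^bsub>V\<^esub> (c \<odot>\<^bsub>V\<^esub> x))) \<rparr>"

text \<open>The map \<open>V/M \<rightarrow> W/N\<close> induced by \<open>f\<close>. For \<open>f\<close> linear with \<open>f(M) \<subseteq> N\<close> all the cosets in the union
  coincide.\<close>

definition induced_map ::
    "('k::field_char_0, 'w) module \<Rightarrow> 'w set \<Rightarrow> ('v \<Rightarrow> 'w) \<Rightarrow> 'v set \<Rightarrow> 'w set" where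
  "induced_map W N f Q = (\<Union>x\<in>Q. (N +>\<^bsub>W\<^esub> f x))"

definition direct_sum :: "'i set \<Rightarrow> ('i \<Rightarrow> ('k::field_char_0, 'v) module) \<Rightarrow> ('k, 'i \<Rightarrow> 'v) module" where
  "direct_sum I V =
     \<lparr> carrier = {x \<in> (\<Pi>\<^sub>E i\<in>I. carrier (V i)). finite {i \<in> I. x i \<noteq> \<zero>\<^bsub>V i\<^esub>}},
       monoid.mult = undefined, one = undefined,
       ring.zero = (\<lambda>i\<in>I. \<zero>\<^bsub>V i\<^esub>), add = (\<lambda>x y. \<lambda>i\<in>I. x i \<oplus>\<^bsub>V i\<^esub> y i),
       module.smult = (\<lambda>c x. \<lambda>i\<in>I. c \<odot>\<^bsub>V i\<^esub> x i) \<rparr>"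

definition function_space :: "('x \<Rightarrow> 'k::field_char_0) set \<Rightarrow> ('k, 'x \<Rightarrow> 'k) module" where
  "function_space S =
     \<lparr> carrier = S, monoid.mult = undefined, one = undefined,
       ring.zero = (\<lambda>_. 0), add = (\<lambda>f g x. f x + g x), module.smult = (\<lambda>c f x. c * f x) \<rparr>"

text \<open>The dual space. HOL functions are total, so a functional on \<open>V\<close> is normalised to be \<open>0\<close> outside
  the carrier.\<close>

definition dual_space :: "('k::field_char_0, 'v) module \<Rightarrow> ('k, 'v \<Rightarrow> 'k) module" where
  "dual_space V = function_space {f.
     (\<forall>x\<in>carrier V. \<forall>y\<in>carrier V. f (x \<oplus>\<^bsub>V\<^esub> y) = f x + f y) \<and>
     (\<forall>c. \<forall>x\<in>carrier V. f (c \<odot>\<^bsub>V\<^esub> x) = c * f x) \<and>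
     (\<forall>x. x \<notin> carrier V \<longrightarrow> f x = 0)}"

text \<open>Cohomology at \<open>V\<close> of \<open>U \<rightarrow> V \<rightarrow> W\<close> (maps \<open>f\<close> and \<open>g\<close>), and of a complex indexed by the integers.\<close>

definition cohomology_at ::
    "('k::field_char_0, 'u) module \<Rightarrow> ('u \<Rightarrow> 'v) \<Rightarrow> ('k, 'v) module \<Rightarrow> ('v \<Rightarrow> 'w) \<Rightarrow> ('k, 'w) module
      \<Rightarrow> ('k, 'v set) module" where
  "cohomology_at U f V g W =
     quotient_space (V\<lparr>carrier := {x \<in> carrier V. g x = \<zero>\<^bsub>W\<^esub>}\<rparr>) (f ` carrier U)"

definition cohomology ::
    "(int \<Rightarrow> ('k::field_char_0, 'v) module) \<Rightarrow> (int \<Rightarrow> 'v \<Rightarrow> 'v) \<Rightarrow> int \<Rightarrow> ('k, 'v set) module" where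
  "cohomology V d n = cohomology_at (V (n - 1)) (d (n - 1)) (V n) (d n) (V (n + 1))"


section \<open>Differential graded algebras and their tensor powers\<close>

text \<open>The algebra is the whole type \<open>'a\<close>; its class \<open>{ring, monoid_mult}\<close> is that of unital associative
  rings, not excluding the zero ring.\<close>

record ('k, 'a) dga_data =
  scl :: "'k \<Rightarrow> 'a \<Rightarrow> 'a"
  homog :: "nat \<Rightarrow> 'a set"
  diff :: "'a \<Rightarrow> 'a"

locale dga = vector_space "scl A"
  for A :: "('k::field_char_0, 'a::{ring, monoid_mult}) dga_data" +
  assumes scl_mult_left: "scl A c (x * y) = scl A c x * y"
    and scl_mult_right: "scl A c (x * y) = x * scl A c y"
    and homog_subspace: "subspace (homog A m)"
    and homog_decomposition:
      "\<exists>!c. (\<forall>m. c m \<in> homog A m) \<and> finite {m. c m \<noteq> 0} \<and> x = (\<Sum>m | c m \<noteq> 0. c m)"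
    and homog_one: "1 \<in> homog A 0"
    and homog_mult: "x \<in> homog A m \<Longrightarrow> y \<in> homog A m' \<Longrightarrow> x * y \<in> homog A (m + m')"
    and diff_linear: "Vector_Spaces.linear (scl A) (scl A) (diff A)"
    and diff_homog_0: "x \<in> homog A 0 \<Longrightarrow> diff A x = 0"
    and diff_homog_Suc: "x \<in> homog A (Suc m) \<Longrightarrow> diff A x \<in> homog A m"
    and diff_diff: "diff A (diff A x) = 0"
    and diff_mult: "x \<in> homog A m \<Longrightarrow>
      diff A (x * y) = diff A x * y + scl A ((-1) ^ m) (x * diff A y)"

text \<open>The \<open>n\<close>-th tensor power is the free vector space on the lists of length \<open>n\<close> modulo the
  multilinearity relations; its elements are cosets.\<close>

type_synonym ('a, 'k) tensor = "('a list \<Rightarrow>\<^sub>0 'k) set"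

definition free_space :: "nat \<Rightarrow> ('k::field_char_0, 'a list \<Rightarrow>\<^sub>0 'k) module" where
  "free_space n =
     \<lparr> carrier = {x. \<forall>as\<in>Poly_Mapping.keys x. length as = n}, monoid.mult = undefined, one = undefined,
       ring.zero = 0, add = (+), module.smult = (\<lambda>c. Poly_Mapping.map ((*) c)) \<rparr>"

definition tensor_relations ::
    "('k::field_char_0, 'a::{ring, monoid_mult}) dga_data \<Rightarrow> nat \<Rightarrow> ('a list \<Rightarrow>\<^sub>0 'k) set" where
  "tensor_relations A n = linear_hull (free_space n)
     ({Poly_Mapping.single (as[i := x + y]) 1
         - Poly_Mapping.single (as[i := x]) 1 - Poly_Mapping.single (as[i := y]) 1
       | as i x y. length as = n \<and> i < n} \<union>
      {Poly_Mapping.single (as[i := scl A c x]) 1 - Poly_Mapping.single (as[i := x]) c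
       | as i c x. length as = n \<and> i < n})"

definition tensor_power ::
    "('k::field_char_0, 'a::{ring, monoid_mult}) dga_data \<Rightarrow> nat \<Rightarrow> ('k, ('a, 'k) tensor) module" where
  "tensor_power A n = quotient_space (free_space n) (tensor_relations A n)"

text \<open>\<open>tens A [a\<^sub>1, \<dots>, a\<^sub>n]\<close> is \<open>a\<^sub>1 \<otimes> \<dots> \<otimes> a\<^sub>n\<close>.\<close>

definition tens ::
    "('k::field_char_0, 'a::{ring, monoid_mult}) dga_data \<Rightarrow> 'a list \<Rightarrow> ('a, 'k) tensor" where
  "tens A as = tensor_relations A (length as) +>\<^bsub>free_space (length as)\<^esub> Poly_Mapping.single as 1"

text \<open>\<open>as\<close> is a list of \<open>n\<close> homogeneous elements with degrees \<open>ds\<close>. The degrees are carried along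
  explicitly because \<open>0\<close> is homogeneous of every degree.\<close>

definition homog_list ::
    "('k, 'a) dga_data \<Rightarrow> nat \<Rightarrow> 'a list \<Rightarrow> nat list \<Rightarrow> bool" where
  "homog_list A n as ds \<longleftrightarrow>
     length as = n \<and> length ds = n \<and> (\<forall>i<n. as ! i \<in> homog A (ds ! i))"

text \<open>\<open>graded_tensor_power A n m\<close> is the part of total degree \<open>m\<close> of the \<open>n\<close>-th tensor power.\<close>

definition graded_tensor_power ::
    "('k::field_char_0, 'a::{ring, monoid_mult}) dga_data \<Rightarrow> nat \<Rightarrow> nat
      \<Rightarrow> ('k, ('a, 'k) tensor) module" where
  "graded_tensor_power A n m = (tensor_power A n)
     \<lparr>carrier := linear_hull (tensor_power A n)
        {tens A as | as ds. homog_list A n as ds \<and> sum_list ds = m}\<rparr>"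

definition tensor_diff ::
    "('k::field_char_0, 'a::{ring, monoid_mult}) dga_data \<Rightarrow> nat
      \<Rightarrow> ('a, 'k) tensor \<Rightarrow> ('a, 'k) tensor" where
  "tensor_diff A n = (THE T.
     T \<in> linear_maps (tensor_power A n) (tensor_power A n) \<and>
     T \<in> extensional (carrier (tensor_power A n)) \<and>
     (\<forall>as ds. homog_list A n as ds \<longrightarrow>
        T (tens A as) = (\<Oplus>\<^bsub>tensor_power A n\<^esub> i\<in>{..<n}.
          (-1) ^ sum_list (take i ds) \<odot>\<^bsub>tensor_power A n\<^esub> tens A (as[i := diff A (as ! i)]))))"


section \<open>Cochains and operators\<close>

type_synonym ('a, 'k) cochain = "('a, 'k) tensor \<Rightarrow> 'k"

definition cochains ::
    "('k::field_char_0, 'a::{ring, monoid_mult}) dga_data \<Rightarrow> nat \<Rightarrow> nat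
      \<Rightarrow> ('k, ('a, 'k) cochain) module" where
  "cochains A n m = dual_space (graded_tensor_power A (n + 1) m)"

text \<open>The cochain in \<open>C\<^sup>n(A)\<^sup>m\<close> with prescribed values \<open>F [a\<^sub>0, \<dots>, a\<^sub>n] [|a\<^sub>0|, \<dots>, |a\<^sub>n|]\<close> on the
  tensors of homogeneous elements of total degree \<open>m\<close>.\<close>

definition cochain_with_values ::
    "('k::field_char_0, 'a::{ring, monoid_mult}) dga_data \<Rightarrow> nat \<Rightarrow> nat
      \<Rightarrow> ('a list \<Rightarrow> nat list \<Rightarrow> 'k) \<Rightarrow> ('a, 'k) cochain" where
  "cochain_with_values A n m F = (THE g. g \<in> carrier (cochains A n m) \<and>
     (\<forall>as ds. homog_list A (n + 1) as ds \<and> sum_list ds = m \<longrightarrow> g (tens A as) = F as ds))"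

text \<open>The operators take the indices \<open>n\<close> and \<open>m\<close> of their \<^emph>\<open>source\<close> \<open>C\<^sup>n(A)\<^sup>m\<close>, except for \<open>op_s\<close>, which
  takes those of its target. In particular \<open>op_b A n m\<close> maps \<open>C\<^sup>n(A)\<^sup>m\<close> to \<open>C\<^sup>n\<^sup>+\<^sup>1(A)\<^sup>m\<close>.\<close>

definition op_delta ::
    "('k::field_char_0, 'a::{ring, monoid_mult}) dga_data \<Rightarrow> nat \<Rightarrow> nat
      \<Rightarrow> ('a, 'k) cochain \<Rightarrow> ('a, 'k) cochain" where
  "op_delta A n m f = (\<lambda>x. if x \<in> carrier (graded_tensor_power A (n + 1) (m + 1))
     then (-1) ^ m * f (tensor_diff A (n + 1) x) else 0)"

definition last_sign_exp :: "nat list \<Rightarrow> nat" where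
  "last_sign_exp ds = last ds * sum_list (butlast ds)"

definition op_b ::
    "('k::field_char_0, 'a::{ring, monoid_mult}) dga_data \<Rightarrow> nat \<Rightarrow> nat
      \<Rightarrow> ('a, 'k) cochain \<Rightarrow> ('a, 'k) cochain" where
  "op_b A n m f = cochain_with_values A (n + 1) m (\<lambda>as ds.
     (\<Sum>i<n + 1. (-1) ^ i * f (tens A (take i as @ [as ! i * as ! (i + 1)] @ drop (i + 2) as)))
     + (-1) ^ (n + 1 + last_sign_exp ds) * f (tens A ((last as * hd as) # butlast (tl as))))"

definition op_tau ::
    "('k::field_char_0, 'a::{ring, monoid_mult}) dga_data \<Rightarrow> nat \<Rightarrow> nat
      \<Rightarrow> ('a, 'k) cochain \<Rightarrow> ('a, 'k) cochain" where
  "op_tau A n m f = cochain_with_values A n m (\<lambda>as ds.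
     (-1) ^ (n + last_sign_exp ds) * f (tens A (last as # butlast as)))"

definition op_N ::
    "('k::field_char_0, 'a::{ring, monoid_mult}) dga_data \<Rightarrow> nat \<Rightarrow> nat
      \<Rightarrow> ('a, 'k) cochain \<Rightarrow> ('a, 'k) cochain" where
  "op_N A n m f = (\<lambda>x. \<Sum>i\<le>n. (op_tau A n m ^^ i) f x)"

definition op_s ::
    "('k::field_char_0, 'a::{ring, monoid_mult}) dga_data \<Rightarrow> nat \<Rightarrow> nat
      \<Rightarrow> ('a, 'k) cochain \<Rightarrow> ('a, 'k) cochain" where
  "op_s A n m f = cochain_with_values A n m (\<lambda>as ds. (-1) ^ n * f (tens A (as @ [1])))"

definition op_B ::
    "('k::field_char_0, 'a::{ring, monoid_mult}) dga_data \<Rightarrow> nat \<Rightarrow> nat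
      \<Rightarrow> ('a, 'k) cochain \<Rightarrow> ('a, 'k) cochain" where
  "op_B A n m f = (case n of 0 \<Rightarrow> (\<lambda>_. 0)
     | Suc n' \<Rightarrow> op_N A n' m (op_s A n' m (\<lambda>x. f x - op_tau A n m f x)))"


section \<open>Cyclic cohomology\<close>

text \<open>Complexes are indexed by the integers and extended by zero spaces and zero maps.\<close>

definition EC ::
    "('k::field_char_0, 'a::{ring, monoid_mult}) dga_data \<Rightarrow> int \<Rightarrow> int \<Rightarrow> int
      \<Rightarrow> ('k, ('a, 'k) cochain) module" where
  "EC A p q r = (if 0 \<le> p \<and> p \<le> q \<and> 0 \<le> r then cochains A (nat (q - p)) (nat r)
     else function_space {\<lambda>_. 0})"

definition EC_map ::
    "(nat \<Rightarrow> nat \<Rightarrow> ('a, 'k) cochain \<Rightarrow> ('a, 'k) cochain) \<Rightarrow> int \<Rightarrow> int \<Rightarrow> int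
      \<Rightarrow> ('a, 'k::field_char_0) cochain \<Rightarrow> ('a, 'k) cochain" where
  "EC_map D p q r f = (if 0 \<le> p \<and> p \<le> q \<and> 0 \<le> r then D (nat (q - p)) (nat r) f else (\<lambda>_. 0))"

definition total_EC ::
    "('k::field_char_0, 'a::{ring, monoid_mult}) dga_data \<Rightarrow> int
      \<Rightarrow> ('k, int \<times> int \<times> int \<Rightarrow> ('a, 'k) cochain) module" where
  "total_EC A n = direct_sum {(p, q, r). p + q + r = n} (\<lambda>(p, q, r). EC A p q r)"

definition total_EC_diff ::
    "('k::field_char_0, 'a::{ring, monoid_mult}) dga_data \<Rightarrow> int
      \<Rightarrow> (int \<times> int \<times> int \<Rightarrow> ('a, 'k) cochain) \<Rightarrow> (int \<times> int \<times> int \<Rightarrow> ('a, 'k) cochain)" where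
  "total_EC_diff A n x = (\<lambda>(p, q, r)\<in>{(p, q, r). p + q + r = n + 1}.
     EC_map (op_b A) p (q - 1) r (x (p, q - 1, r))
     \<oplus>\<^bsub>EC A p q r\<^esub> EC_map (op_B A) (p - 1) q r (x (p - 1, q, r))
     \<oplus>\<^bsub>EC A p q r\<^esub> (((-1) powi (q - p))
          \<odot>\<^bsub>EC A p q r\<^esub> EC_map (op_delta A) p q (r - 1) (x (p, q, r - 1))))"

definition HC ::
    "('k::field_char_0, 'a::{ring, monoid_mult}) dga_data \<Rightarrow> int
      \<Rightarrow> ('k, (int \<times> int \<times> int \<Rightarrow> ('a, 'k) cochain) set) module" where
  "HC A = cohomology (total_EC A) (total_EC_diff A)"


section \<open>Partial Hochschild cohomology\<close>

definition hoch_space ::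
    "('k::field_char_0, 'a::{ring, monoid_mult}) dga_data \<Rightarrow> nat \<Rightarrow> int
      \<Rightarrow> ('k, ('a, 'k) cochain) module" where
  "hoch_space A n m = (if 0 \<le> m then cochains A (nat m) n else function_space {\<lambda>_. 0})"

definition hoch_map ::
    "(nat \<Rightarrow> nat \<Rightarrow> ('a, 'k) cochain \<Rightarrow> ('a, 'k) cochain) \<Rightarrow> nat \<Rightarrow> int
      \<Rightarrow> ('a, 'k::field_char_0) cochain \<Rightarrow> ('a, 'k) cochain" where
  "hoch_map D n m f = (if 0 \<le> m then D (nat m) n f else (\<lambda>_. 0))"

text \<open>\<open>HHP A m n\<close> is \<open>HHP\<^sup>m\<^sub>n(A)\<close>.\<close>

definition HHP ::
    "('k::field_char_0, 'a::{ring, monoid_mult}) dga_data \<Rightarrow> int \<Rightarrow> nat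
      \<Rightarrow> ('k, ('a, 'k) cochain set) module" where
  "HHP A m n = cohomology (hoch_space A n) (hoch_map (op_b A) n) m"

definition hoch_coboundaries ::
    "('k::field_char_0, 'a::{ring, monoid_mult}) dga_data \<Rightarrow> int \<Rightarrow> nat \<Rightarrow> ('a, 'k) cochain set" where
  "hoch_coboundaries A m n = hoch_map (op_b A) n (m - 1) ` carrier (hoch_space A n (m - 1))"

text \<open>\<open>HHP\<^sup>m\<^sub>n \<rightarrow> HHP\<^sup>m\<^sup>-\<^sup>1\<^sub>n\<close> induced by \<open>B\<close>, and \<open>HHP\<^sup>m\<^sub>n \<rightarrow> HHP\<^sup>m\<^sub>n\<^sub>+\<^sub>1\<close> induced by \<open>(-1)\<^sup>m \<delta>\<close>.\<close>

definition HHP_B ::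
    "('k::field_char_0, 'a::{ring, monoid_mult}) dga_data \<Rightarrow> int \<Rightarrow> nat
      \<Rightarrow> ('a, 'k) cochain set \<Rightarrow> ('a, 'k) cochain set" where
  "HHP_B A m n = induced_map (hoch_space A n (m - 1)) (hoch_coboundaries A (m - 1) n)
     (hoch_map (op_B A) n m)"

definition HHP_delta ::
    "('k::field_char_0, 'a::{ring, monoid_mult}) dga_data \<Rightarrow> int \<Rightarrow> nat
      \<Rightarrow> ('a, 'k) cochain set \<Rightarrow> ('a, 'k) cochain set" where
  "HHP_delta A m n = induced_map (hoch_space A (n + 1) m) (hoch_coboundaries A m (n + 1))
     (\<lambda>f. ((-1) powi m) \<odot>\<^bsub>hoch_space A (n + 1) m\<^esub> hoch_map (op_delta A) n m f)"

text \<open>The complex \<open>\<Oplus>HHP\<^sup>q\<^sub>*(A)\<close>. In the differential the index \<open>j\<close> of the target summand receives \<open>B\<close>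
  from index \<open>j - 1\<close> and \<open>\<plusminus>\<delta>\<close> from index \<open>j\<close>, as far as these lie in \<open>{0..p}\<close>.\<close>

definition HHP_sum ::
    "('k::field_char_0, 'a::{ring, monoid_mult}) dga_data \<Rightarrow> int \<Rightarrow> int
      \<Rightarrow> ('k, int \<Rightarrow> ('a, 'k) cochain set) module" where
  "HHP_sum A q p = direct_sum {0..p} (\<lambda>i. HHP A (q - i) (nat (p - i)))"

definition HHP_sum_diff ::
    "('k::field_char_0, 'a::{ring, monoid_mult}) dga_data \<Rightarrow> int \<Rightarrow> int
      \<Rightarrow> (int \<Rightarrow> ('a, 'k) cochain set) \<Rightarrow> (int \<Rightarrow> ('a, 'k) cochain set)" where
  "HHP_sum_diff A q p x = (\<lambda>j\<in>{0..p + 1}.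
     let V = HHP A (q - j) (nat (p + 1 - j)) in
     (if j - 1 \<in> {0..p} then HHP_B A (q - (j - 1)) (nat (p - (j - 1))) (x (j - 1)) else \<zero>\<^bsub>V\<^esub>)
     \<oplus>\<^bsub>V\<^esub> (if j \<in> {0..p} then HHP_delta A (q - j) (nat (p - j)) (x j) else \<zero>\<^bsub>V\<^esub>))"


section \<open>Spectral sequences\<close>

text \<open>A cohomological spectral sequence of vector spaces starting at page \<open>a\<close>; pages \<open>E r\<close> with \<open>r < a\<close>
  are irrelevant.\<close>

definition spectral_sequence ::
    "nat \<Rightarrow> (nat \<Rightarrow> int \<Rightarrow> int \<Rightarrow> ('k::field_char_0, 'v) module)
      \<Rightarrow> (nat \<Rightarrow> int \<Rightarrow> int \<Rightarrow> 'v \<Rightarrow> 'v) \<Rightarrow> bool" where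
  "spectral_sequence a E d \<longleftrightarrow> (\<forall>r\<ge>a. \<forall>p q.
     is_vector_space (E r p q) \<and>
     d r p q \<in> linear_maps (E r p q) (E r (p + int r) (q - int r + 1)) \<and>
     (\<forall>x\<in>carrier (E r p q).
        d r (p + int r) (q - int r + 1) (d r p q x)
          = \<zero>\<^bsub>E r (p + int r + int r) (q - int r + 1 - int r + 1)\<^esub>) \<and>
     isomorphic (E (r + 1) p q)
       (cohomology_at (E r (p - int r) (q + int r - 1)) (d r (p - int r) (q + int r - 1))
          (E r p q) (d r p q) (E r (p + int r) (q - int r + 1))))"

text \<open>From page \<open>r\<^sub>0\<close> on the differentials leaving and entering position \<open>(p, q)\<close> vanish, so that
  \<open>E\<^sub>\<infinity>\<^sup>p\<^sup>,\<^sup>q\<close> is \<open>E r\<^sub>0 p q\<close>.\<close>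

definition stable_from ::
    "nat \<Rightarrow> (nat \<Rightarrow> int \<Rightarrow> int \<Rightarrow> ('k::field_char_0, 'v) module)
      \<Rightarrow> (nat \<Rightarrow> int \<Rightarrow> int \<Rightarrow> 'v \<Rightarrow> 'v) \<Rightarrow> int \<Rightarrow> int \<Rightarrow> bool" where
  "stable_from r\<^sub>0 E d p q \<longleftrightarrow> (\<forall>r\<ge>r\<^sub>0.
     (\<forall>x\<in>carrier (E r p q). d r p q x = \<zero>\<^bsub>E r (p + int r) (q - int r + 1)\<^esub>) \<and>
     (\<forall>x\<in>carrier (E r (p - int r) (q + int r - 1)).
        d r (p - int r) (q + int r - 1) x = \<zero>\<^bsub>E r p q\<^esub>))"

definition finite_decreasing_filtration ::
    "('k::field_char_0, 'h) module \<Rightarrow> (int \<Rightarrow> 'h set) \<Rightarrow> bool" where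
  "finite_decreasing_filtration V F \<longleftrightarrow>
     (\<forall>p. is_subspace (F p) V \<and> F (p + 1) \<subseteq> F p) \<and>
     (\<exists>p. F p = carrier V) \<and> (\<exists>p. F p = {\<zero>\<^bsub>V\<^esub>})"

definition converges_to ::
    "nat \<Rightarrow> (nat \<Rightarrow> int \<Rightarrow> int \<Rightarrow> ('k::field_char_0, 'v) module)
      \<Rightarrow> (nat \<Rightarrow> int \<Rightarrow> int \<Rightarrow> 'v \<Rightarrow> 'v) \<Rightarrow> (int \<Rightarrow> ('k, 'h) module) \<Rightarrow> bool" where
  "converges_to a E d H \<longleftrightarrow> (\<exists>F.
     (\<forall>n. finite_decreasing_filtration (H n) (F n)) \<and>
     (\<forall>p q. \<exists>r\<^sub>0\<ge>a. stable_from r\<^sub>0 E d p q \<and>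
        isomorphic (E r\<^sub>0 p q)
          (quotient_space ((H (p + q))\<lparr>carrier := F (p + q) p\<rparr>) (F (p + q) (p + 1)))))"

end

theory Submission
  imports Defs "HOL-Library.Function_Algebras"
begin

text \<open>
  Regrouped, the tricomplex is a double complex. In degree \<open>n\<close> the total
  complex of \<open>EC(A)\<close> consists of the spaces \<open>C\<^sup>q\<^sup>-\<^sup>i(A)\<^sup>s\<^sup>-\<^sup>i\<close> at the positions \<open>(i, q, s - i)\<close> with
  \<open>q + s = n\<close>; here \<open>b\<close> raises \<open>q\<close> and keeps \<open>s\<close>, whereas \<open>B\<close> and \<open>\<plusminus>\<delta>\<close> keep \<open>q\<close> and raise \<open>s\<close>.
  The spectral sequence is the one of the filtration by \<open>s\<close>, which is finite in each degree because all
  three coordinates of a nonzero entry are at least \<open>0\<close>. Its zeroth differential is \<open>b\<close>, so the first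
  page is made of the groups \<open>HHP\<close>, and the differential of that page is induced by \<open>B \<plusminus> \<delta>\<close>: the
  second page is the cohomology of the complexes \<open>\<Oplus>HHP\<^sup>q\<^sub>*(A)\<close>.

  Besides \<open>\<delta>\<^sup>2 = 0\<close>, three facts make the square of \<open>b + B \<plusminus> \<delta>\<close> vanish. First, the cochains of fixed internal degree
  form a cyclic module: rotations and multiplications of neighbouring entries satisfy the usual
  relations, the Koszul signs being absorbed into the rotation (\<open>cyclic_cochains\<close>). Secondly, the
  relations \<open>b\<^sup>2 = 0\<close>, \<open>B\<^sup>2 = 0\<close> and \<open>bB + Bb = 0\<close> hold in every cyclic module with an extra
  degeneracy (\<open>b_b\<close>, \<open>B_B\<close>, \<open>b_B\<close>). Thirdly, \<open>\<delta>\<close> is a morphism of cyclic modules by the Leibniz rule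
  (\<open>delta_morphism\<close>), and so commutes with \<open>b\<close> and \<open>B\<close>; the sign in \<open>\<plusminus>\<delta>\<close> makes it anticommute with
  them.

  The operators are characterised by their values on tensors of homogeneous elements. For these to
  define cochains one needs the universal property of the graded tensor powers
  (\<open>functional_of_homogeneous_multilinear\<close>); conversely cochains that agree on such tensors are equal
  (\<open>cochain_eqI\<close>), which reduces all identities to identities of lists with signs.

  The spectral sequence of a bounded filtered complex is constructed for subspaces of one ambient
  vector space (\<open>spectral_sequence_E\<close>, \<open>converges\<close>). Both the second page and the limit are then
  identified by the first isomorphism theorem: a map is defined on cocycles, or on cocycles up to
  higher filtration, and its kernel and image are computed (\<open>second_page\<close>, \<open>HC_presentation\<close>).
\<close>

section \<open>Vector spaces, quotients and induced maps\<close>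

lemma scalar_ring_simps [simp]:
  "carrier (ring_of_type_algebra :: 'k::field_char_0 ring) = UNIV"
  "monoid.mult (ring_of_type_algebra :: 'k ring) = (*)"
  "one (ring_of_type_algebra :: 'k ring) = 1"
  "ring.zero (ring_of_type_algebra :: 'k ring) = 0"
  "add (ring_of_type_algebra :: 'k ring) = (+)"
  by (simp_all add: ring_of_type_algebra_def)

lemma is_vector_spaceI:
  fixes V :: "('k::field_char_0, 'v) module"
  assumes add_closed: "\<And>x y. x \<in> carrier V \<Longrightarrow> y \<in> carrier V \<Longrightarrow> x \<oplus>\<^bsub>V\<^esub> y \<in> carrier V"
    and zero_closed: "\<zero>\<^bsub>V\<^esub> \<in> carrier V"
    and smult_closed: "\<And>c x. x \<in> carrier V \<Longrightarrow> c \<odot>\<^bsub>V\<^esub> x \<in> carrier V"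
    and assoc: "\<And>x y z. x \<in> carrier V \<Longrightarrow> y \<in> carrier V \<Longrightarrow> z \<in> carrier V \<Longrightarrow>
      (x \<oplus>\<^bsub>V\<^esub> y) \<oplus>\<^bsub>V\<^esub> z = x \<oplus>\<^bsub>V\<^esub> (y \<oplus>\<^bsub>V\<^esub> z)"
    and comm: "\<And>x y. x \<in> carrier V \<Longrightarrow> y \<in> carrier V \<Longrightarrow> x \<oplus>\<^bsub>V\<^esub> y = y \<oplus>\<^bsub>V\<^esub> x"
    and zero: "\<And>x. x \<in> carrier V \<Longrightarrow> \<zero>\<^bsub>V\<^esub> \<oplus>\<^bsub>V\<^esub> x = x"
    and zero_smult: "\<And>x. x \<in> carrier V \<Longrightarrow> 0 \<odot>\<^bsub>V\<^esub> x = \<zero>\<^bsub>V\<^esub>"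
    and distr_left: "\<And>c d x. x \<in> carrier V \<Longrightarrow> (c + d) \<odot>\<^bsub>V\<^esub> x = c \<odot>\<^bsub>V\<^esub> x \<oplus>\<^bsub>V\<^esub> d \<odot>\<^bsub>V\<^esub> x"
    and distr_right: "\<And>c x y. x \<in> carrier V \<Longrightarrow> y \<in> carrier V \<Longrightarrow>
      c \<odot>\<^bsub>V\<^esub> (x \<oplus>\<^bsub>V\<^esub> y) = c \<odot>\<^bsub>V\<^esub> x \<oplus>\<^bsub>V\<^esub> c \<odot>\<^bsub>V\<^esub> y"
    and smult_assoc: "\<And>c d x. x \<in> carrier V \<Longrightarrow> (c * d) \<odot>\<^bsub>V\<^esub> x = c \<odot>\<^bsub>V\<^esub> (d \<odot>\<^bsub>V\<^esub> x)"
    and one: "\<And>x. x \<in> carrier V \<Longrightarrow> 1 \<odot>\<^bsub>V\<^esub> x = x"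
  shows "is_vector_space V"
proof (rule moduleI)
  show "abelian_group V"
  proof (rule abelian_groupI)
    fix x assume x: "x \<in> carrier V"
    have "(-1) \<odot>\<^bsub>V\<^esub> x \<oplus>\<^bsub>V\<^esub> x = (-1) \<odot>\<^bsub>V\<^esub> x \<oplus>\<^bsub>V\<^esub> 1 \<odot>\<^bsub>V\<^esub> x"
      using x by (simp add: one)
    also have "\<dots> = \<zero>\<^bsub>V\<^esub>"
      using x distr_left[of x "-1" 1] zero_smult by simp
    finally show "\<exists>y\<in>carrier V. y \<oplus>\<^bsub>V\<^esub> x = \<zero>\<^bsub>V\<^esub>"
      using smult_closed[OF x] by blast
  qed (use assms in auto)
  show "cring (ring_of_type_algebra :: 'k ring)"
    by (rule cring_from_type_algebra)
qed (use assms in auto)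

lemma vector_space_simps:
  fixes V :: "('k::field_char_0, 'v) module"
  assumes "is_vector_space V"
  shows "abelian_group V"
    and "\<And>x y. x \<in> carrier V \<Longrightarrow> y \<in> carrier V \<Longrightarrow> x \<oplus>\<^bsub>V\<^esub> y \<in> carrier V"
    and "\<zero>\<^bsub>V\<^esub> \<in> carrier V"
    and "\<And>x. x \<in> carrier V \<Longrightarrow> \<ominus>\<^bsub>V\<^esub> x \<in> carrier V"
    and "\<And>c x. x \<in> carrier V \<Longrightarrow> c \<odot>\<^bsub>V\<^esub> x \<in> carrier V"
    and "\<And>c d x. x \<in> carrier V \<Longrightarrow> (c + d) \<odot>\<^bsub>V\<^esub> x = c \<odot>\<^bsub>V\<^esub> x \<oplus>\<^bsub>V\<^esub> d \<odot>\<^bsub>V\<^esub> x"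
    and "\<And>c x y. x \<in> carrier V \<Longrightarrow> y \<in> carrier V \<Longrightarrow>
      c \<odot>\<^bsub>V\<^esub> (x \<oplus>\<^bsub>V\<^esub> y) = c \<odot>\<^bsub>V\<^esub> x \<oplus>\<^bsub>V\<^esub> c \<odot>\<^bsub>V\<^esub> y"
    and "\<And>c d x. x \<in> carrier V \<Longrightarrow> (c * d) \<odot>\<^bsub>V\<^esub> x = c \<odot>\<^bsub>V\<^esub> (d \<odot>\<^bsub>V\<^esub> x)"
    and "\<And>x. x \<in> carrier V \<Longrightarrow> 1 \<odot>\<^bsub>V\<^esub> x = x"
    and "\<And>x. x \<in> carrier V \<Longrightarrow> 0 \<odot>\<^bsub>V\<^esub> x = \<zero>\<^bsub>V\<^esub>"
    and "\<And>c. c \<odot>\<^bsub>V\<^esub> \<zero>\<^bsub>V\<^esub> = \<zero>\<^bsub>V\<^esub>"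
    and "\<And>x. x \<in> carrier V \<Longrightarrow> (-1) \<odot>\<^bsub>V\<^esub> x = \<ominus>\<^bsub>V\<^esub> x"
proof -
  interpret V: module "ring_of_type_algebra :: 'k ring" V by fact
  show "abelian_group V" by (rule V.abelian_group_axioms)
  show "x \<oplus>\<^bsub>V\<^esub> y \<in> carrier V" if "x \<in> carrier V" "y \<in> carrier V" for x y using that by simp
  show "\<zero>\<^bsub>V\<^esub> \<in> carrier V" by simp
  show "\<ominus>\<^bsub>V\<^esub> x \<in> carrier V" if "x \<in> carrier V" for x using that by simp
  show "c \<odot>\<^bsub>V\<^esub> x \<in> carrier V" if "x \<in> carrier V" for c x using that by simp
  show distr: "(c + d) \<odot>\<^bsub>V\<^esub> x = c \<odot>\<^bsub>V\<^esub> x \<oplus>\<^bsub>V\<^esub> d \<odot>\<^bsub>V\<^esub> x" if "x \<in> carrier V" for c d x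
    using that V.smult_l_distr[of c d x] by simp
  show "c \<odot>\<^bsub>V\<^esub> (x \<oplus>\<^bsub>V\<^esub> y) = c \<odot>\<^bsub>V\<^esub> x \<oplus>\<^bsub>V\<^esub> c \<odot>\<^bsub>V\<^esub> y"
    if "x \<in> carrier V" "y \<in> carrier V" for c x y using that V.smult_r_distr[of c x y] by simp
  show "(c * d) \<odot>\<^bsub>V\<^esub> x = c \<odot>\<^bsub>V\<^esub> (d \<odot>\<^bsub>V\<^esub> x)" if "x \<in> carrier V" for c d x
    using that V.smult_assoc1[of c d x] by simp
  show one: "1 \<odot>\<^bsub>V\<^esub> x = x" if "x \<in> carrier V" for x using that V.smult_one[of x] by simp
  show zero: "0 \<odot>\<^bsub>V\<^esub> x = \<zero>\<^bsub>V\<^esub>" if "x \<in> carrier V" for x using that V.smult_l_null[of x] by simp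
  show "c \<odot>\<^bsub>V\<^esub> \<zero>\<^bsub>V\<^esub> = \<zero>\<^bsub>V\<^esub>" for c using V.smult_r_null[of c] by simp
  show "(-1) \<odot>\<^bsub>V\<^esub> x = \<ominus>\<^bsub>V\<^esub> x" if "x \<in> carrier V" for x
  proof -
    have "(-1) \<odot>\<^bsub>V\<^esub> x \<oplus>\<^bsub>V\<^esub> x = \<zero>\<^bsub>V\<^esub>"
      using distr[OF that, of "-1" 1] one zero that by simp
    then show ?thesis using that by (metis V.minus_equality V.smult_closed scalar_ring_simps(1) UNIV_I)
  qed
qed

lemma minus_eq_zero_iff:
  fixes V :: "('k::field_char_0, 'v) module"
  assumes "is_vector_space V" "x \<in> carrier V" "y \<in> carrier V"
  shows "x \<ominus>\<^bsub>V\<^esub> y = \<zero>\<^bsub>V\<^esub> \<longleftrightarrow> x = y"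
proof -
  interpret V: abelian_group V by (rule vector_space_simps(1)[OF assms(1)])
  show ?thesis
    using assms(2,3) by (metis V.minus_equality V.minus_minus V.r_neg V.a_inv_closed a_minus_def)
qed

lemma is_subspaceI:
  fixes V :: "('k::field_char_0, 'v) module"
  assumes V: "is_vector_space V" and "H \<subseteq> carrier V" "\<zero>\<^bsub>V\<^esub> \<in> H"
    and "\<And>x y. x \<in> H \<Longrightarrow> y \<in> H \<Longrightarrow> x \<oplus>\<^bsub>V\<^esub> y \<in> H"
    and smult: "\<And>c x. x \<in> H \<Longrightarrow> c \<odot>\<^bsub>V\<^esub> x \<in> H"
  shows "is_subspace H V"
proof -
  interpret V: module "ring_of_type_algebra :: 'k ring" V by fact
  show ?thesis
  proof (rule V.submoduleI)
    show "\<ominus>\<^bsub>V\<^esub> x \<in> H" if "x \<in> H" for x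
      using smult[OF that, of "-1"] vector_space_simps(12)[OF V] that assms(2) by auto
  qed (use assms in auto)
qed

lemma is_subspaceD:
  fixes V :: "('k::field_char_0, 'v) module"
  assumes V: "is_vector_space V" and H: "is_subspace H V"
  shows "H \<subseteq> carrier V" "\<zero>\<^bsub>V\<^esub> \<in> H"
    "\<And>x y. x \<in> H \<Longrightarrow> y \<in> H \<Longrightarrow> x \<oplus>\<^bsub>V\<^esub> y \<in> H"
    "\<And>c x. x \<in> H \<Longrightarrow> c \<odot>\<^bsub>V\<^esub> x \<in> H" "\<And>x. x \<in> H \<Longrightarrow> \<ominus>\<^bsub>V\<^esub> x \<in> H"
proof -
  interpret V: module "ring_of_type_algebra :: 'k ring" V by fact
  note E = V.submoduleE[OF H]
  show "H \<subseteq> carrier V" by (fact E(1))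
  show "\<zero>\<^bsub>V\<^esub> \<in> H"
  proof -
    interpret H: subgroup H "add_monoid V" using H by (simp add: submodule_def)
    show ?thesis using H.one_closed by simp
  qed
qed (use module.submoduleE[OF V H] in auto)

lemma subspace_is_vector_space:
  "is_vector_space V \<Longrightarrow> is_subspace H V \<Longrightarrow> is_vector_space (V\<lparr>carrier := H\<rparr>)"
  by (rule submodule.submodule_is_module)

lemma subspace_of_subspace:
  assumes "is_vector_space V" "is_subspace H V" "is_subspace N V" "N \<subseteq> H"
  shows "is_subspace N (V\<lparr>carrier := H\<rparr>)"
  by (rule is_subspaceI[OF subspace_is_vector_space[OF assms(1,2)]])
     (use assms(4) is_subspaceD[OF assms(1,3)] in auto)

lemma carrier_is_subspace: "is_vector_space V \<Longrightarrow> is_subspace (carrier V) V"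
  by (rule is_subspaceI) (auto simp: vector_space_simps)

lemma coset_carrier_update [simp]: "N +>\<^bsub>V\<lparr>carrier := H\<rparr>\<^esub> x = N +>\<^bsub>V\<^esub> x"
  by (simp add: a_r_coset_def r_coset_def)

context
  fixes V :: "('k::field_char_0, 'v) module" and N :: "'v set"
  assumes V: "is_vector_space V" and N: "is_subspace N V"
begin

lemma subspace_abelian_subgroup: "abelian_subgroup N V"
proof (rule abelian_subgroupI3)
  show "additive_subgroup N V"
    using N by (simp add: additive_subgroup_def submodule_def)
qed (rule vector_space_simps(1)[OF V])

lemma coset_eq_iff:
  assumes "x \<in> carrier V" "y \<in> carrier V"
  shows "N +>\<^bsub>V\<^esub> x = N +>\<^bsub>V\<^esub> y \<longleftrightarrow> x \<ominus>\<^bsub>V\<^esub> y \<in> N"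
proof -
  interpret S: abelian_subgroup N V by (rule subspace_abelian_subgroup)
  show ?thesis
    using assms S.a_rcos_module[of y x] S.a_repr_independence'[of x y] S.a_rcos_self[of x]
    by (auto simp: a_minus_def)
qed

lemma coset_self: "x \<in> carrier V \<Longrightarrow> x \<in> N +>\<^bsub>V\<^esub> x"
  by (rule abelian_subgroup.a_rcos_self[OF subspace_abelian_subgroup])

lemma coset_eqI: "x \<in> carrier V \<Longrightarrow> y \<in> N +>\<^bsub>V\<^esub> x \<Longrightarrow> N +>\<^bsub>V\<^esub> y = N +>\<^bsub>V\<^esub> x"
  using abelian_subgroup.a_repr_independence'[OF subspace_abelian_subgroup] by metis

lemma coset_subset: "x \<in> carrier V \<Longrightarrow> y \<in> N +>\<^bsub>V\<^esub> x \<Longrightarrow> y \<in> carrier V"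
  by (rule abelian_subgroup.a_elemrcos_carrier[OF subspace_abelian_subgroup])

lemma coset_eq_zero_iff:
  assumes "x \<in> carrier V"
  shows "N +>\<^bsub>V\<^esub> x = N \<longleftrightarrow> x \<in> N"
proof -
  interpret S: abelian_subgroup N V by (rule subspace_abelian_subgroup)
  show ?thesis using S.a_rcos_const[of x] S.a_rcos_self[OF assms] by auto
qed

lemma coset_add:
  assumes "x \<in> carrier V" "y \<in> carrier V"
  shows "(N +>\<^bsub>V\<^esub> x) <+>\<^bsub>V\<^esub> (N +>\<^bsub>V\<^esub> y) = N +>\<^bsub>V\<^esub> (x \<oplus>\<^bsub>V\<^esub> y)"
  by (rule abelian_subgroup.a_rcos_sum[OF subspace_abelian_subgroup assms])

lemma quotient_carrier: "carrier (quotient_space V N) = (\<lambda>x. N +>\<^bsub>V\<^esub> x) ` carrier V"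
  by (auto simp: quotient_space_def A_RCOSETS_def RCOSETS_def a_r_coset_def)

lemma quotient_add:
  "x \<in> carrier V \<Longrightarrow> y \<in> carrier V \<Longrightarrow>
    (N +>\<^bsub>V\<^esub> x) \<oplus>\<^bsub>quotient_space V N\<^esub> (N +>\<^bsub>V\<^esub> y) = N +>\<^bsub>V\<^esub> (x \<oplus>\<^bsub>V\<^esub> y)"
  by (simp add: quotient_space_def coset_add)

lemma quotient_zero: "\<zero>\<^bsub>quotient_space V N\<^esub> = N"
  by (simp add: quotient_space_def)

lemma quotient_smult:
  assumes x: "x \<in> carrier V"
  shows "c \<odot>\<^bsub>quotient_space V N\<^esub> (N +>\<^bsub>V\<^esub> x) = N +>\<^bsub>V\<^esub> (c \<odot>\<^bsub>V\<^esub> x)"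
proof -
  have "N +>\<^bsub>V\<^esub> (c \<odot>\<^bsub>V\<^esub> y) = N +>\<^bsub>V\<^esub> (c \<odot>\<^bsub>V\<^esub> x)" if y: "y \<in> N +>\<^bsub>V\<^esub> x" for y
  proof -
    have yV: "y \<in> carrier V" and yN: "y \<ominus>\<^bsub>V\<^esub> x \<in> N"
      using coset_subset[OF x y] coset_eqI[OF x y] coset_eq_iff[of y x] x by auto
    have "c \<odot>\<^bsub>V\<^esub> (y \<ominus>\<^bsub>V\<^esub> x) = c \<odot>\<^bsub>V\<^esub> y \<ominus>\<^bsub>V\<^esub> c \<odot>\<^bsub>V\<^esub> x"
      using x yV vector_space_simps(4-8)[OF V] vector_space_simps(12)[OF V, symmetric]
      by (simp add: a_minus_def mult.commute flip: vector_space_simps(8)[OF V])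
    then show ?thesis
      using is_subspaceD(4)[OF V N yN, of c] coset_eq_iff x yV vector_space_simps(5)[OF V] by metis
  qed
  then have "(\<Union>y\<in>N +>\<^bsub>V\<^esub> x. N +>\<^bsub>V\<^esub> (c \<odot>\<^bsub>V\<^esub> y)) = N +>\<^bsub>V\<^esub> (c \<odot>\<^bsub>V\<^esub> x)"
    using coset_self[OF x] by blast
  then show ?thesis by (simp add: quotient_space_def)
qed

lemma quotient_is_vector_space: "is_vector_space (quotient_space V N)"
proof -
  interpret V: abelian_group V by (rule vector_space_simps(1)[OF V])
  have zero: "\<zero>\<^bsub>quotient_space V N\<^esub> = N +>\<^bsub>V\<^esub> \<zero>\<^bsub>V\<^esub>"
    using coset_eq_zero_iff[of "\<zero>\<^bsub>V\<^esub>"] is_subspaceD(2)[OF V N] by (simp add: quotient_zero)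
  show ?thesis
    by (rule is_vector_spaceI)
       (auto simp: quotient_carrier zero quotient_add quotient_smult vector_space_simps(2-12)[OF V]
         V.a_ac)
qed

lemma coset_linear: "(\<lambda>x. N +>\<^bsub>V\<^esub> x) \<in> linear_maps V (quotient_space V N)"
  by (auto simp: linear_maps_def quotient_carrier quotient_add quotient_smult)

end

lemma linear_mapsD:
  assumes "f \<in> linear_maps V W"
  shows "x \<in> carrier V \<Longrightarrow> f x \<in> carrier W"
    and "x \<in> carrier V \<Longrightarrow> y \<in> carrier V \<Longrightarrow> f (x \<oplus>\<^bsub>V\<^esub> y) = f x \<oplus>\<^bsub>W\<^esub> f y"
    and "x \<in> carrier V \<Longrightarrow> f (c \<odot>\<^bsub>V\<^esub> x) = c \<odot>\<^bsub>W\<^esub> f x"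
  using assms by (auto simp: linear_maps_def)

lemma linear_maps_zero:
  assumes V: "is_vector_space V" and W: "is_vector_space W" and f: "f \<in> linear_maps V W"
  shows "f \<zero>\<^bsub>V\<^esub> = \<zero>\<^bsub>W\<^esub>"
  using linear_mapsD(3)[OF f, of "\<zero>\<^bsub>V\<^esub>" 0] vector_space_simps(3,10)[OF V] vector_space_simps(10)[OF W]
    linear_mapsD(1)[OF f, of "\<zero>\<^bsub>V\<^esub>"] by simp

lemma linear_maps_diff:
  assumes V: "is_vector_space V" and W: "is_vector_space W" and f: "f \<in> linear_maps V W"
    and "x \<in> carrier V" "y \<in> carrier V"
  shows "f (x \<ominus>\<^bsub>V\<^esub> y) = f x \<ominus>\<^bsub>W\<^esub> f y"
  using assms(4,5) linear_mapsD[OF f] vector_space_simps(4,5)[OF V]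
  by (simp add: a_minus_def vector_space_simps(12)[OF V, symmetric]
      vector_space_simps(12)[OF W, symmetric])

lemma linear_kernel_is_subspace:
  assumes V: "is_vector_space V" and W: "is_vector_space W" and f: "f \<in> linear_maps V W"
  shows "is_subspace {x \<in> carrier V. f x = \<zero>\<^bsub>W\<^esub>} V"
proof (rule is_subspaceI[OF V])
  interpret W: abelian_group W by (rule vector_space_simps(1)[OF W])
  show "x \<oplus>\<^bsub>V\<^esub> y \<in> {x \<in> carrier V. f x = \<zero>\<^bsub>W\<^esub>}"
    if "x \<in> {x \<in> carrier V. f x = \<zero>\<^bsub>W\<^esub>}" "y \<in> {x \<in> carrier V. f x = \<zero>\<^bsub>W\<^esub>}" for x y
    using that linear_mapsD[OF f] vector_space_simps(2)[OF V] by simp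
qed (use linear_maps_zero[OF V W f] linear_mapsD[OF f] vector_space_simps[OF V]
      vector_space_simps[OF W] in auto)

lemma linear_image_is_subspace:
  assumes V: "is_vector_space V" and W: "is_vector_space W" and f: "f \<in> linear_maps V W"
    and H: "is_subspace H V"
  shows "is_subspace (f ` H) W"
proof (rule is_subspaceI[OF W])
  note HV = is_subspaceD[OF V H]
  show "f ` H \<subseteq> carrier W" using HV(1) linear_mapsD[OF f] by auto
  show "\<zero>\<^bsub>W\<^esub> \<in> f ` H" using HV(2) linear_maps_zero[OF V W f] by (metis imageI)
  show "x \<oplus>\<^bsub>W\<^esub> y \<in> f ` H" if xy: "x \<in> f ` H" "y \<in> f ` H" for x y
  proof -
    obtain x' y' where "x' \<in> H" "y' \<in> H" "x = f x'" "y = f y'" using xy by blast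
    then show ?thesis using HV(1,3) linear_mapsD(2)[OF f, of x' y'] by (metis imageI subsetD)
  qed
  show "c \<odot>\<^bsub>W\<^esub> x \<in> f ` H" if xy: "x \<in> f ` H" for c x
  proof -
    obtain x' where "x' \<in> H" "x = f x'" using xy by blast
    then show ?thesis using HV(1,4) linear_mapsD(3)[OF f, of x'] by (metis imageI subsetD)
  qed
qed

lemma linear_maps_restrict:
  "f \<in> linear_maps V W \<Longrightarrow> H \<subseteq> carrier V \<Longrightarrow> f ` H \<subseteq> K \<Longrightarrow>
    f \<in> linear_maps (V\<lparr>carrier := H\<rparr>) (W\<lparr>carrier := K\<rparr>)"
  by (simp add: linear_maps_def subset_iff image_subset_iff)

lemma linear_maps_compose:
  "f \<in> linear_maps U V \<Longrightarrow> g \<in> linear_maps V W \<Longrightarrow> (\<lambda>x. g (f x)) \<in> linear_maps U W"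
  by (auto simp: linear_maps_def)

text \<open>Every isomorphism below is obtained from this first isomorphism theorem, since linear maps are
  easier to define on representatives than on cosets.\<close>

lemma first_isomorphism:
  assumes V: "is_vector_space V" and W: "is_vector_space W" and f: "f \<in> linear_maps V W"
    and surj: "f ` carrier V = carrier W"
    and ker: "\<And>x. x \<in> carrier V \<Longrightarrow> f x = \<zero>\<^bsub>W\<^esub> \<longleftrightarrow> x \<in> N" and "N \<subseteq> carrier V"
  shows "isomorphic (quotient_space V N) W"
proof -
  have N: "is_subspace N V"
  proof -
    have "N = {x \<in> carrier V. f x = \<zero>\<^bsub>W\<^esub>}" using ker \<open>N \<subseteq> carrier V\<close> by auto
    then show ?thesis using linear_kernel_is_subspace[OF V W f] by simp
  qed
  interpret W: abelian_group W by (rule vector_space_simps(1)[OF W])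
  interpret V: abelian_group V by (rule vector_space_simps(1)[OF V])
  define g where "g = (\<lambda>Q. f (SOME x. x \<in> Q))"
  have eq: "f x = f y \<longleftrightarrow> N +>\<^bsub>V\<^esub> x = N +>\<^bsub>V\<^esub> y" if "x \<in> carrier V" "y \<in> carrier V" for x y
    using that coset_eq_iff[OF V N that] ker[of "x \<ominus>\<^bsub>V\<^esub> y"] linear_maps_diff[OF V W f that]
      linear_mapsD(1)[OF f] by (simp add: minus_eq_zero_iff[OF W])
  have g: "g (N +>\<^bsub>V\<^esub> x) = f x" if x: "x \<in> carrier V" for x
  proof -
    let ?y = "SOME y. y \<in> N +>\<^bsub>V\<^esub> x"
    have "?y \<in> N +>\<^bsub>V\<^esub> x" using coset_self[OF V N x] by (rule someI)
    then show ?thesis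
      using eq[of ?y x] coset_eqI[OF V N x] coset_subset[OF V N x] x by (auto simp: g_def)
  qed
  show ?thesis unfolding isomorphic_def
  proof
    show "g \<in> linear_maps (quotient_space V N) W"
      using linear_mapsD[OF f] vector_space_simps(2,5)[OF V]
      by (auto simp: linear_maps_def quotient_carrier[OF V N] quotient_add[OF V N]
          quotient_smult[OF V N] g)
    show "bij_betw g (carrier (quotient_space V N)) (carrier W)"
      unfolding bij_betw_def inj_on_def quotient_carrier[OF V N]
      using surj by (auto simp: g eq image_image cong: image_cong)
  qed
qed

lemma induced_map_coset:
  assumes V: "is_vector_space V" and W: "is_vector_space W"
    and M: "is_subspace M V" and N: "is_subspace N W" and f: "f \<in> linear_maps V W"
    and fM: "f ` M \<subseteq> N" and x: "x \<in> carrier V"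
  shows "induced_map W N f (M +>\<^bsub>V\<^esub> x) = N +>\<^bsub>W\<^esub> f x"
proof -
  have "N +>\<^bsub>W\<^esub> f y = N +>\<^bsub>W\<^esub> f x" if y: "y \<in> M +>\<^bsub>V\<^esub> x" for y
  proof -
    have yV: "y \<in> carrier V" and yM: "y \<ominus>\<^bsub>V\<^esub> x \<in> M"
      using coset_subset[OF V M x y] coset_eqI[OF V M x y] coset_eq_iff[OF V M, of y x] x by auto
    then have "f y \<ominus>\<^bsub>W\<^esub> f x \<in> N" using linear_maps_diff[OF V W f yV x] fM by force
    then show ?thesis
      using coset_eq_iff[OF W N] linear_mapsD(1)[OF f] x yV by auto
  qed
  then show ?thesis using coset_self[OF V M x] unfolding induced_map_def by blast
qed

lemma induced_map_linear:
  assumes V: "is_vector_space V" and W: "is_vector_space W"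
    and M: "is_subspace M V" and N: "is_subspace N W" and f: "f \<in> linear_maps V W"
    and fM: "f ` M \<subseteq> N"
  shows "induced_map W N f \<in> linear_maps (quotient_space V M) (quotient_space W N)"
  using linear_mapsD[OF f] vector_space_simps(2,5)[OF V]
  by (auto simp: linear_maps_def quotient_carrier[OF V M] quotient_carrier[OF W N]
      quotient_add[OF V M] quotient_add[OF W N] quotient_smult[OF V M] quotient_smult[OF W N]
      induced_map_coset[OF assms])

text \<open>For a complex \<open>U \<rightarrow> V \<rightarrow> W\<close>, cohomology is a quotient of vector spaces in the sense above, so that
  the facts on cosets apply to it.\<close>

context
  fixes U :: "('k::field_char_0, 'u) module" and V :: "('k, 'v) module" and W :: "('k, 'w) module"
    and f g Z
  assumes U: "is_vector_space U" and V: "is_vector_space V" and W: "is_vector_space W"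
    and f: "f \<in> linear_maps U V" and g: "g \<in> linear_maps V W"
    and gf: "\<And>x. x \<in> carrier U \<Longrightarrow> g (f x) = \<zero>\<^bsub>W\<^esub>"
  defines "Z \<equiv> V\<lparr>carrier := {x \<in> carrier V. g x = \<zero>\<^bsub>W\<^esub>}\<rparr>"
begin

lemma cocycles_is_vector_space: "is_vector_space Z"
  unfolding Z_def by (rule subspace_is_vector_space[OF V linear_kernel_is_subspace[OF V W g]])

lemma coboundaries_is_subspace: "is_subspace (f ` carrier U) Z"
  unfolding Z_def
  by (rule subspace_of_subspace[OF V linear_kernel_is_subspace[OF V W g]
        linear_image_is_subspace[OF U V f carrier_is_subspace[OF U]]])
     (use linear_mapsD(1)[OF f] gf in auto)

lemma cohomology_at_quotient: "cohomology_at U f V g W = quotient_space Z (f ` carrier U)"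
  by (simp add: cohomology_at_def Z_def)

lemma cohomology_at_is_vector_space: "is_vector_space (cohomology_at U f V g W)"
  unfolding cohomology_at_quotient
  by (rule quotient_is_vector_space[OF cocycles_is_vector_space coboundaries_is_subspace])

end

section \<open>The spectral sequence of a bounded filtered complex\<close>

locale vector_space_char_0 = vector_space scale
  for scale :: "'k::field_char_0 \<Rightarrow> 'v::ab_group_add \<Rightarrow> 'v"
begin

definition space_on :: "'v set \<Rightarrow> ('k, 'v) module" where
  "space_on S =
     \<lparr> carrier = S, monoid.mult = undefined, one = undefined,
       ring.zero = 0, add = (+), module.smult = scale \<rparr>"

lemma space_on_simps [simp]:
  "carrier (space_on S) = S" "\<zero>\<^bsub>space_on S\<^esub> = 0" "x \<oplus>\<^bsub>space_on S\<^esub> y = x + y"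
  "c \<odot>\<^bsub>space_on S\<^esub> x = scale c x" "space_on S \<lparr>carrier := T\<rparr> = space_on T"
  by (simp_all add: space_on_def)

lemma space_on_is_vector_space: "subspace S \<Longrightarrow> is_vector_space (space_on S)"
  by (rule is_vector_spaceI)
     (auto simp: subspace_0 subspace_add subspace_scale algebra_simps)

lemma space_on_is_subspace:
  assumes "subspace S" "subspace N" "N \<subseteq> S"
  shows "is_subspace N (space_on S)"
  by (rule is_subspaceI[OF space_on_is_vector_space[OF assms(1)]])
     (use assms in \<open>auto simp: subspace_0 subspace_add subspace_scale\<close>)

lemma space_on_minus:
  assumes "subspace S" "x \<in> S" "y \<in> S"
  shows "x \<ominus>\<^bsub>space_on S\<^esub> y = x - y"
proof -
  have "\<ominus>\<^bsub>space_on S\<^esub> y = - y"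
    using vector_space_simps(12)[OF space_on_is_vector_space[OF assms(1)], of y] assms by simp
  then show ?thesis by (simp add: a_minus_def)
qed

lemma space_on_coset_eq_iff:
  assumes "subspace S" "subspace N" "N \<subseteq> S" "x \<in> S" "y \<in> S"
  shows "N +>\<^bsub>space_on S\<^esub> x = N +>\<^bsub>space_on S\<^esub> y \<longleftrightarrow> x - y \<in> N"
  using coset_eq_iff[OF space_on_is_vector_space space_on_is_subspace, OF assms(1) assms(1-3), of x y]
    assms space_on_minus by simp

lemma space_on_coset_eq_zero_iff:
  assumes "subspace S" "subspace N" "N \<subseteq> S" "x \<in> S"
  shows "N +>\<^bsub>space_on S\<^esub> x = N \<longleftrightarrow> x \<in> N"
  using coset_eq_zero_iff[OF space_on_is_vector_space space_on_is_subspace, OF assms(1) assms(1-3)]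
    assms by simp

end

text \<open>The spaces \<open>C n\<close> are subspaces of one type, so that elements can be added without reference to
  degrees and the differential is one function.\<close>

locale filtered_complex = vector_space_char_0 scale
  for scale :: "'k::field_char_0 \<Rightarrow> 'v::ab_group_add \<Rightarrow> 'v" +
  fixes C :: "int \<Rightarrow> 'v set" and d :: "'v \<Rightarrow> 'v" and F :: "int \<Rightarrow> int \<Rightarrow> 'v set"
  assumes C_subspace: "subspace (C n)"
    and d_closed: "x \<in> C n \<Longrightarrow> d x \<in> C (n + 1)"
    and d_add: "x \<in> C n \<Longrightarrow> y \<in> C n \<Longrightarrow> d (x + y) = d x + d y"
    and d_scale: "x \<in> C n \<Longrightarrow> d (scale c x) = scale c (d x)"
    and d_d: "x \<in> C n \<Longrightarrow> d (d x) = 0"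
    and F_subspace: "subspace (F p n)"
    and F_subset: "F p n \<subseteq> C n"
    and F_decreasing: "F (p + 1) n \<subseteq> F p n"
    and F_d: "x \<in> F p n \<Longrightarrow> d x \<in> F p (n + 1)"
    and F_exhaustive: "\<exists>p. F p n = C n"
    and F_separated: "\<exists>p. F p n = {0}"
begin

lemma d_zero [simp]: "d 0 = 0"
  using d_scale[of 0 0 0] C_subspace[of 0] by (simp add: subspace_0)

lemma d_diff: "x \<in> C n \<Longrightarrow> y \<in> C n \<Longrightarrow> d (x - y) = d x - d y"
  using d_add[of "x - y" n y] C_subspace[of n] by (simp add: subspace_diff)

lemma F_antimono: "p \<le> p' \<Longrightarrow> F p' n \<subseteq> F p n"
proof (induction p' rule: int_ge_induct)
  case (step i)
  then show ?case using F_decreasing[of i n] by blast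
qed simp

lemma F_antimonoD: "x \<in> F p' n \<Longrightarrow> p \<le> p' \<Longrightarrow> x \<in> F p n"
  using F_antimono by blast

text \<open>These are the classical \<open>Z\<^sub>r\<close> and \<open>B\<^sub>r\<close>: an element survives to page \<open>r\<close> if its boundary lies
  deep enough, and it vanishes there modulo higher filtration and boundaries of elements that are not
  too far down. The page \<open>r\<close> is the quotient, indexed by filtration and total degree.\<close>

definition approx_cycles :: "int \<Rightarrow> int \<Rightarrow> int \<Rightarrow> 'v set" where
  "approx_cycles r p n = {x \<in> F p n. d x \<in> F (p + r) (n + 1)}"

definition approx_boundaries :: "int \<Rightarrow> int \<Rightarrow> int \<Rightarrow> 'v set" where
  "approx_boundaries r p n = {x + d y | x y.
     x \<in> approx_cycles (r - 1) (p + 1) n \<and> y \<in> approx_cycles (r - 1) (p - r + 1) (n - 1)}"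

definition page :: "int \<Rightarrow> int \<Rightarrow> int \<Rightarrow> ('k, 'v set) module" where
  "page r p n = quotient_space (space_on (approx_cycles r p n)) (approx_boundaries r p n)"

definition page_diff :: "int \<Rightarrow> int \<Rightarrow> int \<Rightarrow> 'v set \<Rightarrow> 'v set" where
  "page_diff r p n =
     induced_map (space_on (approx_cycles r (p + r) (n + 1))) (approx_boundaries r (p + r) (n + 1)) d"

abbreviation page_class :: "int \<Rightarrow> int \<Rightarrow> int \<Rightarrow> 'v \<Rightarrow> 'v set" where
  "page_class r p n x \<equiv> approx_boundaries r p n +>\<^bsub>space_on (approx_cycles r p n)\<^esub> x"

lemma approx_cycles_in_F: "x \<in> approx_cycles r p n \<Longrightarrow> x \<in> F p n"
  and approx_cycles_in_C: "x \<in> approx_cycles r p n \<Longrightarrow> x \<in> C n"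
  and approx_cycles_d: "x \<in> approx_cycles r p n \<Longrightarrow> d x \<in> F (p + r) (n + 1)"
  using F_subset by (auto simp: approx_cycles_def)

lemma approx_cycles_subspace: "subspace (approx_cycles r p n)"
  using F_subspace[of p n] F_subspace[of "p + r" "n + 1"] F_subset[of p n]
  by (intro subspaceI)
     (auto simp: approx_cycles_def subspace_0 subspace_add subspace_scale
       d_add[of _ n] d_scale[of _ n] subset_iff)

lemma approx_cycles_mono:
  "p' \<le> p \<Longrightarrow> p' + r' \<le> p + r \<Longrightarrow> x \<in> approx_cycles r p n \<Longrightarrow> x \<in> approx_cycles r' p' n"
  using F_antimonoD by (fastforce simp: approx_cycles_def)

lemma approx_boundariesI:
  "x \<in> approx_cycles (r - 1) (p + 1) n \<Longrightarrow> y \<in> approx_cycles (r - 1) (p - r + 1) (n - 1) \<Longrightarrow>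
    x + d y \<in> approx_boundaries r p n"
  by (auto simp: approx_boundaries_def)

lemma approx_boundariesE:
  assumes "u \<in> approx_boundaries r p n"
  obtains x y where "u = x + d y" "x \<in> approx_cycles (r - 1) (p + 1) n"
    "y \<in> approx_cycles (r - 1) (p - r + 1) (n - 1)"
  using assms by (auto simp: approx_boundaries_def)

lemma approx_boundaries_subspace: "subspace (approx_boundaries r p n)"
proof (intro subspaceI)
  show "0 \<in> approx_boundaries r p n"
    using approx_boundariesI[of 0 r p n 0] approx_cycles_subspace by (simp add: subspace_0)
next
  fix u v assume "u \<in> approx_boundaries r p n" "v \<in> approx_boundaries r p n"
  then obtain x y x' y' where *: "u = x + d y" "x \<in> approx_cycles (r - 1) (p + 1) n"
      "y \<in> approx_cycles (r - 1) (p - r + 1) (n - 1)"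
      "v = x' + d y'" "x' \<in> approx_cycles (r - 1) (p + 1) n"
      "y' \<in> approx_cycles (r - 1) (p - r + 1) (n - 1)"
    by (elim approx_boundariesE)
  then have "u + v = (x + x') + d (y + y')"
    using d_add[of y "n - 1" y'] approx_cycles_in_C by (simp add: algebra_simps)
  then show "u + v \<in> approx_boundaries r p n"
    using approx_boundariesI[OF subspace_add[OF approx_cycles_subspace *(2,5)]
        subspace_add[OF approx_cycles_subspace *(3,6)]] by simp
next
  fix c u assume "u \<in> approx_boundaries r p n"
  then obtain x y where *: "u = x + d y" "x \<in> approx_cycles (r - 1) (p + 1) n"
      "y \<in> approx_cycles (r - 1) (p - r + 1) (n - 1)"
    by (elim approx_boundariesE)
  then have "scale c u = scale c x + d (scale c y)"
    using d_scale[of y "n - 1" c] approx_cycles_in_C by (simp add: scale_right_distrib)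
  then show "scale c u \<in> approx_boundaries r p n"
    using approx_boundariesI[OF subspace_scale[OF approx_cycles_subspace *(2)]
        subspace_scale[OF approx_cycles_subspace *(3)]] by simp
qed

lemma d_approx_cycles:
  assumes "x \<in> approx_cycles r p n" shows "d x \<in> approx_cycles r' (p + r) (n + 1)"
  using approx_cycles_d[OF assms] d_d[OF approx_cycles_in_C[OF assms]] F_subspace
  by (auto simp: approx_cycles_def subspace_0)

lemma approx_boundaries_subset: "approx_boundaries r p n \<subseteq> approx_cycles r p n"
proof
  fix u assume "u \<in> approx_boundaries r p n"
  then obtain x y where *: "u = x + d y" "x \<in> approx_cycles (r - 1) (p + 1) n"
      "y \<in> approx_cycles (r - 1) (p - r + 1) (n - 1)"
    by (elim approx_boundariesE)
  then show "u \<in> approx_cycles r p n"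
    using d_approx_cycles[OF *(3), of r]
    by (auto intro!: subspace_add[OF approx_cycles_subspace] elim: approx_cycles_mono[rotated 2])
qed

lemmas approx_cycles_space = space_on_is_vector_space[OF approx_cycles_subspace]
lemmas approx_boundaries_is_subspace =
  space_on_is_subspace[OF approx_cycles_subspace approx_boundaries_subspace approx_boundaries_subset]
lemmas page_class_eq_iff =
  space_on_coset_eq_iff[OF approx_cycles_subspace approx_boundaries_subspace approx_boundaries_subset]
lemmas page_class_eq_zero_iff =
  space_on_coset_eq_zero_iff[OF approx_cycles_subspace approx_boundaries_subspace
    approx_boundaries_subset]

lemma page_is_vector_space: "is_vector_space (page r p n)"
  unfolding page_def by (rule quotient_is_vector_space[OF approx_cycles_space approx_boundaries_is_subspace])

lemma page_carrier: "carrier (page r p n) = page_class r p n ` approx_cycles r p n"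
  unfolding page_def by (simp add: quotient_carrier[OF approx_cycles_space approx_boundaries_is_subspace])

lemma page_zero: "\<zero>\<^bsub>page r p n\<^esub> = approx_boundaries r p n"
  by (simp add: page_def quotient_space_def)

lemma page_class_linear: "page_class r p n \<in> linear_maps (space_on (approx_cycles r p n)) (page r p n)"
  unfolding page_def by (rule coset_linear[OF approx_cycles_space approx_boundaries_is_subspace])

lemma d_linear:
  "d \<in> linear_maps (space_on (approx_cycles r p n)) (space_on (approx_cycles r (p + r) (n + 1)))"
  using approx_cycles_in_C[of _ r p n] d_approx_cycles[of _ r p n r]
  by (auto simp: linear_maps_def d_add[of _ n] d_scale[of _ n])

lemma d_approx_boundaries:
  "d ` approx_boundaries r p n \<subseteq> approx_boundaries r (p + r) (n + 1)"
proof
  fix v assume "v \<in> d ` approx_boundaries r p n"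
  then obtain x y where *: "v = d (x + d y)" "x \<in> approx_cycles (r - 1) (p + 1) n"
      "y \<in> approx_cycles (r - 1) (p - r + 1) (n - 1)"
    by (auto elim: approx_boundariesE)
  have "v = 0 + d x"
    using * approx_cycles_in_C[OF *(2)] approx_cycles_in_C[OF *(3)] d_closed[of y "n - 1"]
    by (simp add: d_add[of _ n] d_d)
  also have "\<dots> \<in> approx_boundaries r (p + r) (n + 1)"
    using *(2) by (intro approx_boundariesI) (auto simp: subspace_0[OF approx_cycles_subspace])
  finally show "v \<in> approx_boundaries r (p + r) (n + 1)" .
qed

lemma page_diff_linear: "page_diff r p n \<in> linear_maps (page r p n) (page r (p + r) (n + 1))"
  unfolding page_def page_diff_def
  by (rule induced_map_linear[OF approx_cycles_space approx_cycles_space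
        approx_boundaries_is_subspace approx_boundaries_is_subspace d_linear d_approx_boundaries])

lemma page_diff_class:
  "x \<in> approx_cycles r p n \<Longrightarrow> page_diff r p n (page_class r p n x) = page_class r (p + r) (n + 1) (d x)"
  unfolding page_diff_def
  by (rule induced_map_coset[OF approx_cycles_space approx_cycles_space
        approx_boundaries_is_subspace approx_boundaries_is_subspace d_linear d_approx_boundaries]) simp

lemma page_diff_class_zero_iff:
  "x \<in> approx_cycles r p n \<Longrightarrow>
    page_diff r p n (page_class r p n x) = \<zero>\<^bsub>page r (p + r) (n + 1)\<^esub>
      \<longleftrightarrow> d x \<in> approx_boundaries r (p + r) (n + 1)"
  by (simp add: page_diff_class page_zero page_class_eq_zero_iff d_approx_cycles)

lemma page_diff_page_diff:
  assumes "y \<in> carrier (page r p n)"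
  shows "page_diff r (p + r) (n + 1) (page_diff r p n y) = \<zero>\<^bsub>page r (p + r + r) (n + 1 + 1)\<^esub>"
proof -
  obtain x where x: "y = page_class r p n x" "x \<in> approx_cycles r p n"
    using assms by (auto simp: page_carrier)
  then show ?thesis
    using d_d[OF approx_cycles_in_C[OF x(2)]] subspace_0[OF approx_boundaries_subspace]
      page_diff_class_zero_iff[OF d_approx_cycles[OF x(2), of r]]
    by (simp add: page_diff_class)
qed

text \<open>Passing from \<open>Z\<^sub>r/B\<^sub>r\<close> to \<open>Z\<^sub>r\<^sub>+\<^sub>1/B\<^sub>r\<^sub>+\<^sub>1\<close>: if the class of \<open>x\<close> is a cocycle, then \<open>d x\<close> differs
  from an element of higher filtration only by some \<open>d z\<close> with \<open>z\<close> of higher filtration than \<open>x\<close>; so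
  \<open>x - z\<close> represents the same class and survives to page \<open>r + 1\<close>. The kernel of the resulting
  surjection consists of the boundaries that were added in \<open>B\<^sub>r\<^sub>+\<^sub>1\<close>.\<close>

lemma next_page_isomorphic:
  "isomorphic (page (r + 1) p n)
     (cohomology_at (page r (p - r) (n - 1)) (page_diff r (p - r) (n - 1)) (page r p n)
        (page_diff r p n) (page r (p + r) (n + 1)))"
proof -
  let ?f = "page_diff r (p - r) (n - 1)" and ?g = "page_diff r p n"
  let ?U = "page r (p - r) (n - 1)"
  let ?W = "cohomology_at ?U ?f (page r p n) ?g (page r (p + r) (n + 1))"
  let ?Z = "(page r p n)\<lparr>carrier := {x \<in> carrier (page r p n). ?g x = \<zero>\<^bsub>page r (p + r) (n + 1)\<^esub>}\<rparr>"
  let ?B = "?f ` carrier ?U"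
  have lin: "?f \<in> linear_maps ?U (page r p n)" using page_diff_linear[of r "p - r" "n - 1"] by simp
  note coh = page_is_vector_space page_is_vector_space page_is_vector_space lin page_diff_linear
  have dd: "?g (?f y) = \<zero>\<^bsub>page r (p + r) (n + 1)\<^esub>" if "y \<in> carrier ?U" for y
    using page_diff_page_diff[OF that] by simp
  have W: "is_vector_space ?W" by (rule cohomology_at_is_vector_space[OF coh dd])
  have Z: "is_vector_space ?Z" and B: "is_subspace ?B ?Z"
    by (rule cocycles_is_vector_space[OF coh(1-5) dd] coboundaries_is_subspace[OF coh(1-5) dd], assumption)+
  have W_eq: "?W = quotient_space ?Z ?B" by (rule cohomology_at_quotient[OF coh dd])
  have cyc: "x \<in> approx_cycles r p n" "page_class r p n x \<in> carrier ?Z"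
    if x: "x \<in> approx_cycles (r + 1) p n" for x
  proof -
    show *: "x \<in> approx_cycles r p n" using approx_cycles_mono[OF _ _ x] by simp
    have "d x \<in> approx_boundaries r (p + r) (n + 1)"
      using approx_boundariesI[of "d x" r "p + r" "n + 1" 0] d_approx_cycles[OF x, of "r - 1"]
        subspace_0[OF approx_cycles_subspace] by (simp add: add.assoc)
    then show "page_class r p n x \<in> carrier ?Z"
      using * by (simp add: page_diff_class_zero_iff page_carrier)
  qed
  let ?\<phi> = "\<lambda>x. ?B +>\<^bsub>?Z\<^esub> page_class r p n x"
  show ?thesis unfolding page_def[of "r + 1"]
  proof (rule first_isomorphism[OF approx_cycles_space W])
    show "?\<phi> \<in> linear_maps (space_on (approx_cycles (r + 1) p n)) ?W"
      unfolding W_eq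
    proof (rule linear_maps_compose[OF _ coset_linear[OF Z B]])
      show "page_class r p n \<in> linear_maps (space_on (approx_cycles (r + 1) p n)) ?Z"
        using linear_maps_restrict[OF page_class_linear[of r p n], of "approx_cycles (r + 1) p n"
            "carrier ?Z"] cyc by auto
    qed
    show "?\<phi> ` carrier (space_on (approx_cycles (r + 1) p n)) = carrier ?W"
      unfolding W_eq quotient_carrier[OF Z B]
    proof (intro equalityI subsetI)
      fix w assume "w \<in> (\<lambda>y. ?B +>\<^bsub>?Z\<^esub> y) ` carrier ?Z"
      then obtain x where x: "w = ?\<phi> x" "x \<in> approx_cycles r p n"
          "d x \<in> approx_boundaries r (p + r) (n + 1)"
        by (auto simp: page_carrier page_diff_class_zero_iff)
      obtain u z where u: "d x = u + d z" "u \<in> approx_cycles (r - 1) (p + r + 1) (n + 1)"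
          and z: "z \<in> approx_cycles (r - 1) (p + 1) n"
        using x(3) by (auto elim: approx_boundariesE)
      have zr: "z \<in> approx_cycles r p n"
        using approx_cycles_mono[OF _ _ z] by simp
      have "d (x - z) = u"
        using u d_diff[OF approx_cycles_in_C[OF x(2)] approx_cycles_in_C[OF z]] by simp
      then have xz: "x - z \<in> approx_cycles (r + 1) p n"
        using approx_cycles_in_F[OF u(2)] approx_cycles_in_F[OF subspace_diff[OF approx_cycles_subspace x(2) zr]]
        by (simp add: approx_cycles_def add.assoc)
      have "z \<in> approx_boundaries r p n"
        using approx_boundariesI[OF z, of 0] subspace_0[OF approx_cycles_subspace] by simp
      then have "page_class r p n (x - z) = page_class r p n x"
        using page_class_eq_iff[of "x - z" r p n x] x(2) subspace_diff[OF approx_cycles_subspace x(2) zr]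
          subspace_neg[OF approx_boundaries_subspace] by simp
      then show "w \<in> ?\<phi> ` carrier (space_on (approx_cycles (r + 1) p n))"
        using xz x(1) by (intro image_eqI[of _ _ "x - z"]) simp_all
    qed (use cyc in auto)
    fix x assume "x \<in> carrier (space_on (approx_cycles (r + 1) p n))"
    then have x: "x \<in> approx_cycles (r + 1) p n" by simp
    have "?\<phi> x = \<zero>\<^bsub>?W\<^esub> \<longleftrightarrow> page_class r p n x \<in> ?B"
      unfolding W_eq quotient_zero[OF Z B] by (rule coset_eq_zero_iff[OF Z B cyc(2)[OF x]])
    also have "\<dots> \<longleftrightarrow> (\<exists>w\<in>approx_cycles r (p - r) (n - 1). x - d w \<in> approx_boundaries r p n)"
    proof -
      have "page_class r p n x = ?f (page_class r (p - r) (n - 1) w) \<longleftrightarrow> x - d w \<in> approx_boundaries r p n"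
        if w: "w \<in> approx_cycles r (p - r) (n - 1)" for w
        using page_diff_class[OF w] d_approx_cycles[OF w, of r] cyc(1)[OF x]
        by (simp add: page_class_eq_iff)
      then show ?thesis by (auto simp: page_carrier)
    qed
    also have "\<dots> \<longleftrightarrow> x \<in> approx_boundaries (r + 1) p n"
    proof
      assume "\<exists>w\<in>approx_cycles r (p - r) (n - 1). x - d w \<in> approx_boundaries r p n"
      then obtain w z y where w: "w \<in> approx_cycles r (p - r) (n - 1)" and eq: "x - d w = z + d y"
          and z: "z \<in> approx_cycles (r - 1) (p + 1) n"
          and y: "y \<in> approx_cycles (r - 1) (p - r + 1) (n - 1)"
        by (auto elim: approx_boundariesE)
      have y': "y \<in> approx_cycles r (p - r) (n - 1)"
        using approx_cycles_mono[OF _ _ y] by simp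
      have x_eq: "x = z + d (w + y)"
        using eq d_add[OF approx_cycles_in_C[OF w] approx_cycles_in_C[OF y]] by (simp add: algebra_simps)
      have wy: "w + y \<in> approx_cycles r (p - r) (n - 1)"
        by (rule subspace_add[OF approx_cycles_subspace w y'])
      have "d x = d z"
        using x_eq d_add[of z n "d (w + y)"] d_d[OF approx_cycles_in_C[OF wy]]
          d_closed[OF approx_cycles_in_C[OF wy]] approx_cycles_in_C[OF z] by simp
      then have "z \<in> approx_cycles r (p + 1) n"
        using approx_cycles_d[OF x] approx_cycles_in_F[OF z] by (simp add: approx_cycles_def add_ac)
      then show "x \<in> approx_boundaries (r + 1) p n"
        using approx_boundariesI[of z "r + 1" p n "w + y"] wy x_eq by simp
    next
      assume "x \<in> approx_boundaries (r + 1) p n"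
      then obtain z y where eq: "x = z + d y" and z: "z \<in> approx_cycles r (p + 1) n"
          and y: "y \<in> approx_cycles r (p - r) (n - 1)"
        by (auto elim: approx_boundariesE)
      have "z \<in> approx_cycles (r - 1) (p + 1) n" using approx_cycles_mono[OF _ _ z] by simp
      then have "z \<in> approx_boundaries r p n"
        using approx_boundariesI[of z r p n 0] subspace_0[OF approx_cycles_subspace] by simp
      then show "\<exists>w\<in>approx_cycles r (p - r) (n - 1). x - d w \<in> approx_boundaries r p n"
        using y eq by force
    qed
    finally show "?\<phi> x = \<zero>\<^bsub>?W\<^esub> \<longleftrightarrow> x \<in> approx_boundaries (r + 1) p n" .
  qed (use approx_boundaries_subset in simp)
qed

definition E_page :: "nat \<Rightarrow> int \<Rightarrow> int \<Rightarrow> ('k, 'v set) module" where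
  "E_page r p q = page (int r) p (p + q)"

definition E_diff :: "nat \<Rightarrow> int \<Rightarrow> int \<Rightarrow> 'v set \<Rightarrow> 'v set" where
  "E_diff r p q = page_diff (int r) p (p + q)"

lemma spectral_sequence_E: "spectral_sequence a E_page E_diff"
  unfolding spectral_sequence_def
proof (intro allI impI conjI ballI)
  fix r :: nat and p q :: int
  have idx: "p + int r + (q - int r + 1) = p + q + 1"
    "p + int r + int r + (q - int r + 1 - int r + 1) = p + q + 1 + 1"
    "p - int r + (q + int r - 1) = p + q - 1" by simp_all
  show "is_vector_space (E_page r p q)" by (simp add: E_page_def page_is_vector_space)
  show "E_diff r p q \<in> linear_maps (E_page r p q) (E_page r (p + int r) (q - int r + 1))"
    unfolding E_page_def E_diff_def idx by (rule page_diff_linear)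
  show "E_diff r (p + int r) (q - int r + 1) (E_diff r p q x)
      = \<zero>\<^bsub>E_page r (p + int r + int r) (q - int r + 1 - int r + 1)\<^esub>"
    if "x \<in> carrier (E_page r p q)" for x
    using that unfolding E_page_def E_diff_def idx by (rule page_diff_page_diff)
  show "isomorphic (E_page (r + 1) p q)
     (cohomology_at (E_page r (p - int r) (q + int r - 1)) (E_diff r (p - int r) (q + int r - 1))
       (E_page r p q) (E_diff r p q) (E_page r (p + int r) (q - int r + 1)))"
    unfolding E_page_def E_diff_def idx of_nat_add of_nat_1 by (rule next_page_isomorphic)
qed

lemma approx_cycles_stable:
  assumes "F P (n + 1) = {0}" "P \<le> p + r"
  shows "approx_cycles r p n = {x \<in> F p n. d x = 0}"
  using F_antimono[OF assms(2), of "n + 1"] assms(1) F_subspace[of "p + r" "n + 1"]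
  by (auto simp: approx_cycles_def subspace_0)

text \<open>The limit may be any model \<open>H\<close> of the cohomology, given by a surjection \<open>\<pi>\<close> from the cocycles whose
  kernel consists of the coboundaries. It is filtered by the images of the cocycles of filtration \<open>p\<close>.
  For large \<open>r\<close> boundedness turns \<open>Z\<^sub>r\<close> into the cocycles of filtration \<open>p\<close>, and \<open>B\<^sub>r\<close> into those
  among them that are cohomologous to a cocycle of filtration \<open>p + 1\<close>.\<close>

theorem converges:
  fixes H :: "int \<Rightarrow> ('k, 'h) module"
  assumes H: "\<And>n. is_vector_space (H n)"
    and \<pi>: "\<And>n. \<pi> n \<in> linear_maps (space_on {x \<in> C n. d x = 0}) (H n)"
    and surj: "\<And>n. \<pi> n ` {x \<in> C n. d x = 0} = carrier (H n)"
    and ker: "\<And>n x. x \<in> C n \<Longrightarrow> d x = 0 \<Longrightarrow> \<pi> n x = \<zero>\<^bsub>H n\<^esub> \<longleftrightarrow> x \<in> d ` C (n - 1)"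
  shows "converges_to a E_page E_diff H"
proof -
  define FH where "FH n p = \<pi> n ` {x \<in> F p n. d x = 0}" for n p
  have FZ: "subspace {x \<in> F p n. d x = 0}" for p n
    using F_subspace[of p n] F_subset[of p n]
    by (intro subspaceI)
       (auto simp: subspace_0 subspace_add subspace_scale d_add[of _ n] d_scale[of _ n] subset_iff)
  have CZ: "subspace {x \<in> C n. d x = 0}" for n
  proof -
    obtain p where "F p n = C n" using F_exhaustive by blast
    then show ?thesis using FZ[of p n] by simp
  qed
  note CZV = space_on_is_vector_space[OF CZ]
  have \<pi>_diff: "\<pi> n (x - y) = \<pi> n x \<ominus>\<^bsub>H n\<^esub> \<pi> n y"
    if "x \<in> C n" "d x = 0" "y \<in> C n" "d y = 0" for n x y
    using linear_maps_diff[OF CZV H \<pi>, of x n y] that space_on_minus[OF CZ, of x n y] by simp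
  have FH_subspace: "is_subspace (FH n p) (H n)" for n p
    unfolding FH_def
    by (rule linear_image_is_subspace[OF CZV H \<pi> space_on_is_subspace[OF CZ FZ]])
       (use F_subset[of p n] in auto)
  have FH_antimono: "FH n (p + 1) \<subseteq> FH n p" for n p
    unfolding FH_def using F_decreasing[of p n] by (intro image_mono) blast
  have filtration: "finite_decreasing_filtration (H n) (FH n)" for n
    unfolding finite_decreasing_filtration_def
  proof (intro conjI allI)
    show "is_subspace (FH n p) (H n)" for p by (rule FH_subspace)
    show "FH n (p + 1) \<subseteq> FH n p" for p by (rule FH_antimono)
    obtain p where "F p n = C n" using F_exhaustive by blast
    then have "FH n p = carrier (H n)" by (simp add: FH_def surj)
    then show "\<exists>p. FH n p = carrier (H n)" ..
    obtain p where "F p n = {0}" using F_separated by blast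
    then have "{x \<in> F p n. d x = 0} = {0}" using d_zero by blast
    then have "FH n p = {\<zero>\<^bsub>H n\<^esub>}"
      using linear_maps_zero[OF CZV H \<pi>, of n] by (simp add: FH_def)
    then show "\<exists>p. FH n p = {\<zero>\<^bsub>H n\<^esub>}" ..
  qed
  have "\<exists>r\<^sub>0\<ge>a. stable_from r\<^sub>0 E_page E_diff p q \<and> isomorphic (E_page r\<^sub>0 p q)
      (quotient_space ((H (p + q))\<lparr>carrier := FH (p + q) p\<rparr>) (FH (p + q) (p + 1)))" for p q
  proof -
    define n where "n = p + q"
    obtain P where P: "F P (n + 1) = {0}" using F_separated by blast
    obtain Q where Q: "F Q (n - 1) = C (n - 1)" using F_exhaustive by blast
    have F_all: "F i (n - 1) = C (n - 1)" if "i \<le> Q" for i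
      using F_antimono[OF that, of "n - 1"] F_subset[of i "n - 1"] Q by blast
    \<comment> \<open>From this page on, differentials leaving \<open>(p, q)\<close> land in filtration \<open>\<ge> P\<close>, and those entering
      it start in filtration \<open>\<le> Q\<close>.\<close>
    define r\<^sub>0 where "r\<^sub>0 = max a (nat (max (P - p) (p + 1 - Q)))"
    have r\<^sub>0: "P \<le> p + int r" "p - int r + 1 \<le> Q" if "r\<^sub>0 \<le> r" for r using that by (auto simp: r\<^sub>0_def)
    have "stable_from r\<^sub>0 E_page E_diff p q"
      unfolding stable_from_def
    proof (intro allI impI conjI ballI)
      fix r assume r: "r\<^sub>0 \<le> r"
      fix y assume "y \<in> carrier (E_page r p q)"
      then obtain x where x: "y = page_class (int r) p n x" "x \<in> approx_cycles (int r) p n"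
        by (auto simp: E_page_def page_carrier n_def)
      then have "d x = 0" using approx_cycles_stable[OF P r\<^sub>0(1)[OF r]] by auto
      then have "page_diff (int r) p n y = \<zero>\<^bsub>page (int r) (p + int r) (n + 1)\<^esub>"
        using x subspace_0[OF approx_boundaries_subspace] by (simp add: page_diff_class_zero_iff)
      moreover have idx: "p + int r + (q - int r + 1) = n + 1" by (simp add: n_def)
      ultimately show "E_diff r p q y = \<zero>\<^bsub>E_page r (p + int r) (q - int r + 1)\<^esub>"
        unfolding E_diff_def E_page_def idx n_def[symmetric] by simp
    next
      fix r assume r: "r\<^sub>0 \<le> r"
      fix y assume y: "y \<in> carrier (E_page r (p - int r) (q + int r - 1))"
      have idx: "p - int r + (q + int r - 1) = n - 1" by (simp add: n_def)
      obtain x where x: "y = page_class (int r) (p - int r) (n - 1) x"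
          "x \<in> approx_cycles (int r) (p - int r) (n - 1)"
        using y by (auto simp: E_page_def page_carrier idx)
      have "x \<in> approx_cycles (int r - 1) (p - int r + 1) (n - 1)"
        using approx_cycles_in_C[OF x(2)] approx_cycles_d[OF x(2)] F_all[OF r\<^sub>0(2)[OF r]]
        by (simp add: approx_cycles_def)
      then have "0 + d x \<in> approx_boundaries (int r) p n"
        by (intro approx_boundariesI) (auto simp: subspace_0[OF approx_cycles_subspace])
      then have "page_diff (int r) (p - int r) (n - 1) y = \<zero>\<^bsub>page (int r) p n\<^esub>"
        using x page_diff_class_zero_iff[OF x(2)] by simp
      then show "E_diff r (p - int r) (q + int r - 1) y = \<zero>\<^bsub>E_page r p q\<^esub>"
        unfolding E_diff_def E_page_def idx by (simp add: n_def)
    qed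
    moreover have "isomorphic (E_page r\<^sub>0 p q)
        (quotient_space ((H n)\<lparr>carrier := FH n p\<rparr>) (FH n (p + 1)))"
      unfolding E_page_def page_def n_def[symmetric]
    proof (rule first_isomorphism[OF approx_cycles_space])
      let ?r = "int r\<^sub>0"
      let ?H = "(H n)\<lparr>carrier := FH n p\<rparr>"
      have cyc: "approx_cycles ?r p n = {x \<in> F p n. d x = 0}"
        by (rule approx_cycles_stable[OF P r\<^sub>0(1)]) simp
      have cyc': "approx_cycles (?r - 1) (p + 1) n = {x \<in> F (p + 1) n. d x = 0}"
        by (rule approx_cycles_stable[OF P]) (use r\<^sub>0(1)[of r\<^sub>0] in simp)
      have HV: "is_vector_space ?H" by (rule subspace_is_vector_space[OF H FH_subspace])
      have HN: "is_subspace (FH n (p + 1)) ?H"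
        by (rule subspace_of_subspace[OF H FH_subspace FH_subspace FH_antimono])
      let ?\<phi> = "\<lambda>x. FH n (p + 1) +>\<^bsub>?H\<^esub> \<pi> n x"
      show "is_vector_space (quotient_space ?H (FH n (p + 1)))"
        by (rule quotient_is_vector_space[OF HV HN])
      show "?\<phi> \<in> linear_maps (space_on (approx_cycles ?r p n)) (quotient_space ?H (FH n (p + 1)))"
      proof (rule linear_maps_compose[OF _ coset_linear[OF HV HN]])
        show "\<pi> n \<in> linear_maps (space_on (approx_cycles ?r p n)) ?H"
          using linear_maps_restrict[OF \<pi>[of n], of "approx_cycles ?r p n" "FH n p"] F_subset[of p n]
          by (auto simp: cyc FH_def)
      qed
      show "?\<phi> ` carrier (space_on (approx_cycles ?r p n)) = carrier (quotient_space ?H (FH n (p + 1)))"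
        unfolding quotient_carrier[OF HV HN] by (auto simp: cyc FH_def)
      fix x assume "x \<in> carrier (space_on (approx_cycles ?r p n))"
      then have x: "x \<in> F p n" "x \<in> C n" "d x = 0" using F_subset[of p n] by (auto simp: cyc)
      have "?\<phi> x = \<zero>\<^bsub>quotient_space ?H (FH n (p + 1))\<^esub> \<longleftrightarrow> \<pi> n x \<in> FH n (p + 1)"
        unfolding quotient_zero[OF HV HN] by (rule coset_eq_zero_iff[OF HV HN]) (use x in \<open>auto simp: FH_def\<close>)
      also have "\<dots> \<longleftrightarrow> (\<exists>z\<in>F (p + 1) n. d z = 0 \<and> x - z \<in> d ` C (n - 1))"
      proof -
        have "\<pi> n x = \<pi> n z \<longleftrightarrow> x - z \<in> d ` C (n - 1)" if z: "z \<in> F (p + 1) n" "d z = 0" for z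
        proof -
          have zC: "z \<in> C n" using z F_subset by blast
          then have "x - z \<in> C n" "d (x - z) = 0"
            using x z C_subspace[of n] by (simp_all add: subspace_diff d_diff[of x n z])
          then show ?thesis
            using ker[of "x - z" n] \<pi>_diff[OF x(2,3) zC z(2)] x zC z(2)
              minus_eq_zero_iff[OF H, of "\<pi> n x" n "\<pi> n z"] linear_mapsD(1)[OF \<pi>, of _ n] by simp
        qed
        moreover have "\<pi> n x \<in> FH n (p + 1) \<longleftrightarrow> (\<exists>z\<in>F (p + 1) n. d z = 0 \<and> \<pi> n x = \<pi> n z)"
          unfolding FH_def by blast
        ultimately show ?thesis by (simp cong: conj_cong)
      qed
      also have "\<dots> \<longleftrightarrow> x \<in> approx_boundaries ?r p n"
      proof
        assume "\<exists>z\<in>F (p + 1) n. d z = 0 \<and> x - z \<in> d ` C (n - 1)"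
        then obtain z y where z: "z \<in> F (p + 1) n" "d z = 0" and y: "y \<in> C (n - 1)" "x - z = d y"
          by auto
        have "z \<in> F p n" using z F_decreasing by blast
        then have "d y \<in> F p n" using x F_subspace[of p n] by (simp add: subspace_diff flip: y(2))
        then have "y \<in> approx_cycles (?r - 1) (p - ?r + 1) (n - 1)"
          using y F_all[of "p - ?r + 1"] r\<^sub>0(2)[of r\<^sub>0] by (simp add: approx_cycles_def)
        then have "z + d y \<in> approx_boundaries ?r p n"
          using z by (intro approx_boundariesI) (auto simp: cyc')
        then show "x \<in> approx_boundaries ?r p n" by (simp flip: y(2))
      next
        assume "x \<in> approx_boundaries ?r p n"
        then obtain z y where "x = z + d y" "z \<in> approx_cycles (?r - 1) (p + 1) n"
            "y \<in> approx_cycles (?r - 1) (p - ?r + 1) (n - 1)"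
          by (elim approx_boundariesE)
        then show "\<exists>z\<in>F (p + 1) n. d z = 0 \<and> x - z \<in> d ` C (n - 1)"
          using approx_cycles_in_C by (auto simp: cyc')
      qed
      finally show "?\<phi> x = \<zero>\<^bsub>quotient_space ?H (FH n (p + 1))\<^esub> \<longleftrightarrow> x \<in> approx_boundaries ?r p n" .
    qed (use approx_boundaries_subset in simp)
    ultimately show ?thesis unfolding n_def by (intro exI[of _ r\<^sub>0]) (simp add: r\<^sub>0_def)
  qed
  then show ?thesis unfolding converges_to_def using filtration by blast
qed

end

section \<open>Connes' operators on cyclic modules\<close>

text \<open>A cyclic module with an extra degeneracy \<open>s\<close>, in cochain form. The signs \<open>(-1)\<^sup>i\<close> of the faces and
  \<open>(-1)\<^sup>n\<close> of the rotation are part of the operators, which is why rotations and faces commute without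
  signs whereas faces anticommute. All relations that involve the last face are expressed by the
  rotation.\<close>

locale cyclic_cochains =
  fixes C :: "nat \<Rightarrow> 'v::ab_group_add set"
    and t :: "nat \<Rightarrow> 'v \<Rightarrow> 'v" and face :: "nat \<Rightarrow> nat \<Rightarrow> 'v \<Rightarrow> 'v" and s :: "nat \<Rightarrow> 'v \<Rightarrow> 'v"
  assumes C_zero: "0 \<in> C n"
    and C_add: "f \<in> C n \<Longrightarrow> g \<in> C n \<Longrightarrow> f + g \<in> C n"
    and C_uminus: "f \<in> C n \<Longrightarrow> - f \<in> C n"
    and t_closed: "f \<in> C n \<Longrightarrow> t n f \<in> C n"
    and t_add: "f \<in> C n \<Longrightarrow> g \<in> C n \<Longrightarrow> t n (f + g) = t n f + t n g"
    and face_closed: "f \<in> C n \<Longrightarrow> i \<le> n \<Longrightarrow> face n i f \<in> C (Suc n)"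
    and face_add: "f \<in> C n \<Longrightarrow> g \<in> C n \<Longrightarrow> i \<le> n \<Longrightarrow> face n i (f + g) = face n i f + face n i g"
    and s_closed: "f \<in> C (Suc n) \<Longrightarrow> s n f \<in> C n"
    and s_add: "f \<in> C (Suc n) \<Longrightarrow> g \<in> C (Suc n) \<Longrightarrow> s n (f + g) = s n f + s n g"
    and face_face: "f \<in> C n \<Longrightarrow> i \<le> j \<Longrightarrow> j \<le> n \<Longrightarrow>
      face (Suc n) i (face n j f) = - face (Suc n) (Suc j) (face n i f)"
    and face_t_face: "f \<in> C n \<Longrightarrow>
      face (Suc n) 0 (t (Suc n) (face n 0 f)) = - t (Suc (Suc n)) (face (Suc n) 0 (face n 0 f))"
    and t_face: "f \<in> C n \<Longrightarrow> i < n \<Longrightarrow> t (Suc n) (face n (Suc i) f) = face n i (t n f)"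
    and t_t_face: "f \<in> C n \<Longrightarrow> t (Suc n) (t (Suc n) (face n 0 f)) = face n n (t n f)"
    and t_power: "f \<in> C n \<Longrightarrow> (t n ^^ Suc n) f = f"
    and s_face_last: "f \<in> C n \<Longrightarrow> s n (face n n f) = f"
    and s_face: "f \<in> C (Suc n) \<Longrightarrow> i \<le> n \<Longrightarrow> s (Suc n) (face (Suc n) i f) = - face n i (s n f)"
begin

text \<open>The face that multiplies the last entry into the first is the only one involving a cyclic
  rotation.\<close>

definition c :: "nat \<Rightarrow> nat \<Rightarrow> 'v \<Rightarrow> 'v" where
  "c n i f = (if i \<le> n then face n i f else t (Suc n) (face n 0 f))"

definition b :: "nat \<Rightarrow> 'v \<Rightarrow> 'v" where "b n f = (\<Sum>i\<le>Suc n. c n i f)"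
definition b' :: "nat \<Rightarrow> 'v \<Rightarrow> 'v" where "b' n f = (\<Sum>i\<le>n. c n i f)"
definition N :: "nat \<Rightarrow> 'v \<Rightarrow> 'v" where "N n f = (\<Sum>i\<le>n. (t n ^^ i) f)"
definition B :: "nat \<Rightarrow> 'v \<Rightarrow> 'v" where "B n f = N n (s n (f - t (Suc n) f))"

lemma C_diff: "f \<in> C n \<Longrightarrow> g \<in> C n \<Longrightarrow> f - g \<in> C n"
  using C_add[of f n "- g"] C_uminus[of g n] by simp

lemma C_sum: "(\<And>i. i \<in> I \<Longrightarrow> g i \<in> C n) \<Longrightarrow> sum g I \<in> C n"
  by (induction I rule: infinite_finite_induct) (auto simp: C_zero C_add)

lemma additive_zero:
  assumes "\<And>f g. f \<in> C n \<Longrightarrow> g \<in> C n \<Longrightarrow> h (f + g) = h f + (h g :: 'v)"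
  shows "h 0 = 0"
  using assms[of 0 0] C_zero by simp

lemma additive_uminus:
  assumes "\<And>f g. f \<in> C n \<Longrightarrow> g \<in> C n \<Longrightarrow> h (f + g) = h f + (h g :: 'v)" "f \<in> C n"
  shows "h (- f) = - h f"
  using assms(1)[of f "- f"] additive_zero[of n h] assms(2) C_uminus
  by (metis assms(1) add.right_inverse add_eq_0_iff)

lemma additive_diff:
  assumes h: "\<And>f g. f \<in> C n \<Longrightarrow> g \<in> C n \<Longrightarrow> h (f + g) = h f + (h g :: 'v)" and "f \<in> C n" "g \<in> C n"
  shows "h (f - g) = h f - h g"
  using h[of f "- g"] additive_uminus[of n h g] assms C_uminus by simp

lemma additive_sum:
  assumes h: "\<And>f g. f \<in> C n \<Longrightarrow> g \<in> C n \<Longrightarrow> h (f + g) = h f + (h g :: 'v)"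
    and "\<And>i. i \<in> I \<Longrightarrow> g i \<in> C n"
  shows "h (sum g I) = (\<Sum>i\<in>I. h (g i))"
  using assms(2)
  by (induction I rule: infinite_finite_induct) (auto simp: additive_zero[of n h] h C_sum)

lemma c_closed: "f \<in> C n \<Longrightarrow> i \<le> Suc n \<Longrightarrow> c n i f \<in> C (Suc n)"
  by (auto simp: c_def face_closed t_closed)

lemma c_add: "f \<in> C n \<Longrightarrow> g \<in> C n \<Longrightarrow> c n i (f + g) = c n i f + c n i g"
  by (auto simp: c_def face_add face_closed t_add)

lemma t_pow_closed: "f \<in> C n \<Longrightarrow> (t n ^^ k) f \<in> C n"
  by (induction k) (auto simp: t_closed)

lemma t_pow_add: "f \<in> C n \<Longrightarrow> g \<in> C n \<Longrightarrow> (t n ^^ k) (f + g) = (t n ^^ k) f + (t n ^^ k) g"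
  by (induction k) (auto simp: t_add t_pow_closed)

lemma N_closed: "f \<in> C n \<Longrightarrow> N n f \<in> C n"
  unfolding N_def by (intro C_sum t_pow_closed)

lemma N_add: "f \<in> C n \<Longrightarrow> g \<in> C n \<Longrightarrow> N n (f + g) = N n f + N n g"
  by (simp add: N_def t_pow_add sum.distrib)

lemma b_closed: "f \<in> C n \<Longrightarrow> b n f \<in> C (Suc n)"
  unfolding b_def by (intro C_sum c_closed) auto

lemma b'_closed: "f \<in> C n \<Longrightarrow> b' n f \<in> C (Suc n)"
  unfolding b'_def by (intro C_sum c_closed) auto

lemma b_add: "f \<in> C n \<Longrightarrow> g \<in> C n \<Longrightarrow> b n (f + g) = b n f + b n g"
  unfolding b_def by (simp only: c_add sum.distrib)

lemma b'_add: "f \<in> C n \<Longrightarrow> g \<in> C n \<Longrightarrow> b' n (f + g) = b' n f + b' n g"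
  unfolding b'_def by (simp only: c_add sum.distrib)

lemma N_zero: "N n 0 = 0"
  by (rule additive_zero[of "n"]) (rule N_add)

lemma s_zero: "s n 0 = 0"
  by (rule additive_zero[of "(Suc n)"]) (rule s_add)

lemma N_diff: "f \<in> C n \<Longrightarrow> g \<in> C n \<Longrightarrow> N n (f - g) = N n f - N n g"
  by (rule additive_diff[of "n"]) (rule N_add)

lemma b'_diff: "f \<in> C n \<Longrightarrow> g \<in> C n \<Longrightarrow> b' n (f - g) = b' n f - b' n g"
  by (rule additive_diff[of "n"]) (rule b'_add)

lemma t_uminus: "f \<in> C n \<Longrightarrow> t n (- f) = - t n f"
  by (rule additive_uminus[of n]) (rule t_add)

lemma B_closed: "f \<in> C (Suc n) \<Longrightarrow> B n f \<in> C n"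
  unfolding B_def by (intro N_closed s_closed C_diff t_closed)

lemma B_add: "f \<in> C (Suc n) \<Longrightarrow> g \<in> C (Suc n) \<Longrightarrow> B n (f + g) = B n f + B n g"
proof -
  assume f: "f \<in> C (Suc n)" and g: "g \<in> C (Suc n)"
  have "f + g - t (Suc n) (f + g) = (f - t (Suc n) f) + (g - t (Suc n) g)"
    using f g by (simp add: t_add)
  then show ?thesis
    using f g unfolding B_def by (simp only: s_add C_diff t_closed N_add s_closed)
qed

lemma t_c: "f \<in> C n \<Longrightarrow> i \<le> n \<Longrightarrow> t (Suc n) (c n (Suc i) f) = c n i (t n f)"
  using t_face[of f n i] t_t_face[of f n] by (cases "i = n") (auto simp: c_def)

lemma c_c:
  assumes f: "f \<in> C n" and "i \<le> j" "j \<le> Suc n"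
  shows "c (Suc n) i (c n j f) = - c (Suc n) (Suc j) (c n i f)"
proof (cases "j \<le> n")
  case True
  then show ?thesis using face_face[OF f \<open>i \<le> j\<close>] \<open>i \<le> j\<close> by (simp add: c_def)
next
  case False
  then have j: "j = Suc n" using assms by simp
  have c0: "face n 0 f = c n 0 f" by (simp add: c_def)
  \<comment> \<open>Rotating once reduces the relation for the last face to that for the face \<open>0\<close>.\<close>
  have zero: "c (Suc n) (Suc i) (c n 0 f) = - c (Suc n) 0 (c n i f)" if "i \<le> Suc n" for i
  proof (cases "i \<le> n")
    case True
    then show ?thesis using face_face[OF f, of 0 i] by (simp add: c_def)
  next
    case False
    then have "i = Suc n" using that by simp
    then show ?thesis using face_t_face[OF f] by (simp add: c_def)
  qed
  have cc: "c (Suc n) 0 (c n i f) \<in> C (Suc (Suc n))"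
    using assms j by (intro c_closed f) auto
  have "c (Suc n) i (c n j f) = c (Suc n) i (t (Suc n) (c n 0 f))"
    by (simp add: c_def[of n] j)
  also have "\<dots> = t (Suc (Suc n)) (c (Suc n) (Suc i) (c n 0 f))"
    using t_c[of "c n 0 f" "Suc n" i] c_closed[OF f, of 0] assms j by simp
  also have "\<dots> = - t (Suc (Suc n)) (c (Suc n) 0 (c n i f))"
    using zero[of i] assms j cc by (simp add: t_uminus)
  also have "\<dots> = - c (Suc n) (Suc j) (c n i f)"
    by (simp add: c_def[of "Suc n"] j)
  finally show ?thesis .
qed

text \<open>The terms \<open>c\<^sub>i c\<^sub>j\<close> with \<open>i \<le> j\<close> cancel against those with \<open>i > j\<close>.\<close>

lemma b_b:
  assumes f: "f \<in> C n" shows "b (Suc n) (b n f) = 0"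
proof -
  let ?I = "{(i, j). i \<le> j \<and> j \<le> Suc n}" and ?J = "{(i, j). j < i \<and> i \<le> Suc (Suc n)}"
  let ?g = "\<lambda>(i, j). c (Suc n) i (c n j f)"
  have fin: "finite ?I" "finite ?J"
    by (rule finite_subset[of _ "{..Suc (Suc n)} \<times> {..Suc (Suc n)}"], auto)+
  have "b (Suc n) (b n f) = (\<Sum>i\<le>Suc (Suc n). \<Sum>j\<le>Suc n. c (Suc n) i (c n j f))"
    unfolding b_def
  proof (rule sum.cong[OF refl])
    fix i
    show "c (Suc n) i (\<Sum>j\<le>Suc n. c n j f) = (\<Sum>j\<le>Suc n. c (Suc n) i (c n j f))"
      using additive_sum[of "Suc n" "c (Suc n) i" "{..Suc n}" "\<lambda>j. c n j f"] c_closed[OF f] c_add by auto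
  qed
  also have "\<dots> = sum ?g ({..Suc (Suc n)} \<times> {..Suc n})"
    by (rule sum.cartesian_product)
  also have "{..Suc (Suc n)} \<times> {..Suc n} = ?I \<union> ?J" by auto
  also have "sum ?g (?I \<union> ?J) = sum ?g ?I + sum ?g ?J"
    using fin by (intro sum.union_disjoint) auto
  also have "sum ?g ?I = - (\<Sum>(i, j)\<in>?I. c (Suc n) (Suc j) (c n i f))"
    unfolding sum_negf[symmetric] by (intro sum.cong) (auto simp: c_c[OF f])
  also have "(\<Sum>(i, j)\<in>?I. c (Suc n) (Suc j) (c n i f)) = sum ?g ?J"
    by (rule sum.reindex_bij_witness[of _ "\<lambda>(i, j). (j, i - 1)" "\<lambda>(i, j). (Suc j, i)"]) auto
  finally show ?thesis by simp
qed

lemma N_t: assumes f: "f \<in> C n" shows "N n (t n f) = N n f"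
proof -
  have "N n (t n f) + f = (\<Sum>i\<le>n. (t n ^^ Suc i) f) + (t n ^^ 0) f"
    by (simp add: N_def funpow_swap1)
  also have "\<dots> = (\<Sum>i\<le>Suc n. (t n ^^ i) f)"
    by (subst sum.atMost_Suc_shift) simp
  also have "\<dots> = N n f + f"
    using t_power[OF f] by (simp add: N_def)
  finally show ?thesis by simp
qed

lemma t_N: assumes f: "f \<in> C n" shows "t n (N n f) = N n f"
proof -
  have "t n (N n f) = (\<Sum>i\<le>n. t n ((t n ^^ i) f))"
    unfolding N_def by (rule additive_sum[of n]) (auto simp: t_add t_pow_closed[OF f])
  also have "\<dots> = N n (t n f)" by (simp add: N_def funpow_swap1)
  finally show ?thesis using N_t[OF f] by simp
qed

lemma t_pow_N: "f \<in> C n \<Longrightarrow> (t n ^^ k) (N n f) = N n f"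
  by (induction k) (auto simp: t_N)

lemma N_t_pow: "f \<in> C n \<Longrightarrow> N n ((t n ^^ k) f) = N n f"
  by (induction k) (auto simp: N_t t_pow_closed)

lemma t_pow_c: "f \<in> C n \<Longrightarrow> i \<le> Suc n \<Longrightarrow> (t (Suc n) ^^ i) (c n i f) = c n 0 ((t n ^^ i) f)"
proof (induction i arbitrary: f)
  case (Suc i)
  have "(t (Suc n) ^^ Suc i) (c n (Suc i) f) = (t (Suc n) ^^ i) (c n i (t n f))"
    using t_c[of f n i] Suc.prems by (simp add: funpow_swap1)
  also have "\<dots> = c n 0 ((t n ^^ i) (t n f))" using Suc.IH[of "t n f"] Suc.prems t_closed by simp
  finally show ?case by (simp add: funpow_swap1)
qed simp

text \<open>Both sides equal \<open>N c\<^sub>0 N\<close>, since \<open>c\<^sub>i\<close> is conjugate to \<open>c\<^sub>0\<close> under powers of the rotation.\<close>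

lemma b_N: assumes f: "f \<in> C n" shows "b n (N n f) = N (Suc n) (b' n f)"
proof -
  have "N (Suc n) (b' n f) = (\<Sum>i\<le>n. N (Suc n) (c n i f))"
    unfolding b'_def by (rule additive_sum[of "Suc n"]) (auto simp: N_add c_closed[OF f])
  also have "\<dots> = (\<Sum>i\<le>n. N (Suc n) (c n 0 ((t n ^^ i) f)))"
  proof (intro sum.cong refl)
    fix i assume "i \<in> {..n}"
    then show "N (Suc n) (c n i f) = N (Suc n) (c n 0 ((t n ^^ i) f))"
      using N_t_pow[of "c n i f" "Suc n" i] c_closed[OF f, of i] t_pow_c[OF f, of i] by simp
  qed
  also have "\<dots> = N (Suc n) (c n 0 (N n f))"
  proof -
    have "c n 0 (N n f) = (\<Sum>i\<le>n. c n 0 ((t n ^^ i) f))"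
      unfolding N_def by (rule additive_sum[of n]) (auto simp: c_add t_pow_closed[OF f])
    then show ?thesis
      using additive_sum[of "Suc n" "N (Suc n)" "{..n}" "\<lambda>i. c n 0 ((t n ^^ i) f)"] N_add
        c_closed[OF t_pow_closed[OF f]] by simp
  qed
  finally have L: "N (Suc n) (b' n f) = N (Suc n) (c n 0 (N n f))" .
  define g where "g = c n 0 (N n f)"
  have g: "g \<in> C (Suc n)" using c_closed[OF N_closed[OF f]] by (simp add: g_def)
  have "b n (N n f) = (\<Sum>i\<le>Suc n. (t (Suc n) ^^ (Suc n - i)) (t (Suc n) g))"
    unfolding b_def
  proof (intro sum.cong refl)
    fix i assume i: "i \<in> {..Suc n}"
    have cC: "c n i (N n f) \<in> C (Suc n)" using i by (intro c_closed N_closed f) auto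
    have "c n i (N n f) = (t (Suc n) ^^ (Suc (Suc n) - i + i)) (c n i (N n f))"
      using t_power[OF cC] i by simp
    also have "\<dots> = (t (Suc n) ^^ (Suc (Suc n) - i)) g"
      using t_pow_c[OF N_closed[OF f], of i] i t_pow_N[OF f] unfolding funpow_add by (simp add: g_def)
    also have "Suc (Suc n) - i = Suc (Suc n - i)" using i by auto
    finally show "c n i (N n f) = (t (Suc n) ^^ (Suc n - i)) (t (Suc n) g)" by (simp add: funpow_swap1)
  qed
  also have "\<dots> = N (Suc n) (t (Suc n) g)"
    unfolding N_def by (rule sum.reindex_bij_witness[of _ "\<lambda>i. Suc n - i" "\<lambda>i. Suc n - i"]) auto
  finally show ?thesis using L N_t[OF g] by (simp add: g_def)
qed

text \<open>Rotating \<open>b f\<close> shifts each face by one; only the last face is left over.\<close>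

lemma b_minus_t_b:
  assumes f: "f \<in> C n" shows "b n f - t (Suc n) (b n f) = b' n (f - t n f)"
proof -
  have "t (Suc n) (b n f) = (\<Sum>i\<le>Suc n. t (Suc n) (c n i f))"
    unfolding b_def by (rule additive_sum[of "Suc n"]) (auto simp: t_add c_closed[OF f])
  also have "\<dots> = t (Suc n) (c n 0 f) + (\<Sum>i\<le>n. t (Suc n) (c n (Suc i) f))"
    by (rule sum.atMost_Suc_shift)
  also have "t (Suc n) (c n 0 f) = c n (Suc n) f" by (simp add: c_def)
  also have "(\<Sum>i\<le>n. t (Suc n) (c n (Suc i) f)) = b' n (t n f)"
    unfolding b'_def by (intro sum.cong) (auto simp: t_c[OF f])
  finally show ?thesis
    using b'_diff[OF f t_closed[OF f]] by (simp add: b_def b'_def)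
qed

lemma s_b'_0: "f \<in> C 0 \<Longrightarrow> s 0 (b' 0 f) = f"
  using s_face_last[of f 0] by (simp add: b'_def c_def)

text \<open>The extra degeneracy is a contracting homotopy for \<open>b'\<close>. This is what makes \<open>bB + Bb\<close> vanish below:
  \<open>b N s (1 - t) = N b' s (1 - t)\<close> and \<open>N s (1 - t) b = N s b' (1 - t)\<close> add up to \<open>N (1 - t) = 0\<close>.\<close>

lemma s_b': assumes f: "f \<in> C (Suc n)" shows "s (Suc n) (b' (Suc n) f) = f - b' n (s n f)"
proof -
  have "s (Suc n) (b' (Suc n) f) = (\<Sum>i\<le>Suc n. s (Suc n) (c (Suc n) i f))"
    unfolding b'_def by (rule additive_sum[of "Suc (Suc n)"]) (auto simp: s_add c_closed[OF f])
  also have "\<dots> = (\<Sum>i\<le>n. s (Suc n) (c (Suc n) i f)) + f"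
    using s_face_last[OF f] by (simp add: c_def)
  also have "(\<Sum>i\<le>n. s (Suc n) (c (Suc n) i f)) = (\<Sum>i\<le>n. - c n i (s n f))"
    by (intro sum.cong) (auto simp: c_def s_face[OF f])
  finally show ?thesis by (simp add: b'_def sum_negf)
qed

lemma B_B: assumes f: "f \<in> C (Suc (Suc n))" shows "B n (B (Suc n) f) = 0"
proof -
  have "B (Suc n) f = t (Suc n) (B (Suc n) f)"
    unfolding B_def using f by (simp add: t_N s_closed C_diff t_closed)
  then show ?thesis by (simp add: B_def[of n] s_zero N_zero)
qed

lemma B_b_0: assumes f: "f \<in> C 0" shows "B 0 (b 0 f) = 0"
proof -
  have "t 0 f = f" using t_power[OF f] by simp
  then show ?thesis
    using b_minus_t_b[OF f] s_b'_0[OF C_zero] by (simp add: B_def N_zero)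
qed

lemma b_B: assumes f: "f \<in> C (Suc n)" shows "b n (B n f) + B (Suc n) (b (Suc n) f) = 0"
proof -
  define g where "g = f - t (Suc n) f"
  have g: "g \<in> C (Suc n)" using f by (simp add: g_def C_diff t_closed)
  have "N (Suc n) g = 0" using f by (simp add: g_def N_diff t_closed N_t)
  have "b n (B n f) = N (Suc n) (b' n (s n g))"
    unfolding B_def g_def[symmetric] by (rule b_N[OF s_closed[OF g]])
  also have "b' n (s n g) = g - s (Suc n) (b' (Suc n) g)"
    using s_b'[OF g] by simp
  also have "N (Suc n) \<dots> = - N (Suc n) (s (Suc n) (b' (Suc n) g))"
    using \<open>N (Suc n) g = 0\<close> g by (simp add: N_diff s_closed b'_closed)
  also have "b' (Suc n) g = b (Suc n) f - t (Suc (Suc n)) (b (Suc n) f)"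
    using b_minus_t_b[OF f] by (simp add: g_def)
  finally show ?thesis by (simp add: B_def)
qed

end

text \<open>Compatibility with the rotation, the face \<open>0\<close> and the degeneracy suffices for compatibility with
  \<open>b\<close> and \<open>B\<close>.\<close>

locale cyclic_morphism =
  source: cyclic_cochains C t face s + target: cyclic_cochains C' t' face' s'
  for C :: "nat \<Rightarrow> 'v::ab_group_add set" and t face s
    and C' :: "nat \<Rightarrow> 'v set" and t' face' s' +
  fixes h :: "nat \<Rightarrow> 'v \<Rightarrow> 'v"
  assumes h_closed: "f \<in> C n \<Longrightarrow> h n f \<in> C' n"
    and h_add: "f \<in> C n \<Longrightarrow> g \<in> C n \<Longrightarrow> h n (f + g) = h n f + h n g"
    and h_t: "f \<in> C n \<Longrightarrow> h n (t n f) = t' n (h n f)"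
    and h_face_0: "f \<in> C n \<Longrightarrow> h (Suc n) (face n 0 f) = face' n 0 (h n f)"
    and h_s: "f \<in> C (Suc n) \<Longrightarrow> h n (s n f) = s' n (h (Suc n) f)"
begin

lemma h_t_pow: "f \<in> C n \<Longrightarrow> h n ((t n ^^ k) f) = (t' n ^^ k) (h n f)"
  by (induction k) (auto simp: h_t source.t_pow_closed)

text \<open>The other faces are conjugates of the face \<open>0\<close> under the rotation.\<close>

lemma h_face: "f \<in> C n \<Longrightarrow> i \<le> n \<Longrightarrow> h (Suc n) (face n i f) = face' n i (h n f)"
proof (induction i arbitrary: f)
  case (Suc i)
  let ?k = "Suc n"
  have eq: "face n (Suc i) f = (t (Suc n) ^^ ?k) (face n i (t n f))"
    using source.t_power[OF source.face_closed, of f n "Suc i"] source.t_face[of f n i] Suc.prems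
    by (metis Suc_le_eq funpow_swap1 funpow.simps(2) comp_apply)
  have eq': "face' n (Suc i) (h n f) = (t' (Suc n) ^^ ?k) (face' n i (t' n (h n f)))"
    using target.t_power[OF target.face_closed, of "h n f" n "Suc i"] target.t_face[of "h n f" n i] Suc.prems
      h_closed by (metis Suc_le_eq funpow_swap1 funpow.simps(2) comp_apply)
  have "h (Suc n) (face n (Suc i) f) = (t' (Suc n) ^^ ?k) (h (Suc n) (face n i (t n f)))"
    unfolding eq using Suc.prems by (intro h_t_pow source.face_closed source.t_closed) auto
  also have "h (Suc n) (face n i (t n f)) = face' n i (t' n (h n f))"
    using Suc.IH[of "t n f"] Suc.prems source.t_closed h_t by simp
  finally show ?case using eq' by simp
qed (simp add: h_face_0)

lemma h_sum: "(\<And>i. i \<in> I \<Longrightarrow> g i \<in> C n) \<Longrightarrow> h n (sum g I) = (\<Sum>i\<in>I. h n (g i))"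
  by (rule source.additive_sum[of n]) (auto simp: h_add)

lemma h_b: assumes f: "f \<in> C n" shows "h (Suc n) (source.b n f) = target.b n (h n f)"
proof -
  have "h (Suc n) (source.b n f) = (\<Sum>i\<le>Suc n. h (Suc n) (source.c n i f))"
    unfolding source.b_def by (rule h_sum) (auto simp: source.c_closed[OF f])
  also have "\<dots> = (\<Sum>i\<le>Suc n. target.c n i (h n f))"
    by (intro sum.cong refl)
       (auto simp: source.c_def target.c_def h_face f h_t source.face_closed)
  finally show ?thesis by (simp add: target.b_def)
qed

lemma h_B: assumes f: "f \<in> C (Suc n)" shows "h n (source.B n f) = target.B n (h (Suc n) f)"
proof -
  have d: "h (Suc n) (f - t (Suc n) f) = h (Suc n) f - t' (Suc n) (h (Suc n) f)"
    using h_add[of "f - t (Suc n) f" "Suc n" "t (Suc n) f"] f h_t[OF f]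
    by (simp add: source.C_diff source.t_closed eq_diff_eq)
  have N: "h n (source.N n g) = target.N n (h n g)" if "g \<in> C n" for g
    unfolding source.N_def target.N_def using h_sum[of "{..n}" "\<lambda>i. (t n ^^ i) g" n] that
    by (simp add: source.t_pow_closed h_t_pow)
  show ?thesis
    unfolding source.B_def target.B_def
    using f by (simp add: N h_s d source.s_closed source.C_diff source.t_closed)
qed

end

section \<open>Tensor powers\<close>

lemma equalizer_is_subspace:
  assumes V: "is_vector_space V" and W: "is_vector_space W"
    and f: "f \<in> linear_maps V W" and g: "g \<in> linear_maps V W"
  shows "is_subspace {x \<in> carrier V. f x = g x} V"
proof (rule is_subspaceI[OF V])
  show "\<zero>\<^bsub>V\<^esub> \<in> {x \<in> carrier V. f x = g x}"
    using linear_maps_zero[OF V W f] linear_maps_zero[OF V W g] vector_space_simps(3)[OF V] by simp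
  show "x \<oplus>\<^bsub>V\<^esub> y \<in> {x \<in> carrier V. f x = g x}"
    if "x \<in> {x \<in> carrier V. f x = g x}" "y \<in> {x \<in> carrier V. f x = g x}" for x y
    using that linear_mapsD(2)[OF f, of x y] linear_mapsD(2)[OF g, of x y] vector_space_simps(2)[OF V, of x y]
    by simp
  show "c \<odot>\<^bsub>V\<^esub> x \<in> {x \<in> carrier V. f x = g x}" if "x \<in> {x \<in> carrier V. f x = g x}" for c x
    using that linear_mapsD(3)[OF f, of x c] linear_mapsD(3)[OF g, of x c] vector_space_simps(5)[OF V, of x c]
    by simp
qed auto

lemma linear_hull_is_subspace:
  assumes V: "is_vector_space V" and S: "S \<subseteq> carrier V"
  shows "is_subspace (linear_hull V S) V"
proof (rule is_subspaceI[OF V])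
  show "linear_hull V S \<subseteq> carrier V"
    using carrier_is_subspace[OF V] S by (auto simp: linear_hull_def)
qed (use is_subspaceD[OF V] in \<open>fastforce simp: linear_hull_def\<close>)+

lemma linear_hull_superset: "S \<subseteq> linear_hull V S"
  by (auto simp: linear_hull_def)

lemma linear_hull_minimal: "is_subspace H V \<Longrightarrow> S \<subseteq> H \<Longrightarrow> linear_hull V S \<subseteq> H"
  by (auto simp: linear_hull_def)

abbreviation free_scale :: "'k::field_char_0 \<Rightarrow> ('x \<Rightarrow>\<^sub>0 'k) \<Rightarrow> ('x \<Rightarrow>\<^sub>0 'k)" where
  "free_scale c \<equiv> Poly_Mapping.map ((*) c)"

lemma lookup_free_scale [simp]: "Poly_Mapping.lookup (free_scale c x) a = c * Poly_Mapping.lookup x a"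
  by (simp add: map.rep_eq when_def)

interpretation free: vector_space_char_0 free_scale
  by unfold_locales (auto intro!: poly_mapping_eqI simp: lookup_add algebra_simps)

context vector_space_char_0
begin

definition lift :: "('x \<Rightarrow> 'v) \<Rightarrow> ('x \<Rightarrow>\<^sub>0 'k) \<Rightarrow> 'v" where
  "lift G x = (\<Sum>a\<in>Poly_Mapping.keys x. scale (Poly_Mapping.lookup x a) (G a))"

lemma lift_superset:
  assumes "finite S" "Poly_Mapping.keys x \<subseteq> S"
  shows "lift G x = (\<Sum>a\<in>S. scale (Poly_Mapping.lookup x a) (G a))"
  unfolding lift_def using assms
  by (intro sum.mono_neutral_left) (auto simp: in_keys_iff)

lemma lift_single [simp]: "lift G (Poly_Mapping.single a c) = scale c (G a)"
  by (auto simp: lift_def)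

lemma lift_add: "lift G (x + y) = lift G x + lift G y"
  using lift_superset[of "Poly_Mapping.keys x \<union> Poly_Mapping.keys y" x G]
    lift_superset[of "Poly_Mapping.keys x \<union> Poly_Mapping.keys y" y G]
    lift_superset[of "Poly_Mapping.keys x \<union> Poly_Mapping.keys y" "x + y" G] Poly_Mapping.keys_add[of x y]
  by (simp add: lookup_add scale_left_distrib sum.distrib)

lemma lift_scale: "lift G (free_scale c x) = scale c (lift G x)"
proof -
  have "lift G (free_scale c x)
      = (\<Sum>a\<in>Poly_Mapping.keys x. scale (Poly_Mapping.lookup (free_scale c x) a) (G a))"
    by (rule lift_superset) (auto simp: in_keys_iff)
  then show ?thesis by (simp add: lift_def scale_sum_right)
qed

lemma lift_diff: "lift G (x - y) = lift G x - lift G y"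
  using lift_add[of G "x - y" y] by simp

end

interpretation scalars: vector_space_char_0 "(*) :: 'k::field_char_0 \<Rightarrow> _"
  by unfold_locales (auto simp: algebra_simps)

(* As a rewrite rule this would undo associativity of multiplication. *)
declare scalars.scale_scale [simp del]

lemma free_space_eq: "free_space n = free.space_on {x. \<forall>as\<in>Poly_Mapping.keys x. length as = n}"
  by (simp add: free_space_def free.space_on_def)

lemma free_space_carrier_subspace: "free.subspace {x. \<forall>as\<in>Poly_Mapping.keys x. length as = n}"
  by (rule free.subspaceI) (auto simp: in_keys_iff lookup_add)

lemma free_space_is_vector_space: "is_vector_space (free_space n)"
  unfolding free_space_eq by (rule free.space_on_is_vector_space[OF free_space_carrier_subspace])

lemma free_space_simps [simp]:
  "Poly_Mapping.single as c \<in> carrier (free_space n) \<longleftrightarrow> c = 0 \<or> length as = n"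
  "\<zero>\<^bsub>free_space n\<^esub> = 0" "x \<oplus>\<^bsub>free_space n\<^esub> y = x + y" "c \<odot>\<^bsub>free_space n\<^esub> x = free_scale c x"
  by (auto simp: free_space_def)

lemma free_space_minus:
  "x \<in> carrier (free_space n) \<Longrightarrow> y \<in> carrier (free_space n) \<Longrightarrow> x \<ominus>\<^bsub>free_space n\<^esub> y = x - y"
  unfolding free_space_eq by (rule free.space_on_minus[OF free_space_carrier_subspace]) simp_all

lemma free_space_diff_closed:
  "x \<in> carrier (free_space n) \<Longrightarrow> y \<in> carrier (free_space n) \<Longrightarrow> x - y \<in> carrier (free_space n)"
  using free.subspace_diff[OF free_space_carrier_subspace] by (simp add: free_space_eq)

lemma free_space_sum_closed:
  "(\<And>i. i \<in> I \<Longrightarrow> g i \<in> carrier (free_space n)) \<Longrightarrow> sum g I \<in> carrier (free_space n)"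
  using free.subspace_sum[OF free_space_carrier_subspace, of I g] by (simp add: free_space_eq)

lemma free_subspace: "is_subspace K (free_space n) \<Longrightarrow> free.subspace K"
  using is_subspaceD(2-4)[OF free_space_is_vector_space, of K n] by (intro free.subspaceI) simp_all

abbreviation homogs :: "('k, 'a) dga_data \<Rightarrow> 'a list \<Rightarrow> nat list \<Rightarrow> bool" where
  "homogs A \<equiv> list_all2 (\<lambda>x d. x \<in> homog A d)"

lemma homog_list_iff: "homog_list A n as ds \<longleftrightarrow> length as = n \<and> homogs A as ds"
  by (auto simp: homog_list_def list_all2_conv_all_nth)

context dga
begin

lemma free_space_vs: "is_vector_space (free_space n :: ('k, 'a list \<Rightarrow>\<^sub>0 'k) module)"
  by (rule free_space_is_vector_space)

abbreviation "T n \<equiv> tensor_power A n"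
abbreviation "rel n \<equiv> tensor_relations A n"

lemma tensor_relations_is_subspace: "is_subspace (rel n) (free_space n)"
  unfolding tensor_relations_def
proof (rule linear_hull_is_subspace[OF free_space_vs])
qed (auto intro!: free_space_diff_closed)

lemma tensor_relations_add:
  assumes "length us + Suc (length vs) = n"
  shows "Poly_Mapping.single (us @ (x + y) # vs) 1 - Poly_Mapping.single (us @ x # vs) 1
    - Poly_Mapping.single (us @ y # vs) 1 \<in> rel n"
  unfolding tensor_relations_def
  by (rule subsetD[OF linear_hull_superset], rule UnI1, rule CollectI,
      rule exI[of _ "us @ x # vs"], rule exI[of _ "length us"], rule exI[of _ x], rule exI[of _ y])
     (use assms in auto)

lemma tensor_relations_scale:
  assumes "length us + Suc (length vs) = n"
  shows "Poly_Mapping.single (us @ scl A c x # vs) 1 - Poly_Mapping.single (us @ x # vs) c \<in> rel n"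
  unfolding tensor_relations_def
  by (rule subsetD[OF linear_hull_superset], rule UnI2, rule CollectI,
      rule exI[of _ "us @ x # vs"], rule exI[of _ "length us"], rule exI[of _ c], rule exI[of _ x])
     (use assms in auto)

lemma tensor_relations_minimal:
  assumes K: "is_subspace K (free_space n)"
    and add: "\<And>us vs x y. length us + Suc (length vs) = n \<Longrightarrow>
      Poly_Mapping.single (us @ (x + y) # vs) 1 - Poly_Mapping.single (us @ x # vs) 1
      - Poly_Mapping.single (us @ y # vs) 1 \<in> K"
    and scale: "\<And>us vs c x. length us + Suc (length vs) = n \<Longrightarrow>
      Poly_Mapping.single (us @ scl A c x # vs) 1 - Poly_Mapping.single (us @ x # vs) c \<in> K"
  shows "rel n \<subseteq> K"
proof -
  have "length (take i as) + Suc (length (drop (Suc i) as)) = n" if "length as = n" "i < n" for as :: "'a list" and i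
    using that by simp
  then show ?thesis
    unfolding tensor_relations_def
    by (intro linear_hull_minimal[OF K]) (auto simp: upd_conv_take_nth_drop add scale)
qed

lemma tensor_power_is_vector_space: "is_vector_space (T n)"
  unfolding tensor_power_def
  by (rule quotient_is_vector_space[OF free_space_vs tensor_relations_is_subspace])

lemma tens_eq: "tens A as = rel (length as) +>\<^bsub>free_space (length as)\<^esub> Poly_Mapping.single as 1"
  by (rule tens_def)

lemma tens_in_tensor_power [simp]: "length as = n \<Longrightarrow> tens A as \<in> carrier (T n)"
  unfolding tens_eq tensor_power_def
  by (simp add: quotient_carrier[OF free_space_vs tensor_relations_is_subspace])

lemma tens_add:
  assumes n: "length us + Suc (length vs) = n"
  shows "tens A (us @ (x + y) # vs) = tens A (us @ x # vs) \<oplus>\<^bsub>T n\<^esub> tens A (us @ y # vs)"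
proof -
  note FR = free_space_vs tensor_relations_is_subspace
  have "tens A (us @ x # vs) \<oplus>\<^bsub>T n\<^esub> tens A (us @ y # vs) = rel n +>\<^bsub>free_space n\<^esub>
      (Poly_Mapping.single (us @ x # vs) 1 + Poly_Mapping.single (us @ y # vs) 1)"
    using quotient_add[OF FR, of "Poly_Mapping.single (us @ x # vs) 1" n
        "Poly_Mapping.single (us @ y # vs) 1"] n
    by (simp add: tens_eq tensor_power_def)
  moreover have "rel n +>\<^bsub>free_space n\<^esub> Poly_Mapping.single (us @ (x + y) # vs) 1 = rel n +>\<^bsub>free_space n\<^esub>
      (Poly_Mapping.single (us @ x # vs) 1 + Poly_Mapping.single (us @ y # vs) 1)"
    using tensor_relations_add[OF n, of x y] n
      vector_space_simps(2)[OF free_space_vs[of n],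
        of "Poly_Mapping.single (us @ x # vs) 1" "Poly_Mapping.single (us @ y # vs) 1"]
    by (subst coset_eq_iff[OF FR]) (auto simp: free_space_minus algebra_simps)
  ultimately show ?thesis using n by (simp add: tens_eq)
qed

lemma tens_scale:
  assumes n: "length us + Suc (length vs) = n"
  shows "tens A (us @ scl A c x # vs) = c \<odot>\<^bsub>T n\<^esub> tens A (us @ x # vs)"
proof -
  note FR = free_space_vs tensor_relations_is_subspace
  have single: "free_scale c (Poly_Mapping.single (us @ x # vs) 1) = Poly_Mapping.single (us @ x # vs) c"
    by (rule poly_mapping_eqI) (simp add: lookup_single when_def)
  have "c \<odot>\<^bsub>T n\<^esub> tens A (us @ x # vs) = rel n +>\<^bsub>free_space n\<^esub> Poly_Mapping.single (us @ x # vs) c"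
    using quotient_smult[OF FR, of "Poly_Mapping.single (us @ x # vs) 1" n c] n single
    by (simp add: tens_eq tensor_power_def)
  moreover have "rel n +>\<^bsub>free_space n\<^esub> Poly_Mapping.single (us @ scl A c x # vs) 1
      = rel n +>\<^bsub>free_space n\<^esub> Poly_Mapping.single (us @ x # vs) c"
    using tensor_relations_scale[OF n, of c x] n
    by (subst coset_eq_iff[OF FR]) (auto simp: free_space_minus)
  ultimately show ?thesis using n by (simp add: tens_eq)
qed

lemma tens_zero:
  assumes n: "length us + Suc (length vs) = n"
  shows "tens A (us @ 0 # vs) = \<zero>\<^bsub>T n\<^esub>"
  using tens_scale[OF n, of 0 0] vector_space_simps(10)[OF tensor_power_is_vector_space, of "tens A (us @ 0 # vs)" n] n
  by simp

text \<open>Linear maps out of a tensor power are determined by their values on tensors of homogeneous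
  elements: decompose the entries one after the other.\<close>

lemma tensor_power_induct:
  assumes H: "is_subspace H (T n)"
    and homog: "\<And>as ds. length as = n \<Longrightarrow> homogs A as ds \<Longrightarrow> tens A as \<in> H"
  shows "carrier (T n) \<subseteq> H"
proof -
  note HD = is_subspaceD[OF tensor_power_is_vector_space H]
  have tens_H: "tens A (us @ vs) \<in> H" if "length us + length vs = n" "homogs A vs ds" for us vs ds
    using that
  proof (induction us arbitrary: vs ds rule: rev_induct)
    case Nil
    then show ?case using homog by simp
  next
    case (snoc x us)
    obtain c where c: "\<And>m. c m \<in> homog A m" "finite {m. c m \<noteq> 0}" "x = (\<Sum>m | c m \<noteq> 0. c m)"
      using homog_decomposition[of x] by blast
    have "tens A (us @ sum c S # vs) \<in> H" if "finite S" for S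
      using that
    proof (induction S)
      case empty
      then show ?case using tens_zero[of us vs n] snoc.prems HD(2) by simp
    next
      case (insert m S)
      have "tens A (us @ c m # vs) \<in> H"
        using snoc.IH[of "c m # vs" "m # ds"] snoc.prems c(1) by simp
      then show ?case
        using insert tens_add[of us vs n "c m" "sum c S"] snoc.prems HD(3) by simp
    qed
    then show ?case using c(2,3) by simp
  qed
  have tens_H': "tens A as \<in> H" if "length as = n" for as
    using tens_H[of as "[]" "[]"] that by simp
  have "rel n +>\<^bsub>free_space n\<^esub> x \<in> H" if "x \<in> carrier (free_space n)" for x
  proof -
    note FR = free_space_vs[of n] tensor_relations_is_subspace[of n]
    have "is_subspace {x \<in> carrier (free_space n). rel n +>\<^bsub>free_space n\<^esub> x \<in> H} (free_space n)"
    proof (rule is_subspaceI[OF FR(1)])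
      have zero: "(\<zero>\<^bsub>free_space n\<^esub> :: 'a list \<Rightarrow>\<^sub>0 'k) \<in> carrier (free_space n)"
        by (rule vector_space_simps(3)[OF FR(1)])
      have "rel n +>\<^bsub>free_space n\<^esub> \<zero>\<^bsub>free_space n\<^esub> = rel n"
        unfolding coset_eq_zero_iff[OF FR zero] by (rule is_subspaceD(2)[OF FR])
      then show "\<zero>\<^bsub>free_space n\<^esub> \<in> {x \<in> carrier (free_space n). rel n +>\<^bsub>free_space n\<^esub> x \<in> H}"
        using zero HD(2) quotient_zero[OF FR] by (simp add: tensor_power_def)
    next
      fix x y c
      assume x: "x \<in> {x \<in> carrier (free_space n). rel n +>\<^bsub>free_space n\<^esub> x \<in> H}"
      show "c \<odot>\<^bsub>free_space n\<^esub> x \<in> {x \<in> carrier (free_space n). rel n +>\<^bsub>free_space n\<^esub> x \<in> H}"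
        using x HD(4)[of "rel n +>\<^bsub>free_space n\<^esub> x" c] vector_space_simps(5)[OF FR(1), of x c]
          quotient_smult[OF FR, of x c] by (simp add: tensor_power_def)
      assume y: "y \<in> {x \<in> carrier (free_space n). rel n +>\<^bsub>free_space n\<^esub> x \<in> H}"
      show "x \<oplus>\<^bsub>free_space n\<^esub> y \<in> {x \<in> carrier (free_space n). rel n +>\<^bsub>free_space n\<^esub> x \<in> H}"
        using x y HD(3)[of "rel n +>\<^bsub>free_space n\<^esub> x" "rel n +>\<^bsub>free_space n\<^esub> y"]
          vector_space_simps(2)[OF FR(1), of x y] quotient_add[OF FR, of x y] by (simp add: tensor_power_def)
    qed auto
    then have sub: "free.subspace {x \<in> carrier (free_space n). rel n +>\<^bsub>free_space n\<^esub> x \<in> H}"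
      by (rule free_subspace)
    have "x = (\<Sum>as\<in>Poly_Mapping.keys x. free_scale (Poly_Mapping.lookup x as) (Poly_Mapping.single as 1))"
      by (rule poly_mapping_eqI) (auto simp: lookup_sum lookup_single when_def in_keys_iff)
    also have "\<dots> \<in> {x \<in> carrier (free_space n). rel n +>\<^bsub>free_space n\<^esub> x \<in> H}"
    proof (intro free.subspace_sum[OF sub] free.subspace_scale[OF sub])
      fix as assume "as \<in> Poly_Mapping.keys x"
      then have "length as = n" using that by (auto simp: free_space_def)
      then show "Poly_Mapping.single as 1 \<in> {x \<in> carrier (free_space n). rel n +>\<^bsub>free_space n\<^esub> x \<in> H}"
        using tens_H'[of as] by (simp add: tens_eq)
    qed
    finally show ?thesis by simp
  qed
  then show ?thesis
    by (auto simp: tensor_power_def quotient_carrier[OF free_space_vs tensor_relations_is_subspace])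
qed

text \<open>The universal property of the tensor power, for functionals: the linear extension to the free
  vector space kills the relations.\<close>

lemma functional_of_multilinear:
  assumes add: "\<And>us vs x y. length us + Suc (length vs) = n \<Longrightarrow>
      G (us @ (x + y) # vs) = G (us @ x # vs) + (G (us @ y # vs) :: 'k)"
    and scale: "\<And>us vs c x. length us + Suc (length vs) = n \<Longrightarrow> G (us @ scl A c x # vs) = c * G (us @ x # vs)"
  obtains f where "\<And>x y. x \<in> carrier (T n) \<Longrightarrow> y \<in> carrier (T n) \<Longrightarrow> f (x \<oplus>\<^bsub>T n\<^esub> y) = f x + f y"
    "\<And>c x. x \<in> carrier (T n) \<Longrightarrow> f (c \<odot>\<^bsub>T n\<^esub> x) = c * f x"
    "\<And>as. length as = n \<Longrightarrow> f (tens A as) = G as"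
proof -
  note FR = free_space_vs[of n] tensor_relations_is_subspace[of n]
  define f where "f = (\<lambda>Q. scalars.lift G (SOME x. x \<in> Q))"
  have "is_subspace {x \<in> carrier (free_space n). scalars.lift G x = 0} (free_space n)"
    using vector_space_simps(2,3,5)[OF FR(1)]
    by (intro is_subspaceI[OF FR(1)])
       (auto simp: scalars.lift_add scalars.lift_scale scalars.lift_def[of _ 0])
  then have rel: "rel n \<subseteq> {x \<in> carrier (free_space n). scalars.lift G x = 0}"
    by (rule tensor_relations_minimal)
       (auto intro!: free_space_diff_closed simp: scalars.lift_diff add scale)
  have f: "f (rel n +>\<^bsub>free_space n\<^esub> x) = scalars.lift G x" if x: "x \<in> carrier (free_space n)" for x
  proof -
    let ?y = "SOME y. y \<in> rel n +>\<^bsub>free_space n\<^esub> x"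
    have y: "?y \<in> rel n +>\<^bsub>free_space n\<^esub> x" using coset_self[OF FR x] by (rule someI)
    then have "?y - x \<in> rel n"
      using coset_eqI[OF FR x y] coset_subset[OF FR x y] coset_eq_iff[OF FR] x free_space_minus by metis
    then show ?thesis using rel scalars.lift_diff[of G ?y x] by (auto simp: f_def)
  qed
  show ?thesis
  proof
    show "f (tens A as) = G as" if "length as = n" for as
      using f[of "Poly_Mapping.single as 1"] that by (simp add: tens_eq)
    note closed = vector_space_simps(2,5)[OF FR(1)]
    show "f (P \<oplus>\<^bsub>T n\<^esub> Q) = f P + f Q" if PQ: "P \<in> carrier (T n)" "Q \<in> carrier (T n)" for P Q
    proof -
      obtain x y where "x \<in> carrier (free_space n)" "y \<in> carrier (free_space n)"
          "P = rel n +>\<^bsub>free_space n\<^esub> x" "Q = rel n +>\<^bsub>free_space n\<^esub> y"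
        using PQ by (auto simp: tensor_power_def quotient_carrier[OF FR])
      then show ?thesis
        using f[OF closed(1), of x y] by (simp add: tensor_power_def quotient_add[OF FR] f scalars.lift_add)
    qed
    show "f (c \<odot>\<^bsub>T n\<^esub> P) = c * f P" if P: "P \<in> carrier (T n)" for c P
    proof -
      obtain x where "x \<in> carrier (free_space n)" "P = rel n +>\<^bsub>free_space n\<^esub> x"
        using P by (auto simp: tensor_power_def quotient_carrier[OF FR])
      then show ?thesis
        using f[OF closed(2), of x c]
        by (simp add: tensor_power_def quotient_smult[OF FR] f scalars.lift_scale)
    qed
  qed
qed

text \<open>The differential of a tensor power has to be defined on tensors of arbitrary elements. There the
  sign \<open>(-1)\<^bsup>|a\<^sub>1| + \<dots>\<^esup>\<close> makes no sense, but applying to each entry on the left the involution that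
  multiplies the component of degree \<open>m\<close> by \<open>(-1)\<^sup>m\<close> has the same effect and is linear.\<close>

definition component :: "nat \<Rightarrow> 'a \<Rightarrow> 'a" where
  "component m x = (THE c. (\<forall>m. c m \<in> homog A m) \<and> finite {m. c m \<noteq> 0} \<and> x = (\<Sum>m | c m \<noteq> 0. c m)) m"

lemma component_eqI:
  assumes "\<And>m. c m \<in> homog A m" "finite {m. c m \<noteq> 0}" "x = (\<Sum>m | c m \<noteq> 0. c m)"
  shows "component m x = c m"
proof -
  have "(THE c. (\<forall>m. c m \<in> homog A m) \<and> finite {m. c m \<noteq> 0} \<and> x = (\<Sum>m | c m \<noteq> 0. c m)) = c"
    by (rule the1_equality[OF homog_decomposition]) (use assms in blast)
  then show ?thesis by (simp add: component_def)
qed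

lemma components:
  "component m x \<in> homog A m" "finite {m. component m x \<noteq> 0}"
  "x = (\<Sum>m | component m x \<noteq> 0. component m x)"
proof -
  obtain c where c: "\<And>m. c m \<in> homog A m" "finite {m. c m \<noteq> 0}" "x = (\<Sum>m | c m \<noteq> 0. c m)"
    using homog_decomposition[of x] by blast
  have "component m x = c m" for m by (rule component_eqI[OF c])
  then show "component m x \<in> homog A m" "finite {m. component m x \<noteq> 0}"
    "x = (\<Sum>m | component m x \<noteq> 0. component m x)" using c by simp_all
qed

lemma sum_components:
  assumes "finite S" "{m. component m x \<noteq> 0} \<subseteq> S" shows "(\<Sum>m\<in>S. component m x) = x"
proof -
  have "(\<Sum>m\<in>S. component m x) = (\<Sum>m | component m x \<noteq> 0. component m x)"
    using assms by (intro sum.mono_neutral_right) auto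
  then show ?thesis using components(3)[of x] by simp
qed

lemma component_add: "component m (x + y) = component m x + component m y"
proof (rule component_eqI)
  let ?S = "{m. component m x \<noteq> 0} \<union> {m. component m y \<noteq> 0}"
  have sub: "{m. component m x + component m y \<noteq> 0} \<subseteq> ?S" by auto
  show fin: "finite {m. component m x + component m y \<noteq> 0}"
    by (rule finite_subset[OF sub]) (simp add: components(2))
  have "(\<Sum>m | component m x + component m y \<noteq> 0. component m x + component m y)
      = (\<Sum>m\<in>?S. component m x + component m y)"
    by (rule sum.mono_neutral_left) (use sub components(2) in auto)
  also have "\<dots> = x + y"
    using sum_components[of ?S x] sum_components[of ?S y] components(2) by (simp add: sum.distrib)
  finally show "x + y = (\<Sum>m | component m x + component m y \<noteq> 0. component m x + component m y)" ..
qed (use components(1) homog_subspace in \<open>auto intro: subspace_add\<close>)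

lemma component_homog: "x \<in> homog A d \<Longrightarrow> component m x = (if m = d then x else 0)"
proof (rule component_eqI)
  assume x: "x \<in> homog A d"
  have "{m. (if m = d then x else 0) \<noteq> 0} \<subseteq> {d}" by auto
  then show "finite {m. (if m = d then x else 0) \<noteq> 0}"
    and "x = (\<Sum>m | (if m = d then x else 0) \<noteq> 0. if m = d then x else 0)"
    by (auto simp: finite_subset if_distrib intro!: sum.mono_neutral_cong_right)
  show "(if m = d then x else 0) \<in> homog A m" for m
    using x homog_subspace by (auto intro: subspace_0)
qed

lemma component_scale: "component m (scl A c x) = scl A c (component m x)"
proof (cases "c = 0")
  case True
  have "0 \<in> homog A 0" using homog_subspace by (rule subspace_0)
  then show ?thesis using True component_homog[of 0 0 m] by simp
next
  case False
  show ?thesis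
  proof (rule component_eqI)
    show "scl A c (component m x) \<in> homog A m" for m
      using components(1) homog_subspace by (auto intro: subspace_scale)
    show "finite {m. scl A c (component m x) \<noteq> 0}" using False components(2)[of x] by simp
    show "scl A c x = (\<Sum>m | scl A c (component m x) \<noteq> 0. scl A c (component m x))"
      using False components(3)[of x] by (simp flip: scale_sum_right)
  qed
qed

definition sign :: "'a \<Rightarrow> 'a" where
  "sign x = (\<Sum>m | component m x \<noteq> 0. scl A ((-1) ^ m) (component m x))"

lemma sign_superset:
  assumes "finite S" "{m. component m x \<noteq> 0} \<subseteq> S"
  shows "sign x = (\<Sum>m\<in>S. scl A ((-1) ^ m) (component m x))"
  unfolding sign_def using assms by (intro sum.mono_neutral_left) auto

lemma sign_add: "sign (x + y) = sign x + sign y"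
proof -
  let ?S = "{m. component m x \<noteq> 0} \<union> {m. component m y \<noteq> 0}"
  have fin: "finite ?S" by (simp add: components(2))
  have "{m. component m (x + y) \<noteq> 0} \<subseteq> ?S" by (auto simp: component_add)
  then show ?thesis
    unfolding sign_superset[OF fin, of x, OF Un_upper1] sign_superset[OF fin, of y, OF Un_upper2]
      sign_superset[OF fin]
    by (simp add: sign_superset[OF fin] component_add scale_right_distrib sum.distrib)
qed

lemma sign_scale: "sign (scl A c x) = scl A c (sign x)"
proof -
  have "sign (scl A c x) = (\<Sum>m | component m x \<noteq> 0. scl A ((-1) ^ m) (component m (scl A c x)))"
    by (rule sign_superset[OF components(2)]) (auto simp: component_scale)
  also have "\<dots> = scl A c (sign x)"
    unfolding sign_def scale_sum_right by (simp add: component_scale mult.commute)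
  finally show ?thesis .
qed

lemma sign_homog: "x \<in> homog A d \<Longrightarrow> sign x = scl A ((-1) ^ d) x"
proof -
  assume x: "x \<in> homog A d"
  have "sign x = (\<Sum>m\<in>{d}. scl A ((-1) ^ m) (component m x))"
    by (rule sign_superset) (auto simp: component_homog[OF x])
  then show ?thesis by (simp add: component_homog[OF x])
qed

lemma tens_scale_prefix:
  "length us + length vs = n \<Longrightarrow> homogs A us ds \<Longrightarrow>
    tens A (map sign us @ vs) = (-1) ^ sum_list ds \<odot>\<^bsub>T n\<^esub> tens A (us @ vs)"
proof (induction us arbitrary: vs ds rule: rev_induct)
  case Nil
  then show ?case using vector_space_simps(9)[OF tensor_power_is_vector_space, of "tens A vs" n] by simp
next
  case (snoc x us)
  obtain es d where ds: "ds = es @ [d]" "homogs A us es" "x \<in> homog A d"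
    using snoc.prems(2) by (auto simp: list_all2_append1 list_all2_Cons1)
  have "tens A (map sign (us @ [x]) @ vs) = tens A (map sign us @ scl A ((-1) ^ d) x # vs)"
    using ds by (simp add: sign_homog)
  also have "\<dots> = (-1) ^ d \<odot>\<^bsub>T n\<^esub> tens A (map sign us @ x # vs)"
    using snoc.prems by (intro tens_scale) simp
  also have "\<dots> = (-1) ^ d \<odot>\<^bsub>T n\<^esub> ((-1) ^ sum_list es \<odot>\<^bsub>T n\<^esub> tens A (us @ x # vs))"
    using snoc.IH[of "x # vs" es] snoc.prems ds by simp
  also have "\<dots> = (-1) ^ sum_list ds \<odot>\<^bsub>T n\<^esub> tens A (us @ x # vs)"
    using vector_space_simps(8)[OF tensor_power_is_vector_space, of "tens A (us @ x # vs)" n "(-1) ^ d"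
        "(-1) ^ sum_list es"] snoc.prems ds
    by (simp add: power_add mult.commute)
  finally show ?case by simp
qed

text \<open>The differential is constructed on the free vector space, as a map that preserves the relations.\<close>

definition free_diff :: "'a list \<Rightarrow> ('a list \<Rightarrow>\<^sub>0 'k)" where
  "free_diff as = (\<Sum>i<length as.
     Poly_Mapping.single (map sign (take i as) @ diff A (as ! i) # drop (Suc i) as) 1)"

lemma free_diff_closed: "length as = n \<Longrightarrow> free_diff as \<in> carrier (free_space n)"
  unfolding free_diff_def by (intro free_space_sum_closed) auto

lemma diff_add: "diff A (x + y) = diff A x + diff A y"
  and diff_scale: "diff A (scl A c x) = scl A c (diff A x)"
proof -
  interpret D: Vector_Spaces.linear "scl A" "scl A" "diff A" by (rule diff_linear)
  show "diff A (x + y) = diff A x + diff A y" by (rule D.add)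
  show "diff A (scl A c x) = scl A c (diff A x)" by (rule D.scale)
qed

lemma free_scale_single [simp]:
  "free_scale c (Poly_Mapping.single as d) = Poly_Mapping.single as (c * d)"
  by (rule poly_mapping_eqI) (simp add: lookup_single when_def)

lemma free_lift_closed:
  fixes G :: "'a list \<Rightarrow> ('a list \<Rightarrow>\<^sub>0 'k)"
  assumes "x \<in> carrier (free_space n)" "\<And>as. length as = n \<Longrightarrow> G as \<in> carrier (free_space n)"
  shows "free.lift G x \<in> carrier (free_space n)"
  unfolding free.lift_def
proof (intro free_space_sum_closed)
  fix as assume "as \<in> Poly_Mapping.keys x"
  then have "G as \<in> carrier (free_space n)" using assms by (auto simp: free_space_def)
  then show "free_scale (Poly_Mapping.lookup x as) (G as) \<in> carrier (free_space n)"
    using vector_space_simps(5)[OF free_space_vs, of "G as" n] by simp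
qed

lemma free_diff_relations: "free.lift free_diff ` rel n \<subseteq> rel n"
proof -
  note FR = free_space_vs[of n] tensor_relations_is_subspace[of n]
  note rel = free_subspace[OF FR(2)]
  let ?D = "free.lift free_diff"
  have "is_subspace {x \<in> carrier (free_space n). ?D x \<in> rel n} (free_space n)"
    using vector_space_simps(2,3,5)[OF FR(1)] free.subspace_add[OF rel] free.subspace_scale[OF rel]
      free.subspace_0[OF rel]
    by (intro is_subspaceI[OF FR(1)])
       (simp_all add: free.lift_add free.lift_scale free.lift_def[of _ 0])
  then have "rel n \<subseteq> {x \<in> carrier (free_space n). ?D x \<in> rel n}"
  proof (rule tensor_relations_minimal)
    fix us vs :: "'a list" and x y
    assume n: "length us + Suc (length vs) = n"
    let ?s = "\<lambda>i z. Poly_Mapping.single (map sign (take i (us @ z # vs)) @ diff A ((us @ z # vs) ! i)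
      # drop (Suc i) (us @ z # vs)) (1::'k)"
    have "?s i (x + y) - ?s i x - ?s i y \<in> rel n" if "i < n" for i
    proof (cases i "length us" rule: linorder_cases)
      case less
      then show ?thesis
        using tensor_relations_add[of "map sign (take i us) @ diff A (us ! i) # drop (Suc i) us" vs n x y] n
        by (simp add: nth_append)
    next
      case equal
      then show ?thesis
        using tensor_relations_add[of "map sign us" vs n "diff A x" "diff A y"] n by (simp add: diff_add)
    next
      case greater
      then obtain j where j: "i = length us + Suc j" using less_imp_Suc_add by auto
      then show ?thesis
        using tensor_relations_add[of "map sign us" "map sign (take j vs) @ diff A (vs ! j) # drop (Suc j) vs" n
            "sign x" "sign y"] n that
        by (simp add: nth_append sign_add)
    qed
    then have "(\<Sum>i<n. ?s i (x + y) - ?s i x - ?s i y) \<in> rel n"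
      by (intro free.subspace_sum[OF rel]) auto
    then have "?D (Poly_Mapping.single (us @ (x + y) # vs) 1 - Poly_Mapping.single (us @ x # vs) 1
        - Poly_Mapping.single (us @ y # vs) 1) \<in> rel n"
      using n by (simp add: free.lift_diff free_diff_def sum_subtractf)
    then show "Poly_Mapping.single (us @ (x + y) # vs) 1 - Poly_Mapping.single (us @ x # vs) 1
        - Poly_Mapping.single (us @ y # vs) 1 \<in> {x \<in> carrier (free_space n). ?D x \<in> rel n}"
      using n by (auto intro!: free_space_diff_closed)
  next
    fix us vs :: "'a list" and c x
    assume n: "length us + Suc (length vs) = n"
    let ?s = "\<lambda>i z e. Poly_Mapping.single (map sign (take i (us @ z # vs)) @ diff A ((us @ z # vs) ! i)
      # drop (Suc i) (us @ z # vs)) (e::'k)"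
    have "?s i (scl A c x) 1 - ?s i x c \<in> rel n" if "i < n" for i
    proof (cases i "length us" rule: linorder_cases)
      case less
      then show ?thesis
        using tensor_relations_scale[of "map sign (take i us) @ diff A (us ! i) # drop (Suc i) us" vs n c x] n
        by (simp add: nth_append)
    next
      case equal
      then show ?thesis
        using tensor_relations_scale[of "map sign us" vs n c "diff A x"] n by (simp add: diff_scale)
    next
      case greater
      then obtain j where j: "i = length us + Suc j" using less_imp_Suc_add by auto
      then show ?thesis
        using tensor_relations_scale[of "map sign us" "map sign (take j vs) @ diff A (vs ! j) # drop (Suc j) vs" n
            c "sign x"] n that
        by (simp add: nth_append sign_scale)
    qed
    then have "(\<Sum>i<n. ?s i (scl A c x) 1 - ?s i x c) \<in> rel n"
      by (intro free.subspace_sum[OF rel]) auto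
    then have "?D (Poly_Mapping.single (us @ scl A c x # vs) 1 - Poly_Mapping.single (us @ x # vs) c) \<in> rel n"
      using n by (simp add: free.lift_diff free_diff_def sum_subtractf free.scale_sum_right)
    then show "Poly_Mapping.single (us @ scl A c x # vs) 1 - Poly_Mapping.single (us @ x # vs) c
        \<in> {x \<in> carrier (free_space n). ?D x \<in> rel n}"
      using n by (auto intro!: free_space_diff_closed)
  qed
  then show ?thesis by auto
qed

lemma tens_diff_closed:
  "length as = n \<Longrightarrow> c \<odot>\<^bsub>T n\<^esub> tens A (as[i := x]) \<in> carrier (T n)"
  by (rule vector_space_simps(5)[OF tensor_power_is_vector_space]) simp

lemma tensor_diff_exists:
  "\<exists>!T'. T' \<in> linear_maps (T n) (T n) \<and> T' \<in> extensional (carrier (T n)) \<and>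
     (\<forall>as ds. homog_list A n as ds \<longrightarrow>
        T' (tens A as) = (\<Oplus>\<^bsub>T n\<^esub> i\<in>{..<n}.
          (-1) ^ sum_list (take i ds) \<odot>\<^bsub>T n\<^esub> tens A (as[i := diff A (as ! i)])))"
proof (rule ex_ex1I)
  note FR = free_space_vs[of n] tensor_relations_is_subspace[of n]
  let ?D = "free.lift free_diff"
  let ?T = "restrict (induced_map (free_space n) (rel n) ?D) (carrier (T n))"
  interpret T: abelian_group "T n" by (rule vector_space_simps(1)[OF tensor_power_is_vector_space])
  have zero: "\<zero>\<^bsub>T n\<^esub> = rel n" by (simp add: tensor_power_def quotient_zero[OF FR])
  have D: "?D \<in> linear_maps (free_space n) (free_space n)"
    by (auto simp: linear_maps_def free.lift_add free.lift_scale intro!: free_lift_closed free_diff_closed)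
  note ind = FR(1) FR(1) FR(2) FR(2) D free_diff_relations
  have "?T \<in> linear_maps (T n) (T n)"
    using induced_map_linear[OF ind] vector_space_simps(2,5)[OF tensor_power_is_vector_space[of n]]
    by (auto simp: linear_maps_def tensor_power_def)
  moreover have "?T (tens A as) = (\<Oplus>\<^bsub>T n\<^esub> i\<in>{..<n}.
      (-1) ^ sum_list (take i ds) \<odot>\<^bsub>T n\<^esub> tens A (as[i := diff A (as ! i)]))"
    if "homog_list A n as ds" for as ds
  proof -
    have n: "length as = n" and ds: "homogs A as ds" using that by (auto simp: homog_list_iff)
    let ?l = "\<lambda>i. map sign (take i as) @ diff A (as ! i) # drop (Suc i) as"
    have "?T (tens A as) = rel n +>\<^bsub>free_space n\<^esub> free_diff as"
      using induced_map_coset[OF ind, of "Poly_Mapping.single as 1"] n tens_in_tensor_power[OF n]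
      by (simp add: tens_eq)
    also have "\<dots> = (\<Oplus>\<^bsub>T n\<^esub> i\<in>{..<n}. tens A (?l i))"
    proof -
      have "rel n +>\<^bsub>free_space n\<^esub> (\<Sum>i\<in>I. Poly_Mapping.single (?l i) 1) = (\<Oplus>\<^bsub>T n\<^esub> i\<in>I. tens A (?l i))"
        if "finite I" "I \<subseteq> {..<n}" for I
        using that
      proof (induction I)
        case empty
        show ?case
          using coset_eq_zero_iff[OF FR vector_space_simps(3)[OF FR(1)]] is_subspaceD(2)[OF FR] zero by simp
      next
        case (insert i I)
        have len: "length (?l j) = n" if "j < n" for j using that n by simp
        have "(\<Oplus>\<^bsub>T n\<^esub> j\<in>insert i I. tens A (?l j))
            = tens A (?l i) \<oplus>\<^bsub>T n\<^esub> (\<Oplus>\<^bsub>T n\<^esub> j\<in>I. tens A (?l j))"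
          by (rule T.finsum_insert) (use insert len in \<open>auto simp: Pi_def subset_iff\<close>)
        also have "\<dots> = rel n +>\<^bsub>free_space n\<^esub> (Poly_Mapping.single (?l i) 1 + (\<Sum>j\<in>I. Poly_Mapping.single (?l j) 1))"
        proof -
          have c1: "Poly_Mapping.single (?l i) 1 \<in> carrier (free_space n)" using len insert.prems by simp
          have c2: "(\<Sum>j\<in>I. Poly_Mapping.single (?l j) 1) \<in> carrier (free_space n)"
            using len insert.prems by (intro free_space_sum_closed) (auto simp: subset_iff)
          have "(\<Oplus>\<^bsub>T n\<^esub> j\<in>I. tens A (?l j))
              = rel n +>\<^bsub>free_space n\<^esub> (\<Sum>j\<in>I. Poly_Mapping.single (?l j) 1)"
            using insert.IH insert.prems by simp
          moreover have "tens A (?l i) = rel n +>\<^bsub>free_space n\<^esub> Poly_Mapping.single (?l i) 1"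
            using tens_eq[of "?l i"] len[of i] insert.prems by simp
          ultimately show ?thesis
            using quotient_add[OF FR c1 c2, folded tensor_power_def] by simp
        qed
        finally show ?case using insert by simp
      qed
      then show ?thesis using n by (simp add: free_diff_def)
    qed
    also have "\<dots> = (\<Oplus>\<^bsub>T n\<^esub> i\<in>{..<n}.
        (-1) ^ sum_list (take i ds) \<odot>\<^bsub>T n\<^esub> tens A (as[i := diff A (as ! i)]))"
    proof (rule T.finsum_cong'[OF refl])
      fix i assume i: "i \<in> {..<n}"
      have "homogs A (take i as) (take i ds)" using ds by (rule list_all2_takeI)
      then show "tens A (?l i) = (-1) ^ sum_list (take i ds) \<odot>\<^bsub>T n\<^esub> tens A (as[i := diff A (as ! i)])"
        using tens_scale_prefix[of "take i as" "diff A (as ! i) # drop (Suc i) as" n "take i ds"] n i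
        by (simp add: upd_conv_take_nth_drop)
    qed (auto intro!: tens_diff_closed n)
    finally show ?thesis .
  qed
  ultimately show "\<exists>T'. T' \<in> linear_maps (T n) (T n) \<and> T' \<in> extensional (carrier (T n)) \<and>
     (\<forall>as ds. homog_list A n as ds \<longrightarrow>
        T' (tens A as) = (\<Oplus>\<^bsub>T n\<^esub> i\<in>{..<n}.
          (-1) ^ sum_list (take i ds) \<odot>\<^bsub>T n\<^esub> tens A (as[i := diff A (as ! i)])))"
    by (intro exI[of _ ?T]) auto
next
  fix T1 T2
  let ?S = "\<lambda>as ds. (\<Oplus>\<^bsub>T n\<^esub> i\<in>{..<n}.
          (-1) ^ sum_list (take i ds) \<odot>\<^bsub>T n\<^esub> tens A (as[i := diff A (as ! i)]))"
  assume T1: "T1 \<in> linear_maps (T n) (T n) \<and> T1 \<in> extensional (carrier (T n)) \<and>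
     (\<forall>as ds. homog_list A n as ds \<longrightarrow> T1 (tens A as) = ?S as ds)"
    and T2: "T2 \<in> linear_maps (T n) (T n) \<and> T2 \<in> extensional (carrier (T n)) \<and>
     (\<forall>as ds. homog_list A n as ds \<longrightarrow> T2 (tens A as) = ?S as ds)"
  note V = tensor_power_is_vector_space[of n]
  have "is_subspace {x \<in> carrier (T n). T1 x = T2 x} (T n)"
    by (rule equalizer_is_subspace[OF V V T1[THEN conjunct1] T2[THEN conjunct1]])
  then have "carrier (T n) \<subseteq> {x \<in> carrier (T n). T1 x = T2 x}"
  proof (rule tensor_power_induct)
    fix as ds assume "length as = n" "homogs A as ds"
    then have "homog_list A n as ds" by (simp add: homog_list_iff)
    then have "T1 (tens A as) = T2 (tens A as)"
      using T1[THEN conjunct2, THEN conjunct2, rule_format, of as ds]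
        T2[THEN conjunct2, THEN conjunct2, rule_format, of as ds] by (simp only:)
    then show "tens A as \<in> {x \<in> carrier (T n). T1 x = T2 x}" using \<open>length as = n\<close> by simp
  qed
  then have "T1 x = T2 x" if "x \<in> carrier (T n)" for x using that by blast
  then show "T1 = T2" by (rule extensionalityI[of T1 "carrier (T n)" T2, OF T1[THEN conjunct2, THEN conjunct1]
        T2[THEN conjunct2, THEN conjunct1]])
qed

lemma tensor_diff:
  "tensor_diff A n \<in> linear_maps (T n) (T n)"
  "homog_list A n as ds \<Longrightarrow> tensor_diff A n (tens A as) = (\<Oplus>\<^bsub>T n\<^esub> i\<in>{..<n}.
     (-1) ^ sum_list (take i ds) \<odot>\<^bsub>T n\<^esub> tens A (as[i := diff A (as ! i)]))"
proof -
  note * = theI'[OF tensor_diff_exists[of n], folded tensor_diff_def]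
  show "tensor_diff A n \<in> linear_maps (T n) (T n)" using * by (rule conjunct1)
  show "homog_list A n as ds \<Longrightarrow> tensor_diff A n (tens A as) = (\<Oplus>\<^bsub>T n\<^esub> i\<in>{..<n}.
     (-1) ^ sum_list (take i ds) \<odot>\<^bsub>T n\<^esub> tens A (as[i := diff A (as ! i)]))"
    by (rule *[THEN conjunct2, THEN conjunct2, rule_format])
qed

end

section \<open>Cochains\<close>

lemma sum_fun_apply: "(\<Sum>i\<in>I. g i) x = (\<Sum>i\<in>I. g i x)"
  by (induction I rule: infinite_finite_induct) auto

text \<open>The operation on neighbouring entries is a parameter, since the elements are multiplied whereas their
  degrees are added.\<close>

fun merge :: "('a \<Rightarrow> 'a \<Rightarrow> 'a) \<Rightarrow> nat \<Rightarrow> 'a list \<Rightarrow> 'a list" where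
  "merge f 0 (a # b # xs) = f a b # xs"
| "merge f (Suc i) (a # xs) = a # merge f i xs"
| "merge f i xs = xs"

lemma merge_take_drop:
  "Suc i < length xs \<Longrightarrow> merge f i xs = take i xs @ [f (xs ! i) (xs ! (i + 1))] @ drop (i + 2) xs"
  by (induction f i xs rule: merge.induct) auto

lemma length_merge: "Suc i < length xs \<Longrightarrow> length (merge f i xs) = length xs - 1"
  by (simp add: merge_take_drop)

lemma sum_list_merge: "Suc i < length ds \<Longrightarrow> sum_list (merge (+) i ds) = sum_list (ds :: nat list)"
  by (induction "(+) :: nat \<Rightarrow> _" i ds rule: merge.induct) auto

lemma merge_append_left: "Suc i < length us \<Longrightarrow> merge f i (us @ vs) = merge f i us @ vs"
  by (induction f i us rule: merge.induct) auto

lemma merge_append_right: "i = length us + j \<Longrightarrow> merge f i (us @ vs) = us @ merge f j vs"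
  by (induction us arbitrary: i) auto

lemma merge_merge:
  assumes "\<And>x y z. f (f x y) z = f x (f y z)" "i \<le> j" "Suc (Suc j) < length xs"
  shows "merge f i (merge f (Suc j) xs) = merge f j (merge f i xs)"
  using assms
proof (induction f i xs arbitrary: j rule: merge.induct)
  case (1 f a b xs)
  then show ?case
    by (cases j; cases xs) auto
next
  case (2 f i a xs)
  then show ?case by (cases j) auto
qed auto

context dga
begin

abbreviation "C n m \<equiv> carrier (cochains A n m)"

abbreviation homogs_of :: "nat \<Rightarrow> nat \<Rightarrow> 'a list \<Rightarrow> nat list \<Rightarrow> bool" where
  "homogs_of N m as ds \<equiv> length as = N \<and> homogs A as ds \<and> sum_list ds = m"

lemma zero_homog [simp]: "0 \<in> homog A d"
  using homog_subspace by (rule subspace_0)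

lemma homogs_merge:
  "homogs A as ds \<Longrightarrow> Suc i < length as \<Longrightarrow> homogs A (merge (*) i as) (merge (+) i ds)"
proof (induction "(*) :: 'a \<Rightarrow> _" i as arbitrary: ds rule: merge.induct)
  case (1 a b xs)
  then show ?case by (auto simp: list_all2_Cons1 homog_mult)
next
  case (2 i a xs)
  then show ?case by (auto simp: list_all2_Cons1)
qed auto

lemma merge_merge_mult:
  "i \<le> j \<Longrightarrow> Suc (Suc j) < length xs \<Longrightarrow> merge (*) i (merge (*) (Suc j) xs) = merge (*) j (merge (*) i (xs :: 'a list))"
  by (rule merge_merge) (simp_all add: mult.assoc)

abbreviation "TG N m \<equiv> graded_tensor_power A N m"

lemma graded_is_subspace: "is_subspace (carrier (TG N m)) (T N)"
proof -
  have "{tens A as |as ds. homog_list A N as ds \<and> sum_list ds = m} \<subseteq> carrier (T N)"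
    by (auto simp: homog_list_iff)
  then show ?thesis
    using linear_hull_is_subspace[OF tensor_power_is_vector_space] by (simp add: graded_tensor_power_def)
qed

lemma graded_simps [simp]:
  "x \<oplus>\<^bsub>TG N m\<^esub> y = x \<oplus>\<^bsub>T N\<^esub> y" "c \<odot>\<^bsub>TG N m\<^esub> x = c \<odot>\<^bsub>T N\<^esub> x"
  by (simp_all add: graded_tensor_power_def)

lemma tens_in_graded: "homogs_of N m as ds \<Longrightarrow> tens A as \<in> carrier (TG N m)"
  unfolding graded_tensor_power_def
  by simp (rule subsetD[OF linear_hull_superset], auto simp: homog_list_iff)

lemma graded_induct:
  assumes H: "is_subspace H (T N)" and homog: "\<And>as ds. homogs_of N m as ds \<Longrightarrow> tens A as \<in> H"
  shows "carrier (TG N m) \<subseteq> H"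
  unfolding graded_tensor_power_def
  using linear_hull_minimal[OF H, of "{tens A as |as ds. homog_list A N as ds \<and> sum_list ds = m}"] homog
  by (auto simp: homog_list_iff)

lemmas graded_closed = is_subspaceD(2-4)[OF tensor_power_is_vector_space graded_is_subspace]

lemma cochain_iff:
  "f \<in> C n m \<longleftrightarrow>
     (\<forall>x\<in>carrier (TG (Suc n) m). \<forall>y\<in>carrier (TG (Suc n) m). f (x \<oplus>\<^bsub>T (Suc n)\<^esub> y) = f x + f y) \<and>
     (\<forall>c. \<forall>x\<in>carrier (TG (Suc n) m). f (c \<odot>\<^bsub>T (Suc n)\<^esub> x) = c * f x) \<and>
     (\<forall>x. x \<notin> carrier (TG (Suc n) m) \<longrightarrow> f x = 0)"
  by (simp add: cochains_def dual_space_def function_space_def)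

lemma cochainD:
  assumes "f \<in> C n m"
  shows "x \<in> carrier (TG (Suc n) m) \<Longrightarrow> y \<in> carrier (TG (Suc n) m) \<Longrightarrow> f (x \<oplus>\<^bsub>T (Suc n)\<^esub> y) = f x + f y"
    and "x \<in> carrier (TG (Suc n) m) \<Longrightarrow> f (c \<odot>\<^bsub>T (Suc n)\<^esub> x) = c * f x"
    and "x \<notin> carrier (TG (Suc n) m) \<Longrightarrow> f x = 0"
    and "f \<zero>\<^bsub>T (Suc n)\<^esub> = 0"
proof -
  note * = assms[unfolded cochain_iff]
  show "x \<in> carrier (TG (Suc n) m) \<Longrightarrow> y \<in> carrier (TG (Suc n) m) \<Longrightarrow> f (x \<oplus>\<^bsub>T (Suc n)\<^esub> y) = f x + f y"
    using * by blast
  show smult: "x \<in> carrier (TG (Suc n) m) \<Longrightarrow> f (c \<odot>\<^bsub>T (Suc n)\<^esub> x) = c * f x" for x c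
    using * by blast
  show "x \<notin> carrier (TG (Suc n) m) \<Longrightarrow> f x = 0" using * by blast
  show "f \<zero>\<^bsub>T (Suc n)\<^esub> = 0"
    using smult[of "\<zero>\<^bsub>T (Suc n)\<^esub>" 0] graded_closed(1)[of "Suc n" m]
      vector_space_simps(11)[OF tensor_power_is_vector_space, of "Suc n" 0] by simp
qed

lemma cochains_closed:
  "0 \<in> C n m" "f \<in> C n m \<Longrightarrow> g \<in> C n m \<Longrightarrow> f + g \<in> C n m" "f \<in> C n m \<Longrightarrow> - f \<in> C n m"
  "f \<in> C n m \<Longrightarrow> (\<lambda>x. c * f x) \<in> C n m"
proof -
  show "0 \<in> C n m" by (simp add: cochain_iff)
  show "f + g \<in> C n m" if f: "f \<in> C n m" and g: "g \<in> C n m"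
    unfolding cochain_iff
    by (intro conjI ballI allI impI)
       (simp_all add: cochainD(1)[OF f] cochainD(1)[OF g] cochainD(2)[OF f] cochainD(2)[OF g]
          cochainD(3)[OF f] cochainD(3)[OF g] distrib_left add_ac)
  show "- f \<in> C n m" if f: "f \<in> C n m"
    unfolding cochain_iff
    by (intro conjI ballI allI impI) (simp_all add: cochainD(1)[OF f] cochainD(2)[OF f] cochainD(3)[OF f])
  show "(\<lambda>x. c * f x) \<in> C n m" if f: "f \<in> C n m"
    unfolding cochain_iff
    by (intro conjI ballI allI impI)
       (simp_all add: cochainD(1)[OF f] cochainD(2)[OF f] cochainD(3)[OF f] distrib_left mult.left_commute)
qed

text \<open>Cochains are determined by their values on tensors of homogeneous elements. All identities between
  operators are proved with this lemma.\<close>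

lemma cochain_eqI:
  assumes f: "f \<in> C n m" and g: "g \<in> C n m"
    and eq: "\<And>as ds. homogs_of (Suc n) m as ds \<Longrightarrow> f (tens A as) = g (tens A as)"
  shows "f = g"
proof
  fix x
  show "f x = g x"
  proof (cases "x \<in> carrier (TG (Suc n) m)")
    case True
    let ?H = "{x \<in> carrier (TG (Suc n) m). f x = g x}"
    have "is_subspace ?H (T (Suc n))"
    proof (rule is_subspaceI[OF tensor_power_is_vector_space])
      show "?H \<subseteq> carrier (T (Suc n))"
        using is_subspaceD(1)[OF tensor_power_is_vector_space graded_is_subspace[of "Suc n" m]] by blast
      show "\<zero>\<^bsub>T (Suc n)\<^esub> \<in> ?H"
        using graded_closed(1)[of "Suc n" m] cochainD(4)[OF f] cochainD(4)[OF g] by simp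
      show "x \<oplus>\<^bsub>T (Suc n)\<^esub> y \<in> ?H" if "x \<in> ?H" "y \<in> ?H" for x y
        using that graded_closed(2)[of x "Suc n" m y] cochainD(1)[OF f, of x y] cochainD(1)[OF g, of x y]
        by simp
      show "c \<odot>\<^bsub>T (Suc n)\<^esub> x \<in> ?H" if "x \<in> ?H" for c x
        using that graded_closed(3)[of x "Suc n" m c] cochainD(2)[OF f, of x c] cochainD(2)[OF g, of x c]
        by simp
    qed
    then have "carrier (TG (Suc n) m) \<subseteq> ?H"
    proof (rule graded_induct)
      fix as ds assume *: "homogs_of (Suc n) m as ds"
      show "tens A as \<in> ?H" using eq[OF *] tens_in_graded[OF *] by simp
    qed
    then show ?thesis using True by blast
  qed (use cochainD(3)[OF f] cochainD(3)[OF g] in auto)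
qed

lemma cochain_tens_zero:
  assumes f: "f \<in> C n m" and "length us + Suc (length vs) = Suc n"
  shows "f (tens A (us @ 0 # vs)) = 0"
  using cochainD(4)[OF f] tens_zero[OF assms(2)] by simp

text \<open>Functions of homogeneous elements and their degrees, linear in each entry as long as the degrees are
  kept. The closure properties below show that the formulas for the operators do define cochains.\<close>

definition multilinear :: "nat \<Rightarrow> nat \<Rightarrow> ('a list \<Rightarrow> nat list \<Rightarrow> 'k) \<Rightarrow> bool" where
  "multilinear N m F \<longleftrightarrow> (\<forall>us x y vs c ds.
     homogs_of N m (us @ x # vs) ds \<and> homogs_of N m (us @ y # vs) ds \<longrightarrow>
     F (us @ (x + y) # vs) ds = F (us @ x # vs) ds + F (us @ y # vs) ds \<and>
     F (us @ scl A c x # vs) ds = c * F (us @ x # vs) ds)"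

lemma multilinearD:
  assumes "multilinear N m F" "homogs_of N m (us @ x # vs) ds"
  shows "homogs_of N m (us @ y # vs) ds \<Longrightarrow> F (us @ (x + y) # vs) ds = F (us @ x # vs) ds + F (us @ y # vs) ds"
    and "F (us @ scl A c x # vs) ds = c * F (us @ x # vs) ds"
  using assms(1)[unfolded multilinear_def, rule_format, of us x vs ds y]
    assms(1)[unfolded multilinear_def, rule_format, of us x vs ds x] assms(2) by simp_all

lemma multilinear_zero:
  "multilinear N m F \<Longrightarrow> homogs_of N m (us @ 0 # vs) ds \<Longrightarrow> F (us @ 0 # vs) ds = 0"
  using multilinearD(2)[of N m F us 0 vs ds 0] by simp

lemma homogs_append_Cons:
  assumes "homogs A (us @ x # vs) ds"
  obtains d1 d d2 where "ds = d1 @ d # d2" "homogs A us d1" "x \<in> homog A d" "homogs A vs d2" "length d1 = length us"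
  using assms by (auto simp: list_all2_append1 list_all2_Cons1 dest: list_all2_lengthD)

lemma multilinear_cochain:
  assumes f: "f \<in> C n m" shows "multilinear (Suc n) m (\<lambda>as ds. f (tens A as))"
  unfolding multilinear_def
proof (intro allI impI conjI)
  fix us x y vs c ds
  assume *: "homogs_of (Suc n) m (us @ x # vs) ds \<and> homogs_of (Suc n) m (us @ y # vs) ds"
  then have n: "length us + Suc (length vs) = Suc n" by simp
  have x: "tens A (us @ x # vs) \<in> carrier (TG (Suc n) m)" and y: "tens A (us @ y # vs) \<in> carrier (TG (Suc n) m)"
    using * tens_in_graded[of "us @ x # vs" "Suc n" ds m] tens_in_graded[of "us @ y # vs" "Suc n" ds m] by simp_all
  show "f (tens A (us @ (x + y) # vs)) = f (tens A (us @ x # vs)) + f (tens A (us @ y # vs))"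
    unfolding tens_add[OF n] by (rule cochainD(1)[OF f x y])
  show "f (tens A (us @ scl A c x # vs)) = c * f (tens A (us @ x # vs))"
    unfolding tens_scale[OF n] by (rule cochainD(2)[OF f x])
qed

lemma multilinear_scale:
  assumes F: "multilinear N m F" shows "multilinear N m (\<lambda>as ds. g ds * F as ds)"
  unfolding multilinear_def
proof (intro allI impI)
  fix us x y vs c ds
  assume *: "homogs_of N m (us @ x # vs) ds \<and> homogs_of N m (us @ y # vs) ds"
  have "F (us @ (x + y) # vs) ds = F (us @ x # vs) ds + F (us @ y # vs) ds"
    using * by (intro multilinearD(1)[OF F]) auto
  moreover have "F (us @ scl A c x # vs) ds = c * F (us @ x # vs) ds"
    using * by (intro multilinearD(2)[OF F]) auto
  ultimately show "g ds * F (us @ (x + y) # vs) ds = g ds * F (us @ x # vs) ds + g ds * F (us @ y # vs) ds \<and>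
      g ds * F (us @ scl A c x # vs) ds = c * (g ds * F (us @ x # vs) ds)"
    by (simp add: distrib_left mult.left_commute)
qed

text \<open>A multilinear function is extended from homogeneous to arbitrary entries by summing over the
  components of the right total degree.\<close>

lemma functional_of_homogeneous_multilinear:
  assumes F: "multilinear N m F"
  obtains f where "\<And>x y. x \<in> carrier (T N) \<Longrightarrow> y \<in> carrier (T N) \<Longrightarrow> f (x \<oplus>\<^bsub>T N\<^esub> y) = f x + f y"
    "\<And>c x. x \<in> carrier (T N) \<Longrightarrow> f (c \<odot>\<^bsub>T N\<^esub> x) = c * f x"
    "\<And>as ds. homogs_of N m as ds \<Longrightarrow> f (tens A as) = F as ds"
proof -
  let ?S = "{ds. length ds = N \<and> sum_list ds = m}"
  define G where "G = (\<lambda>as. \<Sum>ds\<in>?S. F (map2 component ds as) ds)"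
  have fin: "finite ?S"
    by (rule finite_subset[OF _ finite_lists_length_eq[of "{..m}" N]])
       (auto dest: member_le_sum_list)
  have hom: "homogs_of N m (map2 component ds as) ds" if "length as = N" "ds \<in> ?S" for as ds
    using that by (auto simp: list_all2_conv_all_nth components(1))
  have split: "map2 component ds (us @ z # vs) = map2 component (take (length us) ds) us @
      component (ds ! length us) z # map2 component (drop (Suc (length us)) ds) vs"
    if "length us + Suc (length vs) = N" "ds \<in> ?S" for us z vs ds
  proof -
    have "ds = take (length us) ds @ ds ! length us # drop (Suc (length us)) ds"
      using that by (intro id_take_nth_drop) auto
    then have "zip ds (us @ z # vs) = zip (take (length us) ds @ ds ! length us # drop (Suc (length us)) ds) (us @ z # vs)"
      by simp
    also have "\<dots> = zip (take (length us) ds) us @ zip (ds ! length us # drop (Suc (length us)) ds) (z # vs)"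
      using that by (intro zip_append) auto
    finally show ?thesis by simp
  qed
  have "G (us @ (x + y) # vs) = G (us @ x # vs) + G (us @ y # vs)"
    if n: "length us + Suc (length vs) = N" for us vs x y
  proof -
    have "F (map2 component ds (us @ (x + y) # vs)) ds
        = F (map2 component ds (us @ x # vs)) ds + F (map2 component ds (us @ y # vs)) ds"
      if ds: "ds \<in> ?S" for ds
    proof -
      have len: "length (us @ x # vs) = N" "length (us @ y # vs) = N" using n by simp_all
      note x = hom[OF len(1) ds] and y = hom[OF len(2) ds]
      show ?thesis
        using multilinearD(1)[OF F x[unfolded split[OF n ds]] y[unfolded split[OF n ds]]]
        unfolding split[OF n ds] component_add .
    qed
    then have "G (us @ (x + y) # vs)
        = (\<Sum>ds\<in>?S. F (map2 component ds (us @ x # vs)) ds + F (map2 component ds (us @ y # vs)) ds)"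
      unfolding G_def by (rule sum.cong[OF refl])
    then show ?thesis unfolding G_def by (simp only: sum.distrib)
  qed
  moreover have "G (us @ scl A c x # vs) = c * G (us @ x # vs)"
    if n: "length us + Suc (length vs) = N" for us vs c x
    unfolding G_def sum_distrib_left
  proof (intro sum.cong refl)
    fix ds assume ds: "ds \<in> ?S"
    show "F (map2 component ds (us @ scl A c x # vs)) ds = c * F (map2 component ds (us @ x # vs)) ds"
    proof -
      have len: "length (us @ x # vs) = N" using n by simp
      note x = hom[OF len ds]
      show ?thesis
        using multilinearD(2)[OF F x[unfolded split[OF n ds]]]
        unfolding split[OF n ds] component_scale .
    qed
  qed
  ultimately obtain f where f: "\<And>x y. x \<in> carrier (T N) \<Longrightarrow> y \<in> carrier (T N) \<Longrightarrow> f (x \<oplus>\<^bsub>T N\<^esub> y) = f x + f y"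
    "\<And>c x. x \<in> carrier (T N) \<Longrightarrow> f (c \<odot>\<^bsub>T N\<^esub> x) = c * f x"
    "\<And>as. length as = N \<Longrightarrow> f (tens A as) = G as"
    by (rule functional_of_multilinear[of N G]) blast+
  have "G as = F as ds" if *: "homogs_of N m as ds" for as ds
  proof -
    have ds: "length ds = N" using * by (auto dest: list_all2_lengthD)
    have zero: "F (map2 component es as) es = 0" if es: "es \<in> ?S" "es \<noteq> ds" for es
    proof -
      obtain i where i: "i < N" "es ! i \<noteq> ds ! i" using es ds by (auto simp: list_eq_iff_nth_eq)
      let ?l = "map2 component es as"
      have "?l ! i = 0"
        using i * es component_homog[of "as ! i" "ds ! i" "es ! i"] by (auto simp: list_all2_conv_all_nth)
      then have l: "?l = take i ?l @ 0 # drop (Suc i) ?l"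
        using id_take_nth_drop[of i ?l] i es * by simp
      have "homogs_of N m ?l es" using hom[of as es] * es by simp
      then show ?thesis using multilinear_zero[OF F, of "take i ?l" "drop (Suc i) ?l" es] l by metis
    qed
    have "G as = (\<Sum>es\<in>{ds}. F (map2 component es as) es)"
      unfolding G_def using fin ds * zero by (intro sum.mono_neutral_right) auto
    moreover have "map2 component ds as = as"
      using * ds component_homog by (auto simp: list_all2_conv_all_nth intro!: nth_equalityI)
    ultimately show ?thesis by simp
  qed
  then show ?thesis using f by (intro that[of f]) auto
qed

lemma cochain_with_values_eqI:
  assumes "g \<in> C n m" "\<And>as ds. homogs_of (Suc n) m as ds \<Longrightarrow> g (tens A as) = F as ds"
  shows "cochain_with_values A n m F = g"
  unfolding cochain_with_values_def
proof (rule the_equality)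
  show "g \<in> C n m \<and> (\<forall>as ds. homog_list A (n + 1) as ds \<and> sum_list ds = m \<longrightarrow> g (tens A as) = F as ds)"
    using assms by (auto simp: homog_list_iff)
  show "h = g" if "h \<in> C n m \<and> (\<forall>as ds. homog_list A (n + 1) as ds \<and> sum_list ds = m \<longrightarrow> h (tens A as) = F as ds)" for h
    using that assms by (intro cochain_eqI[of h n m g]) (auto simp: homog_list_iff)
qed

lemma cochain_with_values:
  assumes F: "multilinear (Suc n) m F"
  shows "cochain_with_values A n m F \<in> C n m"
    and "homogs_of (Suc n) m as ds \<Longrightarrow> cochain_with_values A n m F (tens A as) = F as ds"
proof -
  obtain f where f: "\<And>x y. x \<in> carrier (T (Suc n)) \<Longrightarrow> y \<in> carrier (T (Suc n)) \<Longrightarrow> f (x \<oplus>\<^bsub>T (Suc n)\<^esub> y) = f x + f y"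
    "\<And>c x. x \<in> carrier (T (Suc n)) \<Longrightarrow> f (c \<odot>\<^bsub>T (Suc n)\<^esub> x) = c * f x"
    "\<And>as ds. homogs_of (Suc n) m as ds \<Longrightarrow> f (tens A as) = F as ds"
    by (rule functional_of_homogeneous_multilinear[OF F]) blast
  define g where "g = (\<lambda>x. if x \<in> carrier (TG (Suc n) m) then f x else 0)"
  have g: "g \<in> C n m"
    unfolding cochain_iff
  proof (intro conjI ballI allI impI)
    note sub = is_subspaceD(1)[OF tensor_power_is_vector_space graded_is_subspace[of "Suc n" m], THEN subsetD]
    fix x assume x: "x \<in> carrier (TG (Suc n) m)"
    show "g (c \<odot>\<^bsub>T (Suc n)\<^esub> x) = c * g x" for c
      using x graded_closed(3)[OF x, of c] f(2)[OF sub[OF x], of c] by (simp add: g_def)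
    fix y assume y: "y \<in> carrier (TG (Suc n) m)"
    show "g (x \<oplus>\<^bsub>T (Suc n)\<^esub> y) = g x + g y"
      using x y graded_closed(2)[OF x y] f(1)[OF sub[OF x] sub[OF y]] by (simp add: g_def)
  qed (simp add: g_def)
  have gF: "g (tens A as) = F as ds" if "homogs_of (Suc n) m as ds" for as ds
    unfolding g_def using f(3)[OF that] tens_in_graded[OF that] by (simp only: if_True)
  have "cochain_with_values A n m F = g" by (rule cochain_with_values_eqI[OF g gF])
  then show "cochain_with_values A n m F \<in> C n m"
    "homogs_of (Suc n) m as ds \<Longrightarrow> cochain_with_values A n m F (tens A as) = F as ds"
    using g gF by (simp_all only:)
qed

lemma multilinear_merge:
  assumes F: "multilinear N m F" and i: "i < N"
  shows "multilinear (Suc N) m (\<lambda>as ds. F (merge (*) i as) (merge (+) i ds))"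
proof -
  have "F (merge (*) i (us @ (x + y) # vs)) (merge (+) i ds)
        = F (merge (*) i (us @ x # vs)) (merge (+) i ds) + F (merge (*) i (us @ y # vs)) (merge (+) i ds) \<and>
      F (merge (*) i (us @ scl A c x # vs)) (merge (+) i ds) = c * F (merge (*) i (us @ x # vs)) (merge (+) i ds)"
    if x: "homogs_of (Suc N) m (us @ x # vs) ds" and y: "homogs_of (Suc N) m (us @ y # vs) ds" for us x y vs c ds
  proof -
    have len: "length ds = Suc N" using x by (auto dest: list_all2_lengthD)
    have homogs: "homogs_of N m (merge (*) i (us @ z # vs)) (merge (+) i ds)"
      if z: "homogs_of (Suc N) m (us @ z # vs) ds" for z
    proof (intro conjI)
      have l: "Suc i < length (us @ z # vs)" "Suc i < length ds" using z i len by (simp_all only:)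
      show "length (merge (*) i (us @ z # vs)) = N" using length_merge[OF l(1)] z by simp
      show "homogs A (merge (*) i (us @ z # vs)) (merge (+) i ds)"
        by (rule homogs_merge[OF _ l(1)]) (use z in blast)
      show "sum_list (merge (+) i ds) = m" using sum_list_merge[OF l(2)] z by (simp only:)
    qed
    note hx = homogs[OF x] and hy = homogs[OF y]
    consider "Suc i < length us" | "Suc i = length us" | "i = length us" | j where "i = length us + Suc j"
      by (metis less_imp_Suc_add linorder_neqE_nat Suc_lessI add_Suc_right)
    then show ?thesis
    proof cases
      case 1
      then have eq: "merge (*) i (us @ z # vs) = merge (*) i us @ z # vs" for z by (rule merge_append_left)
      note D = multilinearD[OF F hx[unfolded eq]]
      show ?thesis unfolding eq using D(1)[OF hy[unfolded eq]] D(2) by blast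
    next
      case 2
      then obtain us' u where us: "us = us' @ [u]" by (metis length_0_conv nat.distinct(1) rev_exhaust)
      then have eq: "merge (*) i (us @ z # vs) = us' @ (u * z) # vs" for z
        using 2 merge_append_right[of i us' 0 "(*)" "u # z # vs"] by simp
      note D = multilinearD[OF F hx[unfolded eq]]
      show ?thesis unfolding eq distrib_left scl_mult_right[symmetric] using D(1)[OF hy[unfolded eq]] D(2) by blast
    next
      case 3
      then obtain v vs' where vs: "vs = v # vs'" using x i by (cases vs) auto
      then have eq: "merge (*) i (us @ z # vs) = us @ (z * v) # vs'" for z
        using 3 merge_append_right[of i us 0 "(*)" "z # v # vs'"] by simp
      note D = multilinearD[OF F hx[unfolded eq]]
      show ?thesis unfolding eq distrib_right scl_mult_left[symmetric] using D(1)[OF hy[unfolded eq]] D(2) by blast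
    next
      case 4
      then have eq: "merge (*) i (us @ z # vs) = us @ z # merge (*) j vs" for z
        using merge_append_right[of i us "Suc j" "(*)" "z # vs"] by simp
      note D = multilinearD[OF F hx[unfolded eq]]
      show ?thesis unfolding eq using D(1)[OF hy[unfolded eq]] D(2) by blast
    qed
  qed
  then show ?thesis unfolding multilinear_def by blast
qed

lemma multilinear_rotate:
  assumes F: "multilinear N m F"
  shows "multilinear N m (\<lambda>as ds. F (last as # butlast as) (last ds # butlast ds))"
  unfolding multilinear_def
proof (intro allI impI)
  fix us x y vs c ds
  let ?r = "\<lambda>as. last as # butlast as"
  assume *: "homogs_of N m (us @ x # vs) ds \<and> homogs_of N m (us @ y # vs) ds"
  then have x: "homogs_of N m (us @ x # vs) ds" and y: "homogs_of N m (us @ y # vs) ds" by blast+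
  obtain d1 d d2 where ds: "ds = d1 @ d # d2" "length d1 = length us" "homogs A vs d2"
    using x by (elim conjE homogs_append_Cons)
  show "F (?r (us @ (x + y) # vs)) (?r ds) = F (?r (us @ x # vs)) (?r ds) + F (?r (us @ y # vs)) (?r ds) \<and>
      F (?r (us @ scl A c x # vs)) (?r ds) = c * F (?r (us @ x # vs)) (?r ds)"
  proof (cases vs rule: rev_cases)
    case Nil
    then have d2: "d2 = []" using ds(3) by simp
    have H: "homogs_of N m ([] @ z # us) (d # d1)" if "homogs_of N m (us @ z # vs) ds" for z
      using that unfolding ds(1) Nil d2 by (auto simp: list_all2_append ds(2))
    have eq: "?r (us @ z # vs) = [] @ z # us" for z by (simp add: Nil)
    have eq': "?r ds = d # d1" by (simp add: ds(1) d2)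
    note D = multilinearD[OF F H[OF x]]
    show ?thesis unfolding eq eq' using D(1)[OF H[OF y]] D(2) by blast
  next
    case (snoc vs' v)
    obtain e2 e where d2: "d2 = e2 @ [e]" "length e2 = length vs'"
      using ds(3) unfolding snoc by (auto simp: list_all2_append1 list_all2_Cons1 dest: list_all2_lengthD)
    have H: "homogs_of N m ((v # us) @ z # vs') (e # d1 @ d # e2)" if "homogs_of N m (us @ z # vs) ds" for z
      using that unfolding ds(1) snoc d2(1) by (auto simp: list_all2_append ds(2) d2(2))
    have eq: "?r (us @ z # vs) = (v # us) @ z # vs'" for z by (simp add: snoc butlast_append)
    have eq': "?r ds = e # d1 @ d # e2" by (simp add: ds(1) d2(1) butlast_append)
    note D = multilinearD[OF F H[OF x]]
    show ?thesis unfolding eq eq' using D(1)[OF H[OF y]] D(2) by blast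
  qed
qed

lemma multilinear_append_one:
  assumes F: "multilinear (Suc N) m F"
  shows "multilinear N m (\<lambda>as ds. F (as @ [1]) (ds @ [0]))"
  unfolding multilinear_def
proof (intro allI impI)
  fix us x y vs c ds
  assume *: "homogs_of N m (us @ x # vs) ds \<and> homogs_of N m (us @ y # vs) ds"
  then have x: "homogs_of N m (us @ x # vs) ds" and y: "homogs_of N m (us @ y # vs) ds" by blast+
  have H: "homogs_of (Suc N) m (us @ z # vs @ [1]) (ds @ [0])" if "homogs_of N m (us @ z # vs) ds" for z
    using that list_all2_appendI[of _ "us @ z # vs" ds "[1]" "[0]"] by (simp add: homog_one)
  have eq: "(us @ z # vs) @ [1] = us @ z # vs @ [1]" for z by simp
  note D = multilinearD[OF F H[OF x]]
  show "F ((us @ (x + y) # vs) @ [1]) (ds @ [0]) = F ((us @ x # vs) @ [1]) (ds @ [0]) + F ((us @ y # vs) @ [1]) (ds @ [0]) \<and>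
      F ((us @ scl A c x # vs) @ [1]) (ds @ [0]) = c * F ((us @ x # vs) @ [1]) (ds @ [0])"
    unfolding eq using D(1)[OF H[OF y]] D(2) by blast
qed

end

section \<open>The operators on cochains\<close>

lemma sign_eq: "(even a \<longleftrightarrow> even b) \<Longrightarrow> (-1) ^ a = ((-1) ^ b :: 'k::ring_1)"
  by (simp add: minus_one_power_iff)

lemma sign_mult_left:
  fixes v :: "'k::comm_ring_1"
  shows "(even (a + b) \<longleftrightarrow> even c) \<Longrightarrow> (-1) ^ a * ((-1) ^ b * v) = (-1) ^ c * v"
  by (auto simp: minus_one_power_iff)

lemma sign_mult_both:
  fixes v :: "'k::comm_ring_1"
  shows "(even (a + b) \<longleftrightarrow> even (c + d)) \<Longrightarrow> (-1) ^ a * ((-1) ^ b * v) = (-1) ^ c * ((-1) ^ d * v)"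
  by (auto simp: minus_one_power_iff)

context dga
begin

text \<open>The operator \<open>b\<close> is the sum of these faces and a rotated face \<open>0\<close>.\<close>

definition face :: "nat \<Rightarrow> nat \<Rightarrow> nat \<Rightarrow> ('a, 'k) cochain \<Rightarrow> ('a, 'k) cochain" where
  "face m n i f = cochain_with_values A (Suc n) m (\<lambda>as ds. (-1) ^ i * f (tens A (merge (*) i as)))"

lemma homogs_snocE:
  assumes "homogs A as ds" "length as = Suc n"
  obtains as' x ds' d where "as = as' @ [x]" "ds = ds' @ [d]" "homogs A as' ds'" "x \<in> homog A d"
    "length as' = n" "length ds' = n" "sum_list ds = sum_list ds' + d"
  using assms by (cases as rule: rev_cases)
    (auto simp: list_all2_append1 list_all2_Cons1 dest: list_all2_lengthD)

lemma homogs_of_snocE: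
  assumes "homogs_of (Suc n) m as ds"
  obtains as' x ds' d where "as = as' @ [x]" "ds = ds' @ [d]" "homogs A as' ds'" "x \<in> homog A d"
    "length as' = n" "sum_list ds' + d = m"
proof -
  have h: "homogs A as ds" "length as = Suc n" "sum_list ds = m" using assms by blast+
  obtain as' x ds' d where *: "as = as' @ [x]" "ds = ds' @ [d]" "homogs A as' ds'" "x \<in> homog A d"
    "length as' = n" "sum_list ds = sum_list ds' + d" by (rule homogs_snocE[OF h(1,2)])
  have "sum_list ds' + d = m" using *(6) h(3) by simp
  then show ?thesis by (rule that[OF *(1-5)])
qed

lemma homogs_snoc:
  "homogs A as ds \<Longrightarrow> x \<in> homog A d \<Longrightarrow> homogs A (as @ [x]) (ds @ [d])"
  by (simp add: list_all2_appendI)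

lemma homogs_append:
  "homogs A as ds \<Longrightarrow> homogs A bs es \<Longrightarrow> homogs A (as @ bs) (ds @ es)"
  by (simp add: list_all2_appendI)

lemma tau_multilinear:
  assumes f: "f \<in> C n m"
  shows "multilinear (Suc n) m (\<lambda>as ds. (-1) ^ (n + last_sign_exp ds) * f (tens A (last as # butlast as)))"
  by (rule multilinear_scale[OF multilinear_rotate[OF multilinear_cochain[OF f]]])

lemma tau_closed: "f \<in> C n m \<Longrightarrow> op_tau A n m f \<in> C n m"
  unfolding op_tau_def by (rule cochain_with_values(1)[OF tau_multilinear])

lemma tau_value:
  assumes f: "f \<in> C n m" and "homogs A as ds" "x \<in> homog A d" "length as = n" "sum_list ds + d = m"
  shows "op_tau A n m f (tens A (as @ [x])) = (-1) ^ (n + d * sum_list ds) * f (tens A (x # as))"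
proof -
  have "homogs_of (Suc n) m (as @ [x]) (ds @ [d])" using assms homogs_snoc by simp
  from cochain_with_values(2)[OF tau_multilinear[OF f] this] show ?thesis
    unfolding op_tau_def by (simp add: last_sign_exp_def)
qed

lemma face_multilinear:
  assumes f: "f \<in> C n m" and i: "i \<le> n"
  shows "multilinear (Suc (Suc n)) m (\<lambda>as ds. (-1) ^ i * f (tens A (merge (*) i as)))"
  using multilinear_scale[OF multilinear_merge[OF multilinear_cochain[OF f]], of i "\<lambda>_. (-1) ^ i"] i
  by (simp only: less_Suc_eq_le)

lemma face_closed: "f \<in> C n m \<Longrightarrow> i \<le> n \<Longrightarrow> face m n i f \<in> C (Suc n) m"
  unfolding face_def by (rule cochain_with_values(1)[OF face_multilinear])

lemma face_value:
  assumes f: "f \<in> C n m" and "i \<le> n" and "homogs A as ds" "length as = Suc (Suc n)" "sum_list ds = m"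
  shows "face m n i f (tens A as) = (-1) ^ i * f (tens A (merge (*) i as))"
  using cochain_with_values(2)[OF face_multilinear[OF f \<open>i \<le> n\<close>], of as ds] assms(3-)
  unfolding face_def by (simp only: simp_thms)

lemma s_multilinear:
  assumes f: "f \<in> C (Suc n) m"
  shows "multilinear (Suc n) m (\<lambda>as ds. (-1) ^ n * f (tens A (as @ [1])))"
  by (rule multilinear_scale[OF multilinear_append_one[OF multilinear_cochain[OF f]]])

lemma s_closed: "f \<in> C (Suc n) m \<Longrightarrow> op_s A n m f \<in> C n m"
  unfolding op_s_def by (rule cochain_with_values(1)[OF s_multilinear])

lemma s_value:
  assumes f: "f \<in> C (Suc n) m" and "homogs A as ds" "length as = Suc n" "sum_list ds = m"
  shows "op_s A n m f (tens A as) = (-1) ^ n * f (tens A (as @ [1]))"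
  using cochain_with_values(2)[OF s_multilinear[OF f], of as ds] assms(2-)
  unfolding op_s_def by (simp only: simp_thms)

text \<open>Linearity of the operators is read off from their values.\<close>

lemma tau_linear:
  assumes f: "f \<in> C n m"
  shows "g \<in> C n m \<Longrightarrow> op_tau A n m (f + g) = op_tau A n m f + op_tau A n m g"
    and "op_tau A n m (\<lambda>x. c * f x) = (\<lambda>x. c * op_tau A n m f x)"
proof -
  show "op_tau A n m (f + g) = op_tau A n m f + op_tau A n m g" if g: "g \<in> C n m"
  proof (rule cochain_eqI[OF tau_closed[OF cochains_closed(2)[OF f g]]
        cochains_closed(2)[OF tau_closed[OF f] tau_closed[OF g]]])
    fix as ds assume "homogs_of (Suc n) m as ds"
    then obtain as' x ds' d where *: "as = as' @ [x]" "ds = ds' @ [d]" "homogs A as' ds'" "x \<in> homog A d"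
        "length as' = n" "sum_list ds' + d = m" by (rule homogs_of_snocE)
    show "op_tau A n m (f + g) (tens A as) = (op_tau A n m f + op_tau A n m g) (tens A as)"
      unfolding *(1) plus_fun_apply tau_value[OF cochains_closed(2)[OF f g] *(3-)] tau_value[OF f *(3-)]
        tau_value[OF g *(3-)] by (rule distrib_left)
  qed
  show "op_tau A n m (\<lambda>x. c * f x) = (\<lambda>x. c * op_tau A n m f x)"
  proof (rule cochain_eqI[OF tau_closed[OF cochains_closed(4)[OF f]] cochains_closed(4)[OF tau_closed[OF f]]])
    fix as ds assume "homogs_of (Suc n) m as ds"
    then obtain as' x ds' d where *: "as = as' @ [x]" "ds = ds' @ [d]" "homogs A as' ds'" "x \<in> homog A d"
        "length as' = n" "sum_list ds' + d = m" by (rule homogs_of_snocE)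
    show "op_tau A n m (\<lambda>x. c * f x) (tens A as) = c * op_tau A n m f (tens A as)"
      unfolding *(1) tau_value[OF cochains_closed(4)[OF f] *(3-)] tau_value[OF f *(3-)]
      by (rule mult.left_commute)
  qed
qed

lemma face_linear:
  assumes f: "f \<in> C n m" and i: "i \<le> n"
  shows "g \<in> C n m \<Longrightarrow> face m n i (f + g) = face m n i f + face m n i g"
    and "face m n i (\<lambda>x. c * f x) = (\<lambda>x. c * face m n i f x)"
proof -
  show "face m n i (f + g) = face m n i f + face m n i g" if g: "g \<in> C n m"
  proof (rule cochain_eqI[OF face_closed[OF cochains_closed(2)[OF f g] i]
        cochains_closed(2)[OF face_closed[OF f i] face_closed[OF g i]]])
    fix as ds assume "homogs_of (Suc (Suc n)) m as ds"
    then have *: "homogs A as ds" "length as = Suc (Suc n)" "sum_list ds = m" by blast+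
    show "face m n i (f + g) (tens A as) = (face m n i f + face m n i g) (tens A as)"
      unfolding plus_fun_apply face_value[OF cochains_closed(2)[OF f g] i *] face_value[OF f i *]
        face_value[OF g i *] by (rule distrib_left)
  qed
  show "face m n i (\<lambda>x. c * f x) = (\<lambda>x. c * face m n i f x)"
  proof (rule cochain_eqI[OF face_closed[OF cochains_closed(4)[OF f] i] cochains_closed(4)[OF face_closed[OF f i]]])
    fix as ds assume "homogs_of (Suc (Suc n)) m as ds"
    then have *: "homogs A as ds" "length as = Suc (Suc n)" "sum_list ds = m" by blast+
    show "face m n i (\<lambda>x. c * f x) (tens A as) = c * face m n i f (tens A as)"
      unfolding face_value[OF cochains_closed(4)[OF f] i *] face_value[OF f i *]
      by (rule mult.left_commute)
  qed
qed

lemma s_linear: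
  assumes f: "f \<in> C (Suc n) m"
  shows "g \<in> C (Suc n) m \<Longrightarrow> op_s A n m (f + g) = op_s A n m f + op_s A n m g"
    and "op_s A n m (\<lambda>x. c * f x) = (\<lambda>x. c * op_s A n m f x)"
proof -
  show "op_s A n m (f + g) = op_s A n m f + op_s A n m g" if g: "g \<in> C (Suc n) m"
  proof (rule cochain_eqI[OF s_closed[OF cochains_closed(2)[OF f g]]
        cochains_closed(2)[OF s_closed[OF f] s_closed[OF g]]])
    fix as ds assume "homogs_of (Suc n) m as ds"
    then have *: "homogs A as ds" "length as = Suc n" "sum_list ds = m" by blast+
    show "op_s A n m (f + g) (tens A as) = (op_s A n m f + op_s A n m g) (tens A as)"
      unfolding plus_fun_apply s_value[OF cochains_closed(2)[OF f g] *] s_value[OF f *]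
        s_value[OF g *] by (rule distrib_left)
  qed
  show "op_s A n m (\<lambda>x. c * f x) = (\<lambda>x. c * op_s A n m f x)"
  proof (rule cochain_eqI[OF s_closed[OF cochains_closed(4)[OF f]] cochains_closed(4)[OF s_closed[OF f]]])
    fix as ds assume "homogs_of (Suc n) m as ds"
    then have *: "homogs A as ds" "length as = Suc n" "sum_list ds = m" by blast+
    show "op_s A n m (\<lambda>x. c * f x) (tens A as) = c * op_s A n m f (tens A as)"
      unfolding s_value[OF cochains_closed(4)[OF f] *] s_value[OF f *]
      by (rule mult.left_commute)
  qed
qed

lemma tau_power_closed: "f \<in> C n m \<Longrightarrow> (op_tau A n m ^^ k) f \<in> C n m"
  by (induction k) (auto intro: tau_closed)

text \<open>Moving \<open>k\<close> entries from the end to the front one after the other costs the Koszul sign of moving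
  them as a block, as the signs of the moves past each other cancel in pairs. For a full turn the total
  sign is \<open>(-1)\<^bsup>n(n + 1)\<^esup> = 1\<close>.\<close>

lemma tau_power_value:
  assumes f: "f \<in> C n m"
  shows "homogs A as da \<Longrightarrow> homogs A bs db \<Longrightarrow> length as + length bs = Suc n \<Longrightarrow>
    sum_list da + sum_list db = m \<Longrightarrow> (op_tau A n m ^^ length bs) f (tens A (as @ bs))
      = (-1) ^ (n * length bs + sum_list db * sum_list da) * f (tens A (bs @ as))"
proof (induction bs arbitrary: as da db rule: rev_induct)
  case Nil
  then show ?case by simp
next
  case (snoc x bs)
  obtain eb d where db: "db = eb @ [d]" and bs: "homogs A bs eb" and x: "x \<in> homog A d"
    using snoc.prems(2) by (auto simp: list_all2_append1 list_all2_Cons1)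
  let ?g = "(op_tau A n m ^^ length bs) f"
  have "(op_tau A n m ^^ length (bs @ [x])) f (tens A (as @ bs @ [x]))
      = op_tau A n m ?g (tens A ((as @ bs) @ [x]))" by simp
  also have "\<dots> = (-1) ^ (n + d * sum_list (da @ eb)) * ?g (tens A (x # as @ bs))"
    by (rule tau_value[OF tau_power_closed[OF f] homogs_append[OF snoc.prems(1) bs] x])
       (use snoc.prems(3,4) db in simp_all)
  also have "?g (tens A (x # as @ bs))
      = (-1) ^ (n * length bs + sum_list eb * sum_list (d # da)) * f (tens A (bs @ x # as))"
    using snoc.IH[of "x # as" "d # da" eb] snoc.prems db bs x by simp
  also have "(-1) ^ (n + d * sum_list (da @ eb)) * \<dots>
      = (-1) ^ (n * length (bs @ [x]) + sum_list db * sum_list da) * f (tens A (bs @ x # as))"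
    unfolding db by (rule sign_mult_left) (auto simp: even_add even_mult_iff)
  finally show ?case by simp
qed

text \<open>Each relation is checked on a list of homogeneous elements: on both sides the entries are multiplied
  and rotated in the same way, and the exponents of the signs have the same parity.\<close>

lemma cyclic_cochains: "cyclic_cochains (\<lambda>n. C n m) (\<lambda>n. op_tau A n m) (face m) (\<lambda>n. op_s A n m)"
proof
  fix n i j f g
  show "0 \<in> C n m" "f \<in> C n m \<Longrightarrow> g \<in> C n m \<Longrightarrow> f + g \<in> C n m" "f \<in> C n m \<Longrightarrow> - f \<in> C n m"
    by (fact cochains_closed)+
  show "f \<in> C n m \<Longrightarrow> op_tau A n m f \<in> C n m" by (rule tau_closed)
  show "f \<in> C n m \<Longrightarrow> g \<in> C n m \<Longrightarrow> op_tau A n m (f + g) = op_tau A n m f + op_tau A n m g"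
    by (rule tau_linear)
  show "f \<in> C n m \<Longrightarrow> i \<le> n \<Longrightarrow> face m n i f \<in> C (Suc n) m" by (rule face_closed)
  show "f \<in> C n m \<Longrightarrow> g \<in> C n m \<Longrightarrow> i \<le> n \<Longrightarrow> face m n i (f + g) = face m n i f + face m n i g"
    by (rule face_linear)
  show "f \<in> C (Suc n) m \<Longrightarrow> op_s A n m f \<in> C n m" by (rule s_closed)
  show "f \<in> C (Suc n) m \<Longrightarrow> g \<in> C (Suc n) m \<Longrightarrow> op_s A n m (f + g) = op_s A n m f + op_s A n m g"
    by (rule s_linear)
  have homogs_merge': "homogs A (merge (*) i as) (merge (+) i ds) \<and> length (merge (*) i as) = k \<and>
      sum_list (merge (+) i ds) = sum_list ds"
    if "homogs A as ds" "length as = Suc k" "i < k" for as ds i k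
    using homogs_merge[OF that(1), of i] length_merge[of i as "(*)"] sum_list_merge[of i ds] that
      list_all2_lengthD[OF that(1)] by simp
  show "face m (Suc n) i (face m n j f) = - face m (Suc n) (Suc j) (face m n i f)"
    if f: "f \<in> C n m" and ij: "i \<le> j" "j \<le> n"
  proof (rule cochain_eqI)
    show "face m (Suc n) i (face m n j f) \<in> C (Suc (Suc n)) m"
      "- face m (Suc n) (Suc j) (face m n i f) \<in> C (Suc (Suc n)) m"
      using ij by (auto intro!: face_closed f cochains_closed(3))
    fix as ds assume *: "homogs_of (Suc (Suc (Suc n))) m as ds"
    have val: "face m (Suc n) k (face m n l f) (tens A as)
        = (-1) ^ k * ((-1) ^ l * f (tens A (merge (*) l (merge (*) k as))))"
      if "k \<le> Suc n" "l \<le> n" for k l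
      using face_value[OF face_closed[OF f that(2)] that(1), of as ds]
        face_value[OF f that(2), of "merge (*) k as" "merge (+) k ds"]
        homogs_merge'[of as ds "Suc (Suc n)" k] * that by simp
    have "merge (*) i (merge (*) (Suc j) as) = merge (*) j (merge (*) i as)"
      using ij * by (intro merge_merge_mult) auto
    then show "face m (Suc n) i (face m n j f) (tens A as) = (- face m (Suc n) (Suc j) (face m n i f)) (tens A as)"
      using val[of i j] val[of "Suc j" i] ij by (simp add: mult.left_commute)
  qed
  show "face m (Suc n) 0 (op_tau A (Suc n) m (face m n 0 f)) = - op_tau A (Suc (Suc n)) m (face m (Suc n) 0 (face m n 0 f))"
    if f: "f \<in> C n m"
  proof (rule cochain_eqI)
    have cl: "face m n 0 f \<in> C (Suc n) m" "face m (Suc n) 0 (face m n 0 f) \<in> C (Suc (Suc n)) m"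
      by (auto intro!: face_closed f)
    show "face m (Suc n) 0 (op_tau A (Suc n) m (face m n 0 f)) \<in> C (Suc (Suc n)) m"
      "- op_tau A (Suc (Suc n)) m (face m (Suc n) 0 (face m n 0 f)) \<in> C (Suc (Suc n)) m"
      by (auto intro!: face_closed tau_closed f cochains_closed(3))
    fix as ds assume *: "homogs_of (Suc (Suc (Suc n))) m as ds"
    then obtain as' x ds' d where 1: "as = as' @ [x]" "ds = ds' @ [d]" "homogs A as' ds'" "x \<in> homog A d"
        "length as' = Suc (Suc n)" "sum_list ds' + d = m" by (rule homogs_of_snocE)
    obtain a b as'' da db ds'' where 2: "as' = a # b # as''" "ds' = da # db # ds''" "a \<in> homog A da"
        "b \<in> homog A db" "homogs A as'' ds''" "length as'' = n"
      using 1(3,5) by (auto simp: length_Suc_conv list_all2_Cons1)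
    note ab = homog_mult[OF 2(3,4)] and xa = homog_mult[OF 1(4) 2(3)]
    have sum: "sum_list ((da + db) # ds'') = sum_list ds'" using 2(2) by simp
    have "face m (Suc n) 0 (op_tau A (Suc n) m (face m n 0 f)) (tens A as)
        = op_tau A (Suc n) m (face m n 0 f) (tens A ((a * b # as'') @ [x]))"
      using face_value[OF tau_closed[OF cl(1)], of 0 as ds] * 1 2 by simp
    also have "\<dots> = (-1) ^ (Suc n + d * sum_list ((da + db) # ds'')) * face m n 0 f (tens A (x # a * b # as''))"
      by (rule tau_value[OF cl(1)]) (use 1 2 ab in \<open>simp_all\<close>)
    also have "face m n 0 f (tens A (x # a * b # as'')) = f (tens A (x * (a * b) # as''))"
      using face_value[OF f, of 0 "x # a * b # as''" "d # (da + db) # ds''"] 1 2 ab by simp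
    finally have L: "face m (Suc n) 0 (op_tau A (Suc n) m (face m n 0 f)) (tens A as)
        = (-1) ^ (Suc n + d * sum_list ((da + db) # ds'')) * f (tens A (x * (a * b) # as''))" .
    have "op_tau A (Suc (Suc n)) m (face m (Suc n) 0 (face m n 0 f)) (tens A as)
        = (-1) ^ (Suc (Suc n) + d * sum_list ds') * face m (Suc n) 0 (face m n 0 f) (tens A (x # as'))"
      unfolding 1(1) by (rule tau_value[OF cl(2)]) (use 1 in simp_all)
    also have "face m (Suc n) 0 (face m n 0 f) (tens A (x # as')) = face m n 0 f (tens A (x * a # b # as''))"
      using face_value[OF cl(1), of 0 "x # as'" "d # ds'"] 1 2 by simp
    also have "\<dots> = f (tens A (x * a * b # as''))"
      using face_value[OF f, of 0 "x * a # b # as''" "(d + da) # db # ds''"] 1 2 xa by simp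
    finally show "face m (Suc n) 0 (op_tau A (Suc n) m (face m n 0 f)) (tens A as)
        = (- op_tau A (Suc (Suc n)) m (face m (Suc n) 0 (face m n 0 f))) (tens A as)"
      unfolding L sum by (simp add: mult.assoc)
  qed
  show "op_tau A (Suc n) m (face m n (Suc i) f) = face m n i (op_tau A n m f)" if f: "f \<in> C n m" and i: "i < n"
  proof (rule cochain_eqI)
    show "op_tau A (Suc n) m (face m n (Suc i) f) \<in> C (Suc n) m" "face m n i (op_tau A n m f) \<in> C (Suc n) m"
      using i by (auto intro!: face_closed tau_closed f)
    fix as ds assume *: "homogs_of (Suc (Suc n)) m as ds"
    then obtain as' x ds' d where 1: "as = as' @ [x]" "ds = ds' @ [d]" "homogs A as' ds'" "x \<in> homog A d"
        "length as' = Suc n" "sum_list ds' + d = m" by (rule homogs_of_snocE)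
    note hm = homogs_merge'[OF 1(3,5) i]
    have "op_tau A (Suc n) m (face m n (Suc i) f) (tens A as)
        = (-1) ^ (Suc n + d * sum_list ds') * face m n (Suc i) f (tens A (x # as'))"
      unfolding 1(1) by (rule tau_value) (use 1 i f in \<open>simp_all add: face_closed\<close>)
    also have "face m n (Suc i) f (tens A (x # as')) = (-1) ^ Suc i * f (tens A (x # merge (*) i as'))"
      using face_value[OF f, of "Suc i" "x # as'" "d # ds'"] 1 i by simp
    finally have L: "op_tau A (Suc n) m (face m n (Suc i) f) (tens A as)
        = (-1) ^ (Suc n + d * sum_list ds') * ((-1) ^ Suc i * f (tens A (x # merge (*) i as')))" .
    have "merge (*) i (as' @ [x]) = merge (*) i as' @ [x]" using 1 i by (intro merge_append_left) simp
    then have "face m n i (op_tau A n m f) (tens A as) = (-1) ^ i * op_tau A n m f (tens A (merge (*) i as' @ [x]))"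
      using face_value[OF tau_closed[OF f], of i as ds] * 1(1) i by simp
    also have "op_tau A n m f (tens A (merge (*) i as' @ [x]))
        = (-1) ^ (n + d * sum_list (merge (+) i ds')) * f (tens A (x # merge (*) i as'))"
      by (rule tau_value[OF f]) (use hm 1 in simp_all)
    finally show "op_tau A (Suc n) m (face m n (Suc i) f) (tens A as) = face m n i (op_tau A n m f) (tens A as)"
      unfolding L using hm by (auto simp: minus_one_power_iff)
  qed
  show "op_tau A (Suc n) m (op_tau A (Suc n) m (face m n 0 f)) = face m n n (op_tau A n m f)" if f: "f \<in> C n m"
  proof (rule cochain_eqI)
    have cl: "face m n 0 f \<in> C (Suc n) m" by (rule face_closed[OF f]) simp
    show "op_tau A (Suc n) m (op_tau A (Suc n) m (face m n 0 f)) \<in> C (Suc n) m" "face m n n (op_tau A n m f) \<in> C (Suc n) m"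
      by (auto intro!: face_closed tau_closed f)
    fix as ds assume *: "homogs_of (Suc (Suc n)) m as ds"
    then obtain as' x ds' d where 1: "as = as' @ [x]" "ds = ds' @ [d]" "homogs A as' ds'" "x \<in> homog A d"
        "length as' = Suc n" "sum_list ds' + d = m" by (rule homogs_of_snocE)
    obtain as'' y ds'' e where 2: "as' = as'' @ [y]" "ds' = ds'' @ [e]" "homogs A as'' ds''" "y \<in> homog A e"
        "length as'' = n" "sum_list ds' = sum_list ds'' + e" using homogs_snocE[OF 1(3,5)] by metis
    note yx = homog_mult[OF 2(4) 1(4)]
    have "op_tau A (Suc n) m (op_tau A (Suc n) m (face m n 0 f)) (tens A as)
        = (-1) ^ (Suc n + d * sum_list ds') * op_tau A (Suc n) m (face m n 0 f) (tens A (x # as'))"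
      unfolding 1(1) by (rule tau_value[OF tau_closed[OF cl]]) (use 1 in simp_all)
    also have "op_tau A (Suc n) m (face m n 0 f) (tens A (x # as'))
        = (-1) ^ (Suc n + e * sum_list (d # ds'')) * face m n 0 f (tens A (y # x # as''))"
      using tau_value[OF cl, of "x # as''" "d # ds''" y e] 1 2 by simp
    also have "face m n 0 f (tens A (y # x # as'')) = f (tens A (y * x # as''))"
      using face_value[OF f, of 0 "y # x # as''" "e # d # ds''"] 1 2 by simp
    finally have L: "op_tau A (Suc n) m (op_tau A (Suc n) m (face m n 0 f)) (tens A as)
        = (-1) ^ (Suc n + d * sum_list ds') * ((-1) ^ (Suc n + e * sum_list (d # ds'')) * f (tens A (y * x # as'')))" .
    have "merge (*) n (as'' @ [y, x]) = as'' @ [y * x]" using merge_append_right[of n as'' 0 "(*)" "[y, x]"] 2 by simp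
    then have "face m n n (op_tau A n m f) (tens A as) = (-1) ^ n * op_tau A n m f (tens A (as'' @ [y * x]))"
      using face_value[OF tau_closed[OF f], of n as ds] * 1 2 by simp
    also have "op_tau A n m f (tens A (as'' @ [y * x])) = (-1) ^ (n + (e + d) * sum_list ds'') * f (tens A (y * x # as''))"
      by (rule tau_value[OF f 2(3) yx]) (use 1 2 in simp_all)
    finally show "op_tau A (Suc n) m (op_tau A (Suc n) m (face m n 0 f)) (tens A as) = face m n n (op_tau A n m f) (tens A as)"
      unfolding L 2(6) by (simp only:) (rule sign_mult_both, auto simp: even_add even_mult_iff)
  qed
  show "(op_tau A n m ^^ Suc n) f = f" if f: "f \<in> C n m"
  proof (rule cochain_eqI[OF tau_power_closed[OF f] f])
    fix as ds assume "homogs_of (Suc n) m as ds"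
    then show "(op_tau A n m ^^ Suc n) f (tens A as) = f (tens A as)"
      using tau_power_value[OF f, of "[]" "[]" as ds] by (simp del: funpow.simps)
  qed
  show "op_s A n m (face m n n f) = f" if f: "f \<in> C n m"
  proof (rule cochain_eqI[OF s_closed[OF face_closed[OF f]] f])
    fix as ds assume *: "homogs_of (Suc n) m as ds"
    then obtain as' x ds' d where 1: "as = as' @ [x]" "ds = ds' @ [d]" "homogs A as' ds'" "x \<in> homog A d"
        "length as' = n" "sum_list ds' + d = m" by (rule homogs_of_snocE)
    have "op_s A n m (face m n n f) (tens A as) = (-1) ^ n * face m n n f (tens A (as @ [1]))"
      by (rule s_value[OF face_closed[OF f]]) (use * in auto)
    also have "face m n n f (tens A (as @ [1])) = (-1) ^ n * f (tens A (merge (*) n (as @ [1])))"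
      using face_value[OF f, of n "as @ [1]" "ds @ [0]"] * homogs_snoc[OF _ homog_one, of as ds] by simp
    also have "merge (*) n (as @ [1]) = as" using merge_append_right[of n as' 0 "(*)" "[x, 1]"] 1 by simp
    also have "(-1) ^ n * ((-1) ^ n * f (tens A as)) = (-1) ^ 0 * f (tens A as)"
      by (rule sign_mult_left) simp
    finally show "op_s A n m (face m n n f) (tens A as) = f (tens A as)" by simp
  qed simp
  show "op_s A (Suc n) m (face m (Suc n) i f) = - face m n i (op_s A n m f)" if f: "f \<in> C (Suc n) m" and i: "i \<le> n"
  proof (rule cochain_eqI)
    show "op_s A (Suc n) m (face m (Suc n) i f) \<in> C (Suc n) m" "- face m n i (op_s A n m f) \<in> C (Suc n) m"
      using i by (auto intro!: s_closed face_closed f cochains_closed(3))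
    fix as ds assume *: "homogs_of (Suc (Suc n)) m as ds"
    have "i < Suc n" using i by simp
    note hm = homogs_merge'[of as ds "Suc n", OF _ _ this]
    have "op_s A (Suc n) m (face m (Suc n) i f) (tens A as) = (-1) ^ Suc n * face m (Suc n) i f (tens A (as @ [1]))"
      by (rule s_value) (use * f i in \<open>auto intro: face_closed\<close>)
    also have "face m (Suc n) i f (tens A (as @ [1])) = (-1) ^ i * f (tens A (merge (*) i (as @ [1])))"
      using face_value[OF f, of i "as @ [1]" "ds @ [0]"] * homogs_snoc[OF _ homog_one, of as ds] i by simp
    also have "merge (*) i (as @ [1]) = merge (*) i as @ [1]" using * i by (intro merge_append_left) simp
    finally have L: "op_s A (Suc n) m (face m (Suc n) i f) (tens A as)
        = (-1) ^ Suc n * ((-1) ^ i * f (tens A (merge (*) i as @ [1])))" .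
    have "face m n i (op_s A n m f) (tens A as) = (-1) ^ i * op_s A n m f (tens A (merge (*) i as))"
      using face_value[OF s_closed[OF f] i, of as ds] * by simp
    also have "op_s A n m f (tens A (merge (*) i as)) = (-1) ^ n * f (tens A (merge (*) i as @ [1]))"
      by (rule s_value[OF f]) (use * hm in auto)
    finally show "op_s A (Suc n) m (face m (Suc n) i f) (tens A as) = (- face m n i (op_s A n m f)) (tens A as)"
      unfolding L by (simp add: minus_one_power_iff)
  qed
qed

end

section \<open>The differential of the algebra on cochains\<close>

context dga
begin

lemma subspace_finsum_closed:
  fixes V :: "('k, 'v) module"
  assumes V: "is_vector_space V" and H: "is_subspace H V" and g: "\<And>i. i \<in> I \<Longrightarrow> g i \<in> H"
  shows "(\<Oplus>\<^bsub>V\<^esub> i\<in>I. g i) \<in> H"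
proof -
  interpret V: abelian_group V by (rule vector_space_simps(1)[OF V])
  note HD = is_subspaceD[OF V H]
  show ?thesis using g
  proof (induction I rule: infinite_finite_induct)
    case (infinite I)
    then show ?case using HD(2) V.add.finprod_infinite[of I g] by simp
  next
    case empty
    then show ?case using HD(2) by simp
  next
    case (insert i I)
    have "(\<Oplus>\<^bsub>V\<^esub> j\<in>insert i I. g j) = g i \<oplus>\<^bsub>V\<^esub> (\<Oplus>\<^bsub>V\<^esub> j\<in>I. g j)"
      using insert.hyps insert.prems HD(1) by (intro V.finsum_insert) auto
    then show ?case using insert HD(3) by simp
  qed
qed

lemma cochain_finsum:
  assumes f: "f \<in> C n m" and "finite I" "\<And>i. i \<in> I \<Longrightarrow> g i \<in> carrier (TG (Suc n) m)"
  shows "f (\<Oplus>\<^bsub>T (Suc n)\<^esub> i\<in>I. g i) = (\<Sum>i\<in>I. f (g i))"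
  using assms(2,3)
proof (induction I)
  case empty
  interpret V: abelian_group "T (Suc n)" by (rule vector_space_simps(1)[OF tensor_power_is_vector_space])
  show ?case using cochainD(4)[OF f] by simp
next
  case (insert i I)
  interpret V: abelian_group "T (Suc n)" by (rule vector_space_simps(1)[OF tensor_power_is_vector_space])
  have "(\<Oplus>\<^bsub>T (Suc n)\<^esub> j\<in>insert i I. g j) = g i \<oplus>\<^bsub>T (Suc n)\<^esub> (\<Oplus>\<^bsub>T (Suc n)\<^esub> j\<in>I. g j)"
    using insert.hyps insert.prems is_subspaceD(1)[OF tensor_power_is_vector_space graded_is_subspace[of "Suc n" m]]
    by (intro V.finsum_insert) auto
  moreover have "(\<Oplus>\<^bsub>T (Suc n)\<^esub> j\<in>I. g j) \<in> carrier (TG (Suc n) m)"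
    using insert.prems by (intro subspace_finsum_closed[OF tensor_power_is_vector_space graded_is_subspace]) auto
  ultimately show ?case
    using cochainD(1)[OF f, of "g i" "\<Oplus>\<^bsub>T (Suc n)\<^esub> j\<in>I. g j"] insert by simp
qed

lemma diff_entry_graded:
  assumes "homogs_of N (Suc m) as ds" "i < N"
  shows "tens A (as[i := diff A (as ! i)]) \<in> carrier (TG N m)"
proof -
  have as: "homogs A as ds" "length as = N" "sum_list ds = Suc m" and "length ds = N"
    using assms by (auto dest: list_all2_lengthD)
  have hom: "as ! i \<in> homog A (ds ! i)" using as(1) assms(2) \<open>length ds = N\<close> by (auto simp: list_all2_conv_all_nth)
  show ?thesis
  proof (cases "ds ! i")
    case 0
    then have "as[i := diff A (as ! i)] = take i as @ 0 # drop (Suc i) as"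
      using hom diff_homog_0 as(2) assms(2) by (simp add: upd_conv_take_nth_drop)
    then show ?thesis
      using tens_zero[of "take i as" "drop (Suc i) as" N] graded_closed(1)[of N m] as(2) assms(2) by simp
  next
    case (Suc e)
    have "homogs A (as[i := diff A (as ! i)]) (ds[i := e])"
      using as(1) diff_homog_Suc[of "as ! i" e] hom Suc by (intro list_all2_update_cong) auto
    moreover have "sum_list (ds[i := e]) = m"
      using Suc as(3) assms(2) \<open>length ds = N\<close> member_le_sum_list[of "ds ! i" ds]
      by (subst sum_list_update) auto
    ultimately show ?thesis using as(2) by (intro tens_in_graded) auto
  qed
qed

lemma tensor_diff_value:
  assumes "homogs_of N m as ds"
  shows "tensor_diff A N (tens A as) = (\<Oplus>\<^bsub>T N\<^esub> i\<in>{..<N}.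
     (-1) ^ sum_list (take i ds) \<odot>\<^bsub>T N\<^esub> tens A (as[i := diff A (as ! i)]))"
  by (rule tensor_diff(2)) (use assms in \<open>simp add: homog_list_iff\<close>)

lemma tensor_diff_graded:
  "x \<in> carrier (TG N (Suc m)) \<Longrightarrow> tensor_diff A N x \<in> carrier (TG N m)"
proof -
  note V = tensor_power_is_vector_space[of N] and G = graded_is_subspace[of N m]
  let ?H = "{x \<in> carrier (T N). tensor_diff A N x \<in> carrier (TG N m)}"
  have "is_subspace ?H (T N)"
  proof (rule is_subspaceI[OF V])
    show "\<zero>\<^bsub>T N\<^esub> \<in> ?H"
      using vector_space_simps(3)[OF V] linear_maps_zero[OF V V tensor_diff(1)] graded_closed(1)[of N m] by simp
    show "x \<oplus>\<^bsub>T N\<^esub> y \<in> ?H" if "x \<in> ?H" "y \<in> ?H" for x y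
      using that vector_space_simps(2)[OF V, of x y] linear_mapsD(2)[OF tensor_diff(1), of x N y]
        graded_closed(2)[of "tensor_diff A N x" N m "tensor_diff A N y"] by simp
    show "c \<odot>\<^bsub>T N\<^esub> x \<in> ?H" if "x \<in> ?H" for c x
      using that vector_space_simps(5)[OF V, of x c] linear_mapsD(3)[OF tensor_diff(1), of x N c]
        graded_closed(3)[of "tensor_diff A N x" N m c] by simp
  qed auto
  then have "carrier (TG N (Suc m)) \<subseteq> ?H"
  proof (rule graded_induct)
    fix as ds assume *: "homogs_of N (Suc m) as ds"
    have "tensor_diff A N (tens A as) \<in> carrier (TG N m)"
      unfolding tensor_diff_value[OF *]
      by (intro subspace_finsum_closed[OF V G] graded_closed(3) diff_entry_graded[OF *]) simp
    then show "tens A as \<in> ?H" using * by simp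
  qed
  then show "x \<in> carrier (TG N (Suc m)) \<Longrightarrow> tensor_diff A N x \<in> carrier (TG N m)" by blast
qed

text \<open>The signed sum of the values of \<open>G\<close> on the lists in which one entry is differentiated. Entries
  of degree \<open>0\<close>, whose differential vanishes, are left out, so that \<open>d - 1\<close> is never truncated.\<close>

fun dsum :: "('a list \<Rightarrow> nat list \<Rightarrow> 'k) \<Rightarrow> 'a list \<Rightarrow> nat list \<Rightarrow> 'k" where
  "dsum G (a # as) (d # ds) = (if d = 0 then 0 else G (diff A a # as) ((d - 1) # ds))
     + (-1) ^ d * dsum (\<lambda>bs es. G (a # bs) (d # es)) as ds"
| "dsum G as ds = 0"

lemma diff_homog: "a \<in> homog A d \<Longrightarrow> d \<noteq> 0 \<Longrightarrow> diff A a \<in> homog A (d - 1)"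
  using diff_homog_Suc[of a "d - 1"] by simp

text \<open>In this recursive form of the differential, the identities below become inductions on lists.\<close>

lemma sum_diff_eq_dsum:
  assumes "homogs A as ds" "\<And>us vs. length us + Suc (length vs) = length as \<Longrightarrow> G (us @ 0 # vs) = 0"
  shows "(\<Sum>i<length as. (-1) ^ sum_list (take i ds) * G (as[i := diff A (as ! i)])) = dsum (\<lambda>bs es. G bs) as ds"
  using assms
proof (induction as arbitrary: ds G)
  case Nil
  then show ?case by simp
next
  case (Cons a as)
  obtain d es where ds: "ds = d # es" "a \<in> homog A d" "homogs A as es"
    using Cons.prems(1) by (auto simp: list_all2_Cons1)
  have G0: "G (diff A a # as) = (if d = 0 then 0 else G (diff A a # as))"
    using Cons.prems(2)[of "[]" as] diff_homog_0 ds(2) by auto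
  have IH: "(\<Sum>i<length as. (-1) ^ sum_list (take i es) * G (a # as[i := diff A (as ! i)]))
      = dsum (\<lambda>bs es. G (a # bs)) as es"
    by (rule Cons.IH[OF ds(3)]) (use Cons.prems(2)[of "a # us" for us] in simp)
  let ?h = "\<lambda>i. (-1) ^ sum_list (take i (d # es)) * G ((a # as)[i := diff A ((a # as) ! i)])"
  have h_split: "(\<Sum>i<Suc (length as). ?h i) = ?h 0 + (\<Sum>i<length as. ?h (Suc i))"
    by (rule sum.lessThan_Suc_shift)
  have h_0: "?h 0 = (if d = 0 then 0 else G (diff A a # as))" using G0 by (simp only: take_0 sum_list.Nil power_0
      nth_Cons_0 list_update_code mult_1)
  have h_Suc: "(\<Sum>i<length as. ?h (Suc i))
      = (-1) ^ d * (\<Sum>i<length as. (-1) ^ sum_list (take i es) * G (a # as[i := diff A (as ! i)]))"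
    unfolding take_Suc_Cons sum_list.Cons power_add mult.assoc nth_Cons_Suc list_update_code sum_distrib_left ..
  have "(\<Sum>i<Suc (length as). ?h i) = dsum (\<lambda>bs es. G bs) (a # as) (d # es)"
    unfolding h_split h_0 h_Suc IH dsum.simps ..
  then show ?case unfolding ds(1) length_Cons .
qed

lemma dsum_cong:
  assumes "homogs A as ds"
    and "\<And>bs es. homogs A bs es \<Longrightarrow> length bs = length as \<Longrightarrow> Suc (sum_list es) = sum_list ds \<Longrightarrow> G bs es = H bs es"
  shows "dsum G as ds = dsum H as ds"
  using assms
proof (induction as arbitrary: ds G H)
  case Nil
  then show ?case by simp
next
  case (Cons a as)
  obtain d es where ds: "ds = d # es" "a \<in> homog A d" "homogs A as es"
    using Cons.prems(1) by (auto simp: list_all2_Cons1)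
  have "G (diff A a # as) ((d - 1) # es) = H (diff A a # as) ((d - 1) # es)" if "d \<noteq> 0"
    by (rule Cons.prems(2)) (use ds that diff_homog in simp_all)
  moreover have "dsum (\<lambda>bs es. G (a # bs) (d # es)) as es = dsum (\<lambda>bs es. H (a # bs) (d # es)) as es"
    by (rule Cons.IH[OF ds(3)], rule Cons.prems(2)) (use ds in simp_all)
  ultimately show ?case by (simp add: ds(1))
qed

lemma dsum_scale: "dsum (\<lambda>bs es. c * G bs es) as ds = c * dsum G as ds"
proof (induction as arbitrary: ds G)
  case (Cons a as)
  show ?case
  proof (cases ds)
    case (Cons d es)
    then show ?thesis
      using Cons.IH[of "\<lambda>bs es. G (a # bs) (d # es)" es] by (simp add: distrib_left mult.left_commute)
  qed simp
qed simp

lemma dsum_add: "dsum (\<lambda>bs es. G bs es + H bs es) as ds = dsum G as ds + dsum H as ds"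
proof (induction as arbitrary: ds G H)
  case (Cons a as)
  show ?case
  proof (cases ds)
    case (Cons d es)
    then show ?thesis
      using Cons.IH[of "\<lambda>bs es. G (a # bs) (d # es)" "\<lambda>bs es. H (a # bs) (d # es)" es]
      by (simp add: distrib_left)
  qed simp
qed simp

lemma dsum_snoc:
  "length as = length ds \<Longrightarrow> dsum G (as @ [x]) (ds @ [d]) = dsum (\<lambda>bs es. G (bs @ [x]) (es @ [d])) as ds
     + (-1) ^ sum_list ds * (if d = 0 then 0 else G (as @ [diff A x]) (ds @ [d - 1]))"
proof (induction as arbitrary: ds G)
  case (Cons a as)
  then obtain e es where ds: "ds = e # es" "length as = length es" by (cases ds) auto
  show ?case
    unfolding ds(1) append_Cons dsum.simps Cons.IH[OF ds(2), of "\<lambda>bs es. G (a # bs) (e # es)"]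
    by (simp only: distrib_left sum_list.Cons power_add mult.assoc add.assoc)
qed simp

lemma delta_closed:
  assumes f: "f \<in> C n m" shows "op_delta A n m f \<in> C n (Suc m)"
  unfolding cochain_iff
proof (intro conjI ballI allI impI)
  note sub = is_subspaceD(1)[OF tensor_power_is_vector_space graded_is_subspace[of "Suc n" "Suc m"], THEN subsetD]
  fix x assume x: "x \<in> carrier (TG (Suc n) (Suc m))"
  note Tx = tensor_diff_graded[OF x]
  show "op_delta A n m f (c \<odot>\<^bsub>T (Suc n)\<^esub> x) = c * op_delta A n m f x" for c
    using x graded_closed(3)[OF x, of c] linear_mapsD(3)[OF tensor_diff(1) sub[OF x], of c]
      cochainD(2)[OF f Tx, of c]
    by (simp add: op_delta_def)
  fix y assume y: "y \<in> carrier (TG (Suc n) (Suc m))"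
  show "op_delta A n m f (x \<oplus>\<^bsub>T (Suc n)\<^esub> y) = op_delta A n m f x + op_delta A n m f y"
    using x y graded_closed(2)[OF x y] linear_mapsD(2)[OF tensor_diff(1) sub[OF x] sub[OF y]]
      cochainD(1)[OF f Tx tensor_diff_graded[OF y]]
    by (simp add: op_delta_def distrib_left)
qed (simp add: op_delta_def)

lemma delta_linear:
  "op_delta A n m (f + g) = op_delta A n m f + op_delta A n m g"
  "op_delta A n m (\<lambda>x. c * f x) = (\<lambda>x. c * op_delta A n m f x)"
  by (rule ext, simp add: op_delta_def distrib_left) (rule ext, simp only: op_delta_def mult_zero_right mult.left_commute split: if_split, blast?)

lemma delta_value:
  assumes f: "f \<in> C n m" and "homogs A as ds" "length as = Suc n" "sum_list ds = Suc m"
  shows "op_delta A n m f (tens A as) = (-1) ^ m * dsum (\<lambda>bs es. f (tens A bs)) as ds"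
proof -
  have *: "homogs_of (Suc n) (Suc m) as ds" using assms by blast
  have g: "tens A (as[i := diff A (as ! i)]) \<in> carrier (TG (Suc n) m)" if "i \<in> {..<Suc n}" for i
    using that by (intro diff_entry_graded[OF *]) simp
  have "f (tensor_diff A (Suc n) (tens A as))
      = (\<Sum>i<Suc n. f ((-1) ^ sum_list (take i ds) \<odot>\<^bsub>T (Suc n)\<^esub> tens A (as[i := diff A (as ! i)])))"
    unfolding tensor_diff_value[OF *]
    by (intro cochain_finsum[OF f] graded_closed(3) g) simp_all
  also have "\<dots> = (\<Sum>i<Suc n. (-1) ^ sum_list (take i ds) * f (tens A (as[i := diff A (as ! i)])))"
    by (intro sum.cong refl cochainD(2)[OF f] g)
  also have "\<dots> = dsum (\<lambda>bs es. f (tens A bs)) as ds"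
    using sum_diff_eq_dsum[OF assms(2), of "\<lambda>bs. f (tens A bs)"] cochain_tens_zero[OF f] assms(3) by simp
  finally show ?thesis using tens_in_graded[OF *] by (simp add: op_delta_def)
qed

text \<open>Differentiating the entry that moves to the front changes the Koszul sign according to the total
  degree of the other entries, and differentiating one of those changes it according to the degree of
  the moving entry. These are also the signs by which the positions of the differential before and
  after the rotation differ.\<close>

lemma delta_tau:
  assumes f: "f \<in> C n m" shows "op_delta A n m (op_tau A n m f) = op_tau A n (Suc m) (op_delta A n m f)"
proof (rule cochain_eqI[OF delta_closed[OF tau_closed[OF f]] tau_closed[OF delta_closed[OF f]]])
  fix as ds assume H: "homogs_of (Suc n) (Suc m) as ds"
  then obtain as' x ds' d where 1: "as = as' @ [x]" "ds = ds' @ [d]" "homogs A as' ds'" "x \<in> homog A d"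
      "length as' = n" "sum_list ds' + d = Suc m" by (rule homogs_of_snocE)
  let ?G = "\<lambda>bs es. f (tens A bs)"
  have "dsum (\<lambda>bs es. op_tau A n m f (tens A (bs @ [x]))) as' ds'
      = dsum (\<lambda>bs es. (-1) ^ (n + d * (sum_list ds' + 1)) * f (tens A (x # bs))) as' ds'"
  proof (rule dsum_cong[OF 1(3)])
    fix bs es assume 2: "homogs A bs es" "length bs = length as'" "Suc (sum_list es) = sum_list ds'"
    have "op_tau A n m f (tens A (bs @ [x])) = (-1) ^ (n + d * sum_list es) * f (tens A (x # bs))"
      by (rule tau_value[OF f 2(1) 1(4)]) (use 1(5,6) 2(2,3) in linarith)+
    also have "(-1) ^ (n + d * sum_list es) = ((-1) ^ (n + d * (sum_list ds' + 1)) :: 'k)"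
      unfolding 2(3)[symmetric] by (rule sign_eq) (auto simp: even_add even_mult_iff)
    finally show "op_tau A n m f (tens A (bs @ [x])) = (-1) ^ (n + d * (sum_list ds' + 1)) * f (tens A (x # bs))" .
  qed
  also have "\<dots> = (-1) ^ (n + d * (sum_list ds' + 1)) * dsum (\<lambda>bs es. f (tens A (x # bs))) as' ds'"
    by (rule dsum_scale)
  finally have left: "dsum (\<lambda>bs es. op_tau A n m f (tens A (bs @ [x]))) as' ds'
      = (-1) ^ (n + d * (sum_list ds' + 1)) * dsum (\<lambda>bs es. f (tens A (x # bs))) as' ds'" .
  have right: "op_tau A n m f (tens A (as' @ [diff A x]))
      = (-1) ^ (n + (d - 1) * sum_list ds') * f (tens A (diff A x # as'))" if "d \<noteq> 0"
  proof (rule tau_value[OF f 1(3) diff_homog[OF 1(4) that] 1(5)])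
    show "sum_list ds' + (d - 1) = m" using that 1(6) by simp
  qed
  have L: "op_delta A n m (op_tau A n m f) (tens A as)
      = (-1) ^ m * dsum (\<lambda>bs es. op_tau A n m f (tens A bs)) as ds"
    by (rule delta_value[OF tau_closed[OF f]]) (use H in blast)+
  also have "dsum (\<lambda>bs es. op_tau A n m f (tens A bs)) as ds
      = (-1) ^ (n + d * (sum_list ds' + 1)) * dsum (\<lambda>bs es. f (tens A (x # bs))) as' ds'
        + (-1) ^ sum_list ds' * (if d = 0 then 0 else op_tau A n m f (tens A (as' @ [diff A x])))"
    unfolding 1(1,2) dsum_snoc[OF list_all2_lengthD[OF 1(3)]] left ..
  also have "(-1) ^ sum_list ds' * (if d = 0 then 0 else op_tau A n m f (tens A (as' @ [diff A x])))
      = (-1) ^ (n + d * sum_list ds') * (if d = 0 then 0 else f (tens A (diff A x # as')))"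
  proof (cases "d = 0")
    case False
    then obtain e where e: "d = Suc e" by (cases d) auto
    have "(-1) ^ sum_list ds' * ((-1) ^ (n + (d - 1) * sum_list ds') * f (tens A (diff A x # as')))
        = (-1) ^ (n + d * sum_list ds') * f (tens A (diff A x # as'))"
      unfolding e by (rule sign_mult_left) (auto simp: even_add even_mult_iff)
    then show ?thesis using False right by simp
  qed simp
  finally have L: "op_delta A n m (op_tau A n m f) (tens A as)
      = (-1) ^ m * ((-1) ^ (n + d * (sum_list ds' + 1)) * dsum (\<lambda>bs es. f (tens A (x # bs))) as' ds'
        + (-1) ^ (n + d * sum_list ds') * (if d = 0 then 0 else f (tens A (diff A x # as'))))" .
  have "op_tau A n (Suc m) (op_delta A n m f) (tens A as)
      = (-1) ^ (n + d * sum_list ds') * op_delta A n m f (tens A (x # as'))"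
    unfolding 1(1) by (rule tau_value[OF delta_closed[OF f] 1(3,4,5,6)])
  also have "op_delta A n m f (tens A (x # as')) = (-1) ^ m * dsum ?G (x # as') (d # ds')"
    by (rule delta_value[OF f]) (use 1(3-6) in simp_all)
  also have "dsum ?G (x # as') (d # ds')
      = (if d = 0 then 0 else f (tens A (diff A x # as'))) + (-1) ^ d * dsum (\<lambda>bs es. f (tens A (x # bs))) as' ds'"
    by (rule dsum.simps)
  finally have R: "op_tau A n (Suc m) (op_delta A n m f) (tens A as)
      = (-1) ^ (n + d * sum_list ds') * ((-1) ^ m * ((if d = 0 then 0 else f (tens A (diff A x # as')))
        + (-1) ^ d * dsum (\<lambda>bs es. f (tens A (x # bs))) as' ds'))" .
  have exp: "n + d * (sum_list ds' + 1) = (n + d * sum_list ds') + d" by simp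
  show "op_delta A n m (op_tau A n m f) (tens A as) = op_tau A n (Suc m) (op_delta A n m f) (tens A as)"
    unfolding L R exp power_add[of _ "n + d * sum_list ds'"] by (simp only: distrib_left mult_ac add_ac)
qed

text \<open>This is the Leibniz rule for the product of the first two entries.\<close>

lemma delta_face_0:
  assumes f: "f \<in> C n m" shows "op_delta A (Suc n) m (face m n 0 f) = face (Suc m) n 0 (op_delta A n m f)"
proof (rule cochain_eqI[OF delta_closed[OF face_closed[OF f]] face_closed[OF delta_closed[OF f]]])
  fix as ds assume H: "homogs_of (Suc (Suc n)) (Suc m) as ds"
  obtain a b as' d e ds' where 1: "as = a # b # as'" "ds = d # e # ds'" "a \<in> homog A d" "b \<in> homog A e"
      "homogs A as' ds'" "length as' = n" "d + e + sum_list ds' = Suc m"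
    using H by (auto simp: length_Suc_conv list_all2_Cons1)
  note ab = homog_mult[OF 1(3,4)]
  have val: "face m n 0 f (tens A (x # y # bs)) = f (tens A (x * y # bs))"
    if "x \<in> homog A k" "y \<in> homog A l" "homogs A bs es" "length bs = n" "k + l + sum_list es = m" for x y bs k l es
    using face_value[OF f, of 0 "x # y # bs" "k # l # es"] that by simp
  have "op_delta A (Suc n) m (face m n 0 f) (tens A as) = (-1) ^ m * dsum (\<lambda>bs es. face m n 0 f (tens A bs)) as ds"
    by (rule delta_value[OF face_closed[OF f]]) (use H in \<open>blast | simp\<close>)+
  also have "dsum (\<lambda>bs es. face m n 0 f (tens A bs)) as ds
      = (if d = 0 then 0 else face m n 0 f (tens A (diff A a # b # as')))
        + (-1) ^ d * ((if e = 0 then 0 else face m n 0 f (tens A (a # diff A b # as')))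
          + (-1) ^ e * dsum (\<lambda>bs es. face m n 0 f (tens A (a # b # bs))) as' ds')"
    unfolding 1(1,2) by simp
  also have "dsum (\<lambda>bs es. face m n 0 f (tens A (a # b # bs))) as' ds' = dsum (\<lambda>bs es. f (tens A (a * b # bs))) as' ds'"
  proof (rule dsum_cong[OF 1(5)])
    fix bs es assume 2: "homogs A bs es" "length bs = length as'" "Suc (sum_list es) = sum_list ds'"
    have "length bs = n" "d + e + sum_list es = m" using 2(2,3) 1(6,7) by arith+
    then show "face m n 0 f (tens A (a # b # bs)) = f (tens A (a * b # bs))"
      by (rule val[OF 1(3,4) 2(1)])
  qed
  also have "(if d = 0 then 0 else face m n 0 f (tens A (diff A a # b # as'))) = f (tens A (diff A a * b # as'))"
  proof (cases "d = 0")
    case True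
    then show ?thesis using diff_homog_0 1(3,6) cochain_tens_zero[OF f, of "[]" as'] by simp
  next
    case False
    have "face m n 0 f (tens A (diff A a # b # as')) = f (tens A (diff A a * b # as'))"
      by (rule val[OF diff_homog[OF 1(3) False] 1(4,5,6)]) (use 1(7) False in arith)
    then show ?thesis using False by simp
  qed
  also have "(if e = 0 then 0 else face m n 0 f (tens A (a # diff A b # as'))) = f (tens A (a * diff A b # as'))"
  proof (cases "e = 0")
    case True
    then show ?thesis using diff_homog_0 1(4,6) cochain_tens_zero[OF f, of "[]" as'] by simp
  next
    case False
    have "face m n 0 f (tens A (a # diff A b # as')) = f (tens A (a * diff A b # as'))"
      by (rule val[OF 1(3) diff_homog[OF 1(4) False] 1(5,6)]) (use 1(7) False in arith)
    then show ?thesis using False by simp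
  qed
  finally have L: "op_delta A (Suc n) m (face m n 0 f) (tens A as)
      = (-1) ^ m * (f (tens A (diff A a * b # as')) + (-1) ^ d * (f (tens A (a * diff A b # as'))
          + (-1) ^ e * dsum (\<lambda>bs es. f (tens A (a * b # bs))) as' ds'))" .
  have "face (Suc m) n 0 (op_delta A n m f) (tens A as) = op_delta A n m f (tens A (a * b # as'))"
    using face_value[OF delta_closed[OF f], of 0 as ds] H 1(1) by simp
  also have "\<dots> = (-1) ^ m * dsum (\<lambda>bs es. f (tens A bs)) (a * b # as') ((d + e) # ds')"
    by (rule delta_value[OF f]) (use 1(5,6,7) ab in simp_all)
  also have "dsum (\<lambda>bs es. f (tens A bs)) (a * b # as') ((d + e) # ds')
      = f (tens A (diff A (a * b) # as')) + (-1) ^ (d + e) * dsum (\<lambda>bs es. f (tens A (a * b # bs))) as' ds'"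
  proof (cases "d + e = 0")
    case True
    then have "diff A (a * b) = 0" using diff_homog_0 ab by simp
    then show ?thesis using True cochain_tens_zero[OF f, of "[]" as'] 1(6) by simp
  qed (simp only: dsum.simps if_False)
  also have "f (tens A (diff A (a * b) # as'))
      = f (tens A (diff A a * b # as')) + (-1) ^ d * f (tens A (a * diff A b # as'))"
  proof (cases "d + e = 0")
    case True
    then have "diff A a = 0" "diff A b = 0" "diff A (a * b) = 0" using diff_homog_0 ab 1(3,4) by simp_all
    then show ?thesis using cochain_tens_zero[OF f, of "[]" as'] 1(6) by simp
  next
    case False
    \<comment> \<open>One of the two summands may have the wrong degree, but then it is \<open>0\<close>.\<close>
    have da: "diff A a * b \<in> homog A (d + e - 1)"
      using homog_mult[OF diff_homog[OF 1(3)] 1(4)] diff_homog_0[of a] 1(3) by (cases "d = 0") auto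
    have db: "a * diff A b \<in> homog A (d + e - 1)"
      using homog_mult[OF 1(3) diff_homog[OF 1(4)]] diff_homog_0[of b] 1(4) by (cases "e = 0") auto
    have db': "scl A ((-1) ^ d) (a * diff A b) \<in> homog A (d + e - 1)"
      by (rule subspace_scale[OF homog_subspace db])
    have H': "homogs_of (Suc n) m ([] @ z # as') ((d + e - 1) # ds')" if "z \<in> homog A (d + e - 1)" for z
    proof -
      have "d + e - 1 + sum_list ds' = m" using 1(7) False by arith
      then show ?thesis using that 1(5,6) by simp
    qed
    note ml = multilinearD[OF multilinear_cochain[OF f]]
    show ?thesis
      using ml(1)[OF H'[OF da] H'[OF db']] ml(2)[OF H'[OF db], of "(-1) ^ d"] diff_mult[OF 1(3), of b] by simp
  qed
  finally show "op_delta A (Suc n) m (face m n 0 f) (tens A as) = face (Suc m) n 0 (op_delta A n m f) (tens A as)"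
    unfolding L by (simp only: distrib_left power_add mult.assoc add.assoc)
qed simp_all

text \<open>The unit has degree \<open>0\<close>, hence its differential contributes nothing.\<close>

lemma delta_s:
  assumes f: "f \<in> C (Suc n) m" shows "op_delta A n m (op_s A n m f) = op_s A n (Suc m) (op_delta A (Suc n) m f)"
proof (rule cochain_eqI[OF delta_closed[OF s_closed[OF f]] s_closed[OF delta_closed[OF f]]])
  fix as ds assume H: "homogs_of (Suc n) (Suc m) as ds"
  have h: "homogs A as ds" "length as = Suc n" "sum_list ds = Suc m" using H by blast+
  have "op_delta A n m (op_s A n m f) (tens A as) = (-1) ^ m * dsum (\<lambda>bs es. op_s A n m f (tens A bs)) as ds"
    by (rule delta_value[OF s_closed[OF f] h])
  also have "dsum (\<lambda>bs es. op_s A n m f (tens A bs)) as ds = dsum (\<lambda>bs es. (-1) ^ n * f (tens A (bs @ [1]))) as ds"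
  proof (rule dsum_cong[OF h(1)])
    fix bs es assume 2: "homogs A bs es" "length bs = length as" "Suc (sum_list es) = sum_list ds"
    have "length bs = Suc n" "sum_list es = m" using 2(2,3) h(2,3) by arith+
    then show "op_s A n m f (tens A bs) = (-1) ^ n * f (tens A (bs @ [1]))" by (rule s_value[OF f 2(1)])
  qed
  also have "\<dots> = (-1) ^ n * dsum (\<lambda>bs es. f (tens A (bs @ [1]))) as ds" by (rule dsum_scale)
  finally have L: "op_delta A n m (op_s A n m f) (tens A as)
      = (-1) ^ m * ((-1) ^ n * dsum (\<lambda>bs es. f (tens A (bs @ [1]))) as ds)" .
  have "op_s A n (Suc m) (op_delta A (Suc n) m f) (tens A as) = (-1) ^ n * op_delta A (Suc n) m f (tens A (as @ [1]))"
    by (rule s_value[OF delta_closed[OF f] h])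
  also have "op_delta A (Suc n) m f (tens A (as @ [1])) = (-1) ^ m * dsum (\<lambda>bs es. f (tens A bs)) (as @ [1]) (ds @ [0])"
    by (rule delta_value[OF f homogs_snoc[OF h(1) homog_one]]) (use h in simp_all)
  also have "dsum (\<lambda>bs es. f (tens A bs)) (as @ [1]) (ds @ [0]) = dsum (\<lambda>bs es. f (tens A (bs @ [1]))) as ds"
    unfolding dsum_snoc[OF list_all2_lengthD[OF h(1)]] by simp
  finally show "op_delta A n m (op_s A n m f) (tens A as) = op_s A n (Suc m) (op_delta A (Suc n) m f) (tens A as)"
    unfolding L by (simp only: mult_ac)
qed

text \<open>Differentiating two different entries in either order gives opposite signs.\<close>

lemma dsum_dsum:
  assumes "homogs A as ds" "\<And>us vs es. length us + Suc (length vs) = length as \<Longrightarrow> G (us @ 0 # vs) es = 0"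
  shows "dsum (\<lambda>bs es. dsum G bs es) as ds = 0"
  using assms
proof (induction as arbitrary: ds G)
  case Nil
  then show ?case by simp
next
  case (Cons a as)
  obtain d es where ds: "ds = d # es" "a \<in> homog A d" "homogs A as es"
    using Cons.prems(1) by (auto simp: list_all2_Cons1)
  have IH: "dsum (\<lambda>bs es. dsum (\<lambda>bs es. G (a # bs) (d # es)) bs es) as es = 0"
    by (rule Cons.IH[OF ds(3)]) (use Cons.prems(2)[of "a # us" for us] in simp)
  have "dsum (\<lambda>bs es. dsum G (a # bs) (d # es)) as es
      = dsum (\<lambda>bs es'. (if d = 0 then 0 else G (diff A a # bs) ((d - 1) # es'))) as es"
    unfolding dsum.simps dsum_add dsum_scale IH mult_zero_right add_0_right ..
  also have "\<dots> = (if d = 0 then 0 else dsum (\<lambda>bs es'. G (diff A a # bs) ((d - 1) # es')) as es)"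
  proof (cases "d = 0")
    case True
    then show ?thesis using dsum_scale[of 0 "\<lambda>_ _. 0" as es] by (simp only: if_True mult_zero_left simp_thms)
  qed (simp only: if_False)
  finally have inner: "dsum (\<lambda>bs es. dsum G (a # bs) (d # es)) as es
      = (if d = 0 then 0 else dsum (\<lambda>bs es'. G (diff A a # bs) ((d - 1) # es')) as es)" .
  have "dsum (\<lambda>bs es. dsum G bs es) (a # as) (d # es)
      = (if d = 0 then 0 else dsum G (diff A a # as) ((d - 1) # es)
        + (-1) ^ d * dsum (\<lambda>bs es'. G (diff A a # bs) ((d - 1) # es')) as es)"
    unfolding dsum.simps(1)[of "\<lambda>bs es. dsum G bs es"] inner by (cases "d = 0") (simp_all only: if_True if_False mult_zero_right add_0_left simp_thms)
  also have "\<dots> = 0"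
  proof (cases d)
    case (Suc e)
    have "G (diff A (diff A a) # as) ((e - 1) # es) = 0"
      using Cons.prems(2)[of "[]" as] by (simp only: diff_diff append_Nil list.size length_Cons add_0_left)
    then show ?thesis by (simp add: Suc)
  qed simp
  finally show ?case unfolding ds(1) .
qed

lemma delta_delta:
  assumes f: "f \<in> C n m" shows "op_delta A n (Suc m) (op_delta A n m f) = 0"
proof (rule cochain_eqI[OF delta_closed[OF delta_closed[OF f]] cochains_closed(1)])
  fix as ds assume H: "homogs_of (Suc n) (Suc (Suc m)) as ds"
  have h: "homogs A as ds" "length as = Suc n" "sum_list ds = Suc (Suc m)" using H by blast+
  have "op_delta A n (Suc m) (op_delta A n m f) (tens A as)
      = (-1) ^ Suc m * dsum (\<lambda>bs es. op_delta A n m f (tens A bs)) as ds"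
    by (rule delta_value[OF delta_closed[OF f] h])
  also have "dsum (\<lambda>bs es. op_delta A n m f (tens A bs)) as ds
      = dsum (\<lambda>bs es. (-1) ^ m * dsum (\<lambda>bs es. f (tens A bs)) bs es) as ds"
  proof (rule dsum_cong[OF h(1)])
    fix bs es assume 2: "homogs A bs es" "length bs = length as" "Suc (sum_list es) = sum_list ds"
    have "length bs = Suc n" "sum_list es = Suc m" using 2(2,3) h(2,3) by arith+
    then show "op_delta A n m f (tens A bs) = (-1) ^ m * dsum (\<lambda>bs es. f (tens A bs)) bs es"
      by (rule delta_value[OF f 2(1)])
  qed
  also have "\<dots> = (-1) ^ m * dsum (\<lambda>bs es. dsum (\<lambda>bs es. f (tens A bs)) bs es) as ds"
    by (rule dsum_scale)
  also have "dsum (\<lambda>bs es. dsum (\<lambda>bs es. f (tens A bs)) bs es) as ds = 0"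
    by (rule dsum_dsum[OF h(1)]) (use cochain_tens_zero[OF f] h(2) in simp)
  finally show "op_delta A n (Suc m) (op_delta A n m f) (tens A as) = 0 (tens A as)" by simp
qed

sublocale cyc: cyclic_cochains "\<lambda>n. C n m" "\<lambda>n. op_tau A n m" "face m" "\<lambda>n. op_s A n m" for m
  by (rule cyclic_cochains)

lemma delta_morphism:
  "cyclic_morphism (\<lambda>n. C n m) (\<lambda>n. op_tau A n m) (face m) (\<lambda>n. op_s A n m)
     (\<lambda>n. C n (Suc m)) (\<lambda>n. op_tau A n (Suc m)) (face (Suc m)) (\<lambda>n. op_s A n (Suc m))
     (\<lambda>n. op_delta A n m)"
  by (intro cyclic_morphism.intro cyclic_cochains cyclic_morphism_axioms.intro delta_closed delta_linear(1)
      delta_tau delta_face_0 delta_s)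

lemma op_b_eq: assumes f: "f \<in> C n m" shows "op_b A n m f = cyc.b m n f"
  unfolding op_b_def Suc_eq_plus1[symmetric]
proof (rule cochain_with_values_eqI[OF cyc.b_closed[OF f]])
  fix as ds assume H: "homogs_of (Suc (Suc n)) m as ds"
  then obtain as' x ds' d where 1: "as = as' @ [x]" "ds = ds' @ [d]" "homogs A as' ds'" "x \<in> homog A d"
      "length as' = Suc n" "sum_list ds' + d = m" by (rule homogs_of_snocE)
  obtain y as'' where 2: "as' = y # as''" using 1(5) by (cases as') auto
  have h: "homogs A as ds" "length as = Suc (Suc n)" "sum_list ds = m" using H by blast+
  have "cyc.b m n f (tens A as) = (\<Sum>i\<le>n. face m n i f (tens A as)) + op_tau A (Suc n) m (face m n 0 f) (tens A as)"
    by (simp add: cyc.b_def cyc.c_def sum_fun_apply)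
  moreover have "(\<Sum>i\<le>n. face m n i f (tens A as))
      = (\<Sum>i\<le>n. (-1) ^ i * f (tens A (take i as @ [as ! i * as ! Suc i] @ drop (i + 2) as)))"
  proof (intro sum.cong refl)
    fix i assume "i \<in> {..n}"
    then have i: "i \<le> n" by simp
    then show "face m n i f (tens A as) = (-1) ^ i * f (tens A (take i as @ [as ! i * as ! Suc i] @ drop (i + 2) as))"
      using face_value[OF f i h] merge_take_drop[of i as "(*)"] h(2) by simp
  qed
  moreover have "op_tau A (Suc n) m (face m n 0 f) (tens A as)
      = (-1) ^ (Suc n + d * sum_list ds') * face m n 0 f (tens A (x # as'))"
    unfolding 1(1) by (rule tau_value[OF face_closed[OF f] 1(3,4,5,6)]) simp
  moreover have "face m n 0 f (tens A (x # as')) = f (tens A (x * y # as''))"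
    using face_value[OF f, of 0 "x # as'" "d # ds'"] 1 2 by simp
  moreover have "last as * hd as # butlast (tl as) = x * y # as''" "last_sign_exp ds = d * sum_list ds'"
    by (simp_all add: 1(1,2) 2 last_sign_exp_def)
  ultimately show "cyc.b m n f (tens A as)
      = (\<Sum>i<Suc n. (-1) ^ i * f (tens A (take i as @ [as ! i * as ! Suc i] @ drop (i + 2) as)))
        + (-1) ^ (Suc n + last_sign_exp ds) * f (tens A (last as * hd as # butlast (tl as)))"
    by (simp only: lessThan_Suc_atMost)
qed

lemma op_B_eq: "op_B A (Suc n) m f = cyc.B m n f"
  by (simp add: op_B_def cyc.B_def cyc.N_def op_N_def fun_eq_iff sum_fun_apply fun_diff_def)

lemma op_B_0: "op_B A 0 m f = 0"
  by (simp add: op_B_def zero_fun_def)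

lemma b_closed: "f \<in> C n m \<Longrightarrow> op_b A n m f \<in> C (Suc n) m"
  by (simp add: op_b_eq cyc.b_closed)

lemma B_closed: "f \<in> C (Suc n) m \<Longrightarrow> op_B A (Suc n) m f \<in> C n m"
  by (simp add: op_B_eq cyc.B_closed)

lemma c_scale: "f \<in> C n m \<Longrightarrow> cyc.c m n i (\<lambda>x. k * f x) = (\<lambda>x. k * cyc.c m n i f x)"
  by (simp add: cyc.c_def face_linear(2) tau_linear(2) face_closed)

lemma b_linear:
  assumes f: "f \<in> C n m"
  shows "g \<in> C n m \<Longrightarrow> op_b A n m (f + g) = op_b A n m f + op_b A n m g"
    and "op_b A n m (\<lambda>x. k * f x) = (\<lambda>x. k * op_b A n m f x)"
proof -
  show "g \<in> C n m \<Longrightarrow> op_b A n m (f + g) = op_b A n m f + op_b A n m g"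
    using f by (simp only: op_b_eq cochains_closed(2) cyc.b_add)
  show "op_b A n m (\<lambda>x. k * f x) = (\<lambda>x. k * op_b A n m f x)"
    by (rule ext) (simp only: op_b_eq[OF f] op_b_eq[OF cochains_closed(4)[OF f]] cyc.b_def c_scale[OF f]
      sum_fun_apply sum_distrib_left)
qed

lemma tau_power_scale:
  "f \<in> C n m \<Longrightarrow> (op_tau A n m ^^ i) (\<lambda>x. k * f x) = (\<lambda>x. k * (op_tau A n m ^^ i) f x)"
  by (induction i) (simp_all add: tau_linear(2) tau_power_closed)

lemma B_linear:
  assumes f: "f \<in> C (Suc n) m"
  shows "g \<in> C (Suc n) m \<Longrightarrow> op_B A (Suc n) m (f + g) = op_B A (Suc n) m f + op_B A (Suc n) m g"
    and "op_B A (Suc n) m (\<lambda>x. k * f x) = (\<lambda>x. k * op_B A (Suc n) m f x)"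
proof -
  show "g \<in> C (Suc n) m \<Longrightarrow> op_B A (Suc n) m (f + g) = op_B A (Suc n) m f + op_B A (Suc n) m g"
    using f by (simp only: op_B_eq cyc.B_add)
  have d: "f - op_tau A (Suc n) m f \<in> C (Suc n) m" by (intro cyc.C_diff tau_closed f)
  have "(\<lambda>x. k * f x) - op_tau A (Suc n) m (\<lambda>x. k * f x) = (\<lambda>x. k * (f - op_tau A (Suc n) m f) x)"
    unfolding tau_linear(2)[OF f] by (rule ext) (simp add: right_diff_distrib)
  then show "op_B A (Suc n) m (\<lambda>x. k * f x) = (\<lambda>x. k * op_B A (Suc n) m f x)"
    unfolding op_B_eq cyc.B_def cyc.N_def
    by (intro ext) (simp only: s_linear(2)[OF d] tau_power_scale[OF s_closed[OF d]] sum_fun_apply sum_distrib_left)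
qed

lemma b_b: "f \<in> C n m \<Longrightarrow> op_b A (Suc n) m (op_b A n m f) = 0"
  by (simp only: op_b_eq cyc.b_closed cyc.b_b)

lemma B_B: "f \<in> C (Suc (Suc n)) m \<Longrightarrow> op_B A (Suc n) m (op_B A (Suc (Suc n)) m f) = 0"
  by (simp only: op_B_eq cyc.B_B)

lemma b_B: "f \<in> C (Suc n) m \<Longrightarrow>
    op_b A n m (op_B A (Suc n) m f) + op_B A (Suc (Suc n)) m (op_b A (Suc n) m f) = 0"
  by (simp only: op_b_eq op_B_eq cyc.B_closed cyc.b_B)

lemma B_b_0: "f \<in> C 0 m \<Longrightarrow> op_B A (Suc 0) m (op_b A 0 m f) = 0"
  by (simp only: op_b_eq op_B_eq cyc.B_b_0)

lemma delta_b: "f \<in> C n m \<Longrightarrow> op_delta A (Suc n) m (op_b A n m f) = op_b A n (Suc m) (op_delta A n m f)"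
  by (simp only: op_b_eq delta_closed cyclic_morphism.h_b[OF delta_morphism])

lemma delta_B: "f \<in> C (Suc n) m \<Longrightarrow>
    op_delta A n m (op_B A (Suc n) m f) = op_B A (Suc n) (Suc m) (op_delta A (Suc n) m f)"
  by (simp only: op_B_eq cyclic_morphism.h_B[OF delta_morphism])

end

section \<open>The total complex and its filtration\<close>

interpretation tuples: vector_space_char_0 "\<lambda>(c::'k::field_char_0) (x :: 'i \<Rightarrow> 't \<Rightarrow> 'k) i t. c * x i t"
  by unfold_locales (simp_all add: fun_eq_iff distrib_left distrib_right mult.assoc)

declare tuples.scale_scale [simp del]

lemma direct_sum_is_vector_space:
  fixes V :: "'i \<Rightarrow> ('k::field_char_0, 'v) module"
  assumes V: "\<And>i. i \<in> I \<Longrightarrow> is_vector_space (V i)"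
  shows "is_vector_space (direct_sum I V)"
proof -
  let ?S = "direct_sum I V"
  have carrier_iff: "x \<in> carrier ?S \<longleftrightarrow> (\<forall>i\<in>I. x i \<in> carrier (V i)) \<and> x \<in> extensional I \<and>
      finite {i \<in> I. x i \<noteq> \<zero>\<^bsub>V i\<^esub>}" for x
    by (auto simp: direct_sum_def PiE_iff)
  have ops: "x \<oplus>\<^bsub>?S\<^esub> y = (\<lambda>i\<in>I. x i \<oplus>\<^bsub>V i\<^esub> y i)" "\<zero>\<^bsub>?S\<^esub> = (\<lambda>i\<in>I. \<zero>\<^bsub>V i\<^esub>)"
    "c \<odot>\<^bsub>?S\<^esub> x = (\<lambda>i\<in>I. c \<odot>\<^bsub>V i\<^esub> x i)" for x y c
    by (simp_all add: direct_sum_def)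
  have am: "abelian_monoid (V i)" if "i \<in> I" for i
    using vector_space_simps(1)[OF V[OF that]] by (rule abelian_group.axioms(1))
  note laws = vector_space_simps(2-11)[OF V] abelian_monoid.l_zero[OF am] abelian_monoid.a_assoc[OF am]
  show ?thesis
  proof (rule is_vector_spaceI)
    fix x assume x: "x \<in> carrier ?S"
    note xD = x[unfolded carrier_iff]
    show "\<zero>\<^bsub>?S\<^esub> \<oplus>\<^bsub>?S\<^esub> x = x"
      by (rule extensionalityI[of _ I]) (use xD in \<open>auto simp: ops laws\<close>)
    show "0 \<odot>\<^bsub>?S\<^esub> x = \<zero>\<^bsub>?S\<^esub>"
      by (rule extensionalityI[of _ I]) (use xD in \<open>auto simp: ops laws\<close>)
    show "1 \<odot>\<^bsub>?S\<^esub> x = x"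
      by (rule extensionalityI[of _ I]) (use xD in \<open>auto simp: ops laws\<close>)
    fix c d :: 'k
    show "(c + d) \<odot>\<^bsub>?S\<^esub> x = c \<odot>\<^bsub>?S\<^esub> x \<oplus>\<^bsub>?S\<^esub> d \<odot>\<^bsub>?S\<^esub> x"
      by (rule extensionalityI[of _ I]) (use xD in \<open>auto simp: ops laws\<close>)
    show "(c * d) \<odot>\<^bsub>?S\<^esub> x = c \<odot>\<^bsub>?S\<^esub> (d \<odot>\<^bsub>?S\<^esub> x)"
      by (rule extensionalityI[of _ I]) (use xD in \<open>auto simp: ops laws\<close>)
    have "{i \<in> I. c \<odot>\<^bsub>V i\<^esub> x i \<noteq> \<zero>\<^bsub>V i\<^esub>} \<subseteq> {i \<in> I. x i \<noteq> \<zero>\<^bsub>V i\<^esub>}" by (auto simp: laws)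
    then have "finite {i \<in> I. c \<odot>\<^bsub>V i\<^esub> x i \<noteq> \<zero>\<^bsub>V i\<^esub>}" using xD finite_subset by blast
    then show "c \<odot>\<^bsub>?S\<^esub> x \<in> carrier ?S"
      using xD unfolding carrier_iff ops by (auto simp: laws cong: conj_cong)
    fix y assume y: "y \<in> carrier ?S"
    note yD = y[unfolded carrier_iff]
    show "x \<oplus>\<^bsub>?S\<^esub> y = y \<oplus>\<^bsub>?S\<^esub> x"
      by (rule extensionalityI[of _ I]) (use xD yD abelian_monoid.a_comm[OF am] in \<open>auto simp: ops\<close>)
    show "c \<odot>\<^bsub>?S\<^esub> (x \<oplus>\<^bsub>?S\<^esub> y) = c \<odot>\<^bsub>?S\<^esub> x \<oplus>\<^bsub>?S\<^esub> c \<odot>\<^bsub>?S\<^esub> y"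
      by (rule extensionalityI[of _ I]) (use xD yD in \<open>auto simp: ops laws\<close>)
    have "{i \<in> I. x i \<oplus>\<^bsub>V i\<^esub> y i \<noteq> \<zero>\<^bsub>V i\<^esub>} \<subseteq> {i \<in> I. x i \<noteq> \<zero>\<^bsub>V i\<^esub>} \<union> {i \<in> I. y i \<noteq> \<zero>\<^bsub>V i\<^esub>}"
      by (auto simp: laws)
    then have "finite {i \<in> I. x i \<oplus>\<^bsub>V i\<^esub> y i \<noteq> \<zero>\<^bsub>V i\<^esub>}"
      using xD yD by (meson finite_Un finite_subset)
    then show "x \<oplus>\<^bsub>?S\<^esub> y \<in> carrier ?S"
      using xD yD unfolding carrier_iff ops by (auto simp: laws cong: conj_cong)
    fix z assume z: "z \<in> carrier ?S"
    note zD = z[unfolded carrier_iff]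
    show "x \<oplus>\<^bsub>?S\<^esub> y \<oplus>\<^bsub>?S\<^esub> z = x \<oplus>\<^bsub>?S\<^esub> (y \<oplus>\<^bsub>?S\<^esub> z)"
      by (rule extensionalityI[of _ I]) (use xD yD zD in \<open>auto simp: ops laws\<close>)
  next
    have "{i \<in> I. (\<lambda>i\<in>I. \<zero>\<^bsub>V i\<^esub>) i \<noteq> \<zero>\<^bsub>V i\<^esub>} = {}" by auto
    then show "\<zero>\<^bsub>?S\<^esub> \<in> carrier ?S" unfolding carrier_iff ops by (auto simp: laws)
  qed
qed

lemma function_space_simps [simp]:
  "carrier (function_space S) = S" "\<zero>\<^bsub>function_space S\<^esub> = 0"
  "x \<oplus>\<^bsub>function_space S\<^esub> y = x + y" "c \<odot>\<^bsub>function_space S\<^esub> x = (\<lambda>t. c * x t)"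
  by (simp_all add: function_space_def zero_fun_def plus_fun_def)

lemma function_space_is_vector_space:
  assumes "0 \<in> S" "\<And>x y. x \<in> S \<Longrightarrow> y \<in> S \<Longrightarrow> x + y \<in> S" "\<And>c x. x \<in> S \<Longrightarrow> (\<lambda>t. c * x t) \<in> S"
  shows "is_vector_space (function_space S)"
  by (rule is_vector_spaceI) (use assms in \<open>simp_all add: fun_eq_iff distrib_left distrib_right mult.assoc add.assoc add.commute\<close>)

lemma minus_one_powi_Suc: "(-1) powi (k + 1) = - ((-1) powi k :: 'k::field)"
  by (simp add: power_int_add_1)

lemma minus_one_powi_pred: "(-1) powi (k - 1) = - ((-1) powi k :: 'k::field)"
  using minus_one_powi_Suc[of "k - 1", where 'k = 'k] by (simp only: diff_add_cancel minus_minus)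

context dga
begin

abbreviation "E p q r \<equiv> carrier (EC A p q r)"
abbreviation scaled :: "'k \<Rightarrow> ('a, 'k) cochain \<Rightarrow> ('a, 'k) cochain" where
  "scaled c f \<equiv> (\<lambda>t. c * f t)"
abbreviation "bE \<equiv> EC_map (op_b A)"
abbreviation "BE \<equiv> EC_map (op_B A)"
abbreviation "dE \<equiv> EC_map (op_delta A)"

text \<open>The integer positions of the tricomplex are reduced to natural indices in one place; elsewhere the
  maps are used with integer indices, and vanish outside the tricomplex.\<close>

lemma E_cases:
  obtains (valid) n m where "0 \<le> p" "q = p + int n" "r = int m" "E p q r = C n m"
  | (invalid) "\<not> (0 \<le> p \<and> p \<le> q \<and> 0 \<le> r)" "E p q r = {0}"
proof (cases "0 \<le> p \<and> p \<le> q \<and> 0 \<le> r")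
  case True
  then show ?thesis using valid[of "nat (q - p)" "nat r"] by (simp add: EC_def)
next
  case False
  then show ?thesis using invalid by (auto simp: EC_def zero_fun_def)
qed

lemma EC_eq: "EC A p q r = function_space (E p q r)"
  by (simp add: EC_def cochains_def dual_space_def)

lemma EC_simps [simp]:
  "\<zero>\<^bsub>EC A p q r\<^esub> = 0" "x \<oplus>\<^bsub>EC A p q r\<^esub> y = x + y" "c \<odot>\<^bsub>EC A p q r\<^esub> x = scaled c x"
  by (subst EC_eq, simp)+

lemma E_closed:
  "0 \<in> E p q r" "f \<in> E p q r \<Longrightarrow> g \<in> E p q r \<Longrightarrow> f + g \<in> E p q r" "f \<in> E p q r \<Longrightarrow> - f \<in> E p q r"
  "f \<in> E p q r \<Longrightarrow> scaled c f \<in> E p q r"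
  by (cases rule: E_cases[of p q r]; force simp: cochains_closed)+

lemma E_zero: "f \<in> E p q r \<Longrightarrow> \<not> (0 \<le> p \<and> p \<le> q \<and> 0 \<le> r) \<Longrightarrow> f = 0"
  by (cases rule: E_cases[of p q r]) auto

lemma EC_is_vector_space: "is_vector_space (EC A p q r)"
  by (subst EC_eq, rule function_space_is_vector_space) (auto intro: E_closed)

lemma EC_map_invalid: "\<not> (0 \<le> p \<and> p \<le> q \<and> 0 \<le> r) \<Longrightarrow> EC_map h p q r f = 0"
  by (auto simp: EC_map_def zero_fun_def)

lemma EC_map_eq: "0 \<le> p \<Longrightarrow> q = p + int n \<Longrightarrow> r = int m \<Longrightarrow> EC_map h p q r = h n m"
  by (auto simp: EC_map_def fun_eq_iff)

lemma E_eq: "0 \<le> p \<Longrightarrow> q = p + int n \<Longrightarrow> r = int m \<Longrightarrow> E p q r = C n m"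
  by (simp add: EC_def)

lemma bE_closed: "f \<in> E p q r \<Longrightarrow> bE p q r f \<in> E p (q + 1) r"
proof (cases rule: E_cases[of p q r])
  case (valid n m)
  assume "f \<in> E p q r"
  moreover have "E p (q + 1) r = C (Suc n) m" by (rule E_eq) (use valid in simp_all)
  ultimately show ?thesis using b_closed[of f n m] valid(4) by (simp add: EC_map_eq[OF valid(1-3)])
qed (simp add: EC_map_invalid E_closed)

lemma BE_closed: "f \<in> E p q r \<Longrightarrow> BE p q r f \<in> E (p + 1) q r"
proof (cases rule: E_cases[of p q r])
  case (valid n m)
  assume f: "f \<in> E p q r"
  show ?thesis
  proof (cases n)
    case 0
    then have "BE p q r f = 0" unfolding EC_map_eq[OF valid(1-3)] by (simp only: op_B_0)
    then show ?thesis using E_closed(1) by (simp only:)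
  next
    case (Suc k)
    have "E (p + 1) q r = C k m" by (rule E_eq) (use valid Suc in simp_all)
    then show ?thesis using B_closed[of f k m] f valid(4) Suc by (simp add: EC_map_eq[OF valid(1-3)])
  qed
qed (simp add: EC_map_invalid E_closed)

lemma dE_closed: "f \<in> E p q r \<Longrightarrow> dE p q r f \<in> E p q (r + 1)"
proof (cases rule: E_cases[of p q r])
  case (valid n m)
  assume f: "f \<in> E p q r"
  have "E p q (r + 1) = C n (Suc m)" by (rule E_eq) (use valid in simp_all)
  then show ?thesis using delta_closed[of f n m] f valid(4) by (simp add: EC_map_eq[OF valid(1-3)])
qed (simp add: EC_map_invalid E_closed)

lemma EC_map_linear:
  assumes "\<And>n m f g. f \<in> C n m \<Longrightarrow> g \<in> C n m \<Longrightarrow> h n m (f + g) = h n m f + h n m g"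
    and "\<And>n m f c. f \<in> C n m \<Longrightarrow> h n m (scaled c f) = scaled c (h n m f)" and f: "f \<in> E p q r"
  shows "g \<in> E p q r \<Longrightarrow> EC_map h p q r (f + g) = EC_map h p q r f + EC_map h p q r g"
    and "EC_map h p q r (scaled c f) = scaled c (EC_map h p q r f)"
  using f
  by (cases rule: E_cases[of p q r]; simp add: EC_map_invalid EC_map_eq assms; simp add: fun_eq_iff)+

lemma op_B_linear:
  assumes f: "f \<in> C n m"
  shows "g \<in> C n m \<Longrightarrow> op_B A n m (f + g) = op_B A n m f + op_B A n m g"
    and "op_B A n m (scaled c f) = scaled c (op_B A n m f)"
  using f by (cases n; simp add: op_B_0 B_linear; simp add: fun_eq_iff)+

lemma bE_linear:
  assumes "f \<in> E p q r"
  shows "g \<in> E p q r \<Longrightarrow> bE p q r (f + g) = bE p q r f + bE p q r g"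
    and "bE p q r (scaled c f) = scaled c (bE p q r f)"
  by (rule EC_map_linear[OF _ _ assms]; simp only: b_linear)+

lemma BE_linear:
  assumes "f \<in> E p q r"
  shows "g \<in> E p q r \<Longrightarrow> BE p q r (f + g) = BE p q r f + BE p q r g"
    and "BE p q r (scaled c f) = scaled c (BE p q r f)"
  by (rule EC_map_linear[OF _ _ assms]; simp only: op_B_linear)+

lemma dE_linear:
  assumes "f \<in> E p q r"
  shows "g \<in> E p q r \<Longrightarrow> dE p q r (f + g) = dE p q r f + dE p q r g"
    and "dE p q r (scaled c f) = scaled c (dE p q r f)"
  by (rule EC_map_linear[OF _ _ assms]; simp only: delta_linear)+

lemma E_map_zero:
  "bE p q r 0 = 0" "BE p q r 0 = 0" "dE p q r 0 = 0"
proof -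
  have z: "scaled 0 (0 :: ('a, 'k) cochain) = 0" "scaled 0 f = 0" for f :: "('a, 'k) cochain"
    by (simp_all add: fun_eq_iff)
  show "bE p q r 0 = 0" "BE p q r 0 = 0" "dE p q r 0 = 0"
    using bE_linear(2)[OF E_closed(1), of p q r 0] BE_linear(2)[OF E_closed(1), of p q r 0]
      dE_linear(2)[OF E_closed(1), of p q r 0] unfolding z by auto
qed

lemma bE_bE: "f \<in> E p q r \<Longrightarrow> bE p (q + 1) r (bE p q r f) = 0"
proof (cases rule: E_cases[of p q r])
  case (valid n m)
  have "bE p (q + 1) r = op_b A (Suc n) m" by (rule EC_map_eq) (use valid in simp_all)
  moreover assume "f \<in> E p q r"
  ultimately show ?thesis using b_b[of f n m] valid(4) by (simp add: EC_map_eq[OF valid(1-3)])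
qed (simp add: EC_map_invalid E_map_zero)

lemma BE_BE: "f \<in> E p q r \<Longrightarrow> BE (p + 1) q r (BE p q r f) = 0"
proof (cases rule: E_cases[of p q r])
  case (valid n m)
  assume f: "f \<in> E p q r"
  consider "n = 0" | "n = 1" | k where "n = Suc (Suc k)" by (metis One_nat_def not0_implies_Suc)
  then show ?thesis
  proof cases
    case 1
    then have "BE p q r f = 0" unfolding EC_map_eq[OF valid(1-3)] by (simp only: op_B_0)
    then show ?thesis by (simp only: E_map_zero)
  next
    case 2
    have "BE (p + 1) q r = op_B A 0 m" by (rule EC_map_eq) (use valid 2 in simp_all)
    then show ?thesis by (simp add: op_B_0)
  next
    case 3
    have "BE (p + 1) q r = op_B A (Suc k) m" by (rule EC_map_eq) (use valid 3 in simp_all)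
    then show ?thesis using B_B[of f k m] f valid(4) 3 by (simp add: EC_map_eq[OF valid(1-3)])
  qed
qed (simp add: EC_map_invalid E_map_zero)

lemma bE_BE: "f \<in> E p q r \<Longrightarrow> bE (p + 1) q r (BE p q r f) + BE p (q + 1) r (bE p q r f) = 0"
proof (cases rule: E_cases[of p q r])
  case (valid n m)
  assume f: "f \<in> E p q r"
  have Bv: "BE p (q + 1) r = op_B A (Suc n) m" by (rule EC_map_eq) (use valid in simp_all)
  note v = EC_map_eq[OF valid(1-3)] Bv
  show ?thesis
  proof (cases n)
    case 0
    then have "bE (p + 1) q r (BE p q r f) = 0"
      using valid by (intro EC_map_invalid) simp
    then show ?thesis using B_b_0[of f m] f valid(4) 0 by (simp add: v)
  next
    case (Suc k)
    have "bE (p + 1) q r = op_b A k m" by (rule EC_map_eq) (use valid Suc in simp_all)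
    then show ?thesis using b_B[of f k m] f valid(4) Suc by (simp add: v)
  qed
qed (simp add: EC_map_invalid E_map_zero)

lemma dE_bE: "f \<in> E p q r \<Longrightarrow> dE p (q + 1) r (bE p q r f) = bE p q (r + 1) (dE p q r f)"
proof (cases rule: E_cases[of p q r])
  case (valid n m)
  have "dE p (q + 1) r = op_delta A (Suc n) m" "bE p q (r + 1) = op_b A n (Suc m)"
    by (rule EC_map_eq; use valid in simp)+
  moreover assume "f \<in> E p q r"
  ultimately show ?thesis using delta_b[of f n m] valid(4) by (simp add: EC_map_eq[OF valid(1-3)])
qed (simp add: EC_map_invalid E_map_zero)

lemma dE_BE: "f \<in> E p q r \<Longrightarrow> dE (p + 1) q r (BE p q r f) = BE p q (r + 1) (dE p q r f)"
proof (cases rule: E_cases[of p q r])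
  case (valid n m)
  assume f: "f \<in> E p q r"
  have Bv: "BE p q (r + 1) = op_B A n (Suc m)" by (rule EC_map_eq) (use valid in simp_all)
  note v = EC_map_eq[OF valid(1-3)] Bv
  show ?thesis
  proof (cases n)
    case 0
    then have "BE p q r f = 0" "BE p q (r + 1) (dE p q r f) = 0" unfolding v by (simp_all only: op_B_0)
    then show ?thesis by (simp only: E_map_zero)
  next
    case (Suc k)
    have "dE (p + 1) q r = op_delta A k m" by (rule EC_map_eq) (use valid Suc in simp_all)
    then show ?thesis using delta_B[of f k m] f valid(4) Suc by (simp add: v)
  qed
qed (simp add: EC_map_invalid E_map_zero)

lemma dE_dE: "f \<in> E p q r \<Longrightarrow> dE p q (r + 1) (dE p q r f) = 0"
proof (cases rule: E_cases[of p q r])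
  case (valid n m)
  have "dE p q (r + 1) = op_delta A n (Suc m)" by (rule EC_map_eq) (use valid in simp_all)
  moreover assume "f \<in> E p q r"
  ultimately show ?thesis using delta_delta[of f n m] valid(4) by (simp add: EC_map_eq[OF valid(1-3)])
qed (simp add: EC_map_invalid E_map_zero)

text \<open>A model of the total complex inside one type: its elements are extended by \<open>0\<close> to all positions.
  Finite support is automatic, as only finitely many positions of a given total degree carry nonzero
  spaces.\<close>

definition TC :: "int \<Rightarrow> (int \<times> int \<times> int \<Rightarrow> ('a, 'k) cochain) set" where
  "TC n = {x. \<forall>p q r. x (p, q, r) \<in> E p q r \<and> (p + q + r \<noteq> n \<longrightarrow> x (p, q, r) = 0)}"

definition sgn_delta :: "int \<Rightarrow> int \<Rightarrow> int \<Rightarrow> ('a, 'k) cochain \<Rightarrow> ('a, 'k) cochain" where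
  "sgn_delta p q r f = scaled ((-1) powi (q - p)) (dE p q r f)"

definition D :: "(int \<times> int \<times> int \<Rightarrow> ('a, 'k) cochain) \<Rightarrow> (int \<times> int \<times> int \<Rightarrow> ('a, 'k) cochain)" where
  "D x = (\<lambda>(p, q, r). bE p (q - 1) r (x (p, q - 1, r)) + BE (p - 1) q r (x (p - 1, q, r))
     + sgn_delta p q (r - 1) (x (p, q, r - 1)))"

lemma TCD: "x \<in> TC n \<Longrightarrow> x (p, q, r) \<in> E p q r" "x \<in> TC n \<Longrightarrow> p + q + r \<noteq> n \<Longrightarrow> x (p, q, r) = 0"
  by (auto simp: TC_def)

lemma sgn_delta_zero: "sgn_delta p q r 0 = 0"
  by (simp add: sgn_delta_def E_map_zero fun_eq_iff)

lemma sgn_delta_closed: "f \<in> E p q r \<Longrightarrow> sgn_delta p q r f \<in> E p q (r + 1)"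
  unfolding sgn_delta_def by (intro E_closed(4) dE_closed)

lemma sgn_delta_linear:
  "f \<in> E p q r \<Longrightarrow> g \<in> E p q r \<Longrightarrow> sgn_delta p q r (f + g) = sgn_delta p q r f + sgn_delta p q r g"
  "f \<in> E p q r \<Longrightarrow> sgn_delta p q r (scaled c f) = scaled c (sgn_delta p q r f)"
  by (simp add: sgn_delta_def dE_linear(1) distrib_left fun_eq_iff)
     (simp only: sgn_delta_def dE_linear(2) mult.left_commute)

lemma bE_sgn_delta:
  assumes f: "f \<in> E p q r"
  shows "sgn_delta p (q + 1) r (bE p q r f) + bE p q (r + 1) (sgn_delta p q r f) = 0"
proof -
  have "q + 1 - p = (q - p) + 1" by simp
  then show ?thesis
    unfolding sgn_delta_def bE_linear(2)[OF dE_closed[OF f]] dE_bE[OF f]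
    by (simp only: minus_one_powi_Suc) (simp add: fun_eq_iff)
qed

lemma BE_sgn_delta:
  assumes f: "f \<in> E p q r"
  shows "sgn_delta (p + 1) q r (BE p q r f) + BE p q (r + 1) (sgn_delta p q r f) = 0"
proof -
  have "q - (p + 1) = (q - p) - 1" by simp
  then show ?thesis
    unfolding sgn_delta_def BE_linear(2)[OF dE_closed[OF f]] dE_BE[OF f]
    by (simp only: minus_one_powi_pred) (simp add: fun_eq_iff)
qed

lemma sgn_delta_sgn_delta:
  assumes f: "f \<in> E p q r" shows "sgn_delta p q (r + 1) (sgn_delta p q r f) = 0"
  unfolding sgn_delta_def dE_linear(2)[OF dE_closed[OF f]] dE_dE[OF f] by (simp add: fun_eq_iff)

lemma TC_subspace: "tuples.subspace (TC n)"
  by (rule tuples.subspaceI) (auto simp: TC_def E_closed fun_eq_iff)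

lemma D_closed:
  assumes x: "x \<in> TC n" shows "D x \<in> TC (n + 1)"
proof -
  have "D x (p, q, r) \<in> E p q r" for p q r
    using bE_closed[OF TCD(1)[OF x], of p "q - 1" r] BE_closed[OF TCD(1)[OF x], of "p - 1" q r]
      sgn_delta_closed[OF TCD(1)[OF x], of p q "r - 1"]
    by (simp add: D_def E_closed(2))
  moreover have "D x (p, q, r) = 0" if "p + q + r \<noteq> n + 1" for p q r
    using that TCD(2)[OF x, of p "q - 1" r] TCD(2)[OF x, of "p - 1" q r] TCD(2)[OF x, of p q "r - 1"]
    by (simp add: D_def E_map_zero sgn_delta_zero)
  ultimately show ?thesis by (simp add: TC_def)
qed

lemma D_linear:
  assumes x: "x \<in> TC n"
  shows "y \<in> TC n \<Longrightarrow> D (x + y) = D x + D y" and "D (\<lambda>i. scaled c (x i)) = (\<lambda>i. scaled c (D x i))"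
proof -
  show "D (x + y) = D x + D y" if y: "y \<in> TC n"
    by (rule ext, clarify)
       (simp add: D_def bE_linear(1)[OF TCD(1)[OF x] TCD(1)[OF y]] BE_linear(1)[OF TCD(1)[OF x] TCD(1)[OF y]]
          sgn_delta_linear(1)[OF TCD(1)[OF x] TCD(1)[OF y]])
  show "D (\<lambda>i. scaled c (x i)) = (\<lambda>i. scaled c (D x i))"
    by (rule ext, clarify)
       (simp add: D_def bE_linear(2)[OF TCD(1)[OF x]] BE_linear(2)[OF TCD(1)[OF x]]
          sgn_delta_linear(2)[OF TCD(1)[OF x]] distrib_left fun_eq_iff)
qed

lemma D_D: assumes x: "x \<in> TC n" shows "D (D x) = 0"
proof (rule ext, clarify)
  fix p q r
  have E1: "bE p (q - 1 - 1) r (x (p, q - 1 - 1, r)) \<in> E p (q - 1) r"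
    "BE (p - 1) (q - 1) r (x (p - 1, q - 1, r)) \<in> E p (q - 1) r"
    "sgn_delta p (q - 1) (r - 1) (x (p, q - 1, r - 1)) \<in> E p (q - 1) r"
    using bE_closed[OF TCD(1)[OF x], of p "q - 1 - 1" r] BE_closed[OF TCD(1)[OF x], of "p - 1" "q - 1" r]
      sgn_delta_closed[OF TCD(1)[OF x], of p "q - 1" "r - 1"] by simp_all
  have E2: "bE (p - 1) (q - 1) r (x (p - 1, q - 1, r)) \<in> E (p - 1) q r"
    "BE (p - 1 - 1) q r (x (p - 1 - 1, q, r)) \<in> E (p - 1) q r"
    "sgn_delta (p - 1) q (r - 1) (x (p - 1, q, r - 1)) \<in> E (p - 1) q r"
    using bE_closed[OF TCD(1)[OF x], of "p - 1" "q - 1" r] BE_closed[OF TCD(1)[OF x], of "p - 1 - 1" q r]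
      sgn_delta_closed[OF TCD(1)[OF x], of "p - 1" q "r - 1"] by simp_all
  have E3: "bE p (q - 1) (r - 1) (x (p, q - 1, r - 1)) \<in> E p q (r - 1)"
    "BE (p - 1) q (r - 1) (x (p - 1, q, r - 1)) \<in> E p q (r - 1)"
    "sgn_delta p q (r - 1 - 1) (x (p, q, r - 1 - 1)) \<in> E p q (r - 1)"
    using bE_closed[OF TCD(1)[OF x], of p "q - 1" "r - 1"] BE_closed[OF TCD(1)[OF x], of "p - 1" q "r - 1"]
      sgn_delta_closed[OF TCD(1)[OF x], of p q "r - 1 - 1"] by simp_all
  have zero: "bE p (q - 1) r (bE p (q - 1 - 1) r (x (p, q - 1 - 1, r))) = 0"
    "BE (p - 1) q r (BE (p - 1 - 1) q r (x (p - 1 - 1, q, r))) = 0"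
    "sgn_delta p q (r - 1) (sgn_delta p q (r - 1 - 1) (x (p, q, r - 1 - 1))) = 0"
    using bE_bE[OF TCD(1)[OF x], of p "q - 1 - 1" r] BE_BE[OF TCD(1)[OF x], of "p - 1 - 1" q r]
      sgn_delta_sgn_delta[OF TCD(1)[OF x], of p q "r - 1 - 1"] by simp_all
  have "bE p (q - 1) r (D x (p, q - 1, r)) = bE p (q - 1) r (BE (p - 1) (q - 1) r (x (p - 1, q - 1, r)))
      + bE p (q - 1) r (sgn_delta p (q - 1) (r - 1) (x (p, q - 1, r - 1)))"
    by (simp only: D_def prod.case zero add_0_left bE_linear(1)[OF E_closed(2)[OF E1(1,2)] E1(3)] bE_linear(1)[OF E1(1,2)])
  moreover have "BE (p - 1) q r (D x (p - 1, q, r)) = BE (p - 1) q r (bE (p - 1) (q - 1) r (x (p - 1, q - 1, r)))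
      + BE (p - 1) q r (sgn_delta (p - 1) q (r - 1) (x (p - 1, q, r - 1)))"
    by (simp only: D_def prod.case zero add_0_right BE_linear(1)[OF E_closed(2)[OF E2(1,2)] E2(3)] BE_linear(1)[OF E2(1,2)])
  moreover have "sgn_delta p q (r - 1) (D x (p, q, r - 1)) = sgn_delta p q (r - 1) (bE p (q - 1) (r - 1) (x (p, q - 1, r - 1)))
      + sgn_delta p q (r - 1) (BE (p - 1) q (r - 1) (x (p - 1, q, r - 1)))"
    by (simp only: D_def prod.case zero add_0_right sgn_delta_linear(1)[OF E_closed(2)[OF E3(1,2)] E3(3)] sgn_delta_linear(1)[OF E3(1,2)])
  moreover have "bE p (q - 1) r (BE (p - 1) (q - 1) r (x (p - 1, q - 1, r)))
      + BE (p - 1) q r (bE (p - 1) (q - 1) r (x (p - 1, q - 1, r))) = 0"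
    using bE_BE[OF TCD(1)[OF x], of "p - 1" "q - 1" r] by simp
  moreover have "sgn_delta p q (r - 1) (bE p (q - 1) (r - 1) (x (p, q - 1, r - 1)))
      + bE p (q - 1) r (sgn_delta p (q - 1) (r - 1) (x (p, q - 1, r - 1))) = 0"
    using bE_sgn_delta[OF TCD(1)[OF x], of p "q - 1" "r - 1"] by simp
  moreover have "sgn_delta p q (r - 1) (BE (p - 1) q (r - 1) (x (p - 1, q, r - 1)))
      + BE (p - 1) q r (sgn_delta (p - 1) q (r - 1) (x (p - 1, q, r - 1))) = 0"
    using BE_sgn_delta[OF TCD(1)[OF x], of "p - 1" q "r - 1"] by simp
  moreover have "D (D x) (p, q, r)
      = bE p (q - 1) r (D x (p, q - 1, r)) + BE (p - 1) q r (D x (p - 1, q, r)) + sgn_delta p q (r - 1) (D x (p, q, r - 1))"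
    by (subst D_def) simp
  ultimately show "D (D x) (p, q, r) = 0 (p, q, r)"
    by (simp add: eq_neg_iff_add_eq_0[symmetric])
qed

text \<open>The filtration by the sum of the first and the third coordinate: \<open>b\<close> preserves this sum, and \<open>B\<close>
  and \<open>\<delta>\<close> raise it by one.\<close>

definition F :: "int \<Rightarrow> int \<Rightarrow> (int \<times> int \<times> int \<Rightarrow> ('a, 'k) cochain) set" where
  "F s n = {x \<in> TC n. \<forall>p q r. p + r < s \<longrightarrow> x (p, q, r) = 0}"

lemma F_subspace: "tuples.subspace (F s n)"
  using TC_subspace[of n]
  by (intro tuples.subspaceI)
     (auto simp: F_def tuples.subspace_0 tuples.subspace_add tuples.subspace_scale fun_eq_iff)

sublocale fil: filtered_complex "\<lambda>(c::'k) x i t. c * x i t" TC D F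
proof
  show "tuples.subspace (TC n)" "tuples.subspace (F s n)" for n s by (rule TC_subspace F_subspace)+
  show "x \<in> TC n \<Longrightarrow> D x \<in> TC (n + 1)" for x n by (rule D_closed)
  show "x \<in> TC n \<Longrightarrow> y \<in> TC n \<Longrightarrow> D (x + y) = D x + D y" for x y n by (rule D_linear)
  show "x \<in> TC n \<Longrightarrow> D (\<lambda>i t. c * x i t) = (\<lambda>i t. c * D x i t)" for x n c by (rule D_linear)
  show "x \<in> TC n \<Longrightarrow> D (D x) = 0" for x n by (rule D_D)
  show "F s n \<subseteq> TC n" "F (s + 1) n \<subseteq> F s n" for s n by (auto simp: F_def)
  show "D x \<in> F s (n + 1)" if "x \<in> F s n" for x s n
  proof -
    have x: "x \<in> TC n" and z: "\<And>p q r. p + r < s \<Longrightarrow> x (p, q, r) = 0" using that by (auto simp: F_def)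
    have "D x (p, q, r) = 0" if "p + r < s" for p q r
      using that z[of p r "q - 1"] z[of "p - 1" r q] z[of p "r - 1" q] by (simp add: D_def E_map_zero sgn_delta_zero)
    then show ?thesis using D_closed[OF x] by (simp add: F_def)
  qed
  show "\<exists>s. F s n = TC n" for n
  proof
    have "x (p, q, r) = 0" if "x \<in> TC n" "p + r < 0" for x p q r
      using E_zero[OF TCD(1)[OF that(1)], of p q r] that(2) by auto
    then show "F 0 n = TC n" by (auto simp: F_def)
  qed
  show "\<exists>s. F s n = {0}" for n
  proof
    have "x = 0" if "x \<in> F (n + 1) n" for x
    proof (rule ext, clarify)
      fix p q r
      have x: "x \<in> TC n" and z: "p + r < n + 1 \<Longrightarrow> x (p, q, r) = 0" using that by (auto simp: F_def)
      show "x (p, q, r) = 0 (p, q, r)"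
      proof (cases "p + q + r = n \<and> 0 \<le> p \<and> p \<le> q")
        case True
        then show ?thesis using z by simp
      next
        case False
        then show ?thesis using TCD(2)[OF x, of p q r] E_zero[OF TCD(1)[OF x], of p q r] by auto
      qed
    qed
    moreover have "0 \<in> F (n + 1) n" by (rule tuples.subspace_0[OF F_subspace])
    ultimately show "F (n + 1) n = {0}" by auto
  qed
qed

section \<open>Cyclic cohomology as the cohomology of the total complex\<close>

abbreviation "tri n \<equiv> {(p, q, r). p + q + r = (n::int)}"

text \<open>The passage from the extension by \<open>0\<close> to the direct sum, whose elements are \<open>undefined\<close> outside
  their index set.\<close>

definition ext :: "int \<Rightarrow> (int \<times> int \<times> int \<Rightarrow> ('a, 'k) cochain) \<Rightarrow> (int \<times> int \<times> int \<Rightarrow> ('a, 'k) cochain)" where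
  "ext n x = restrict x (tri n)"

lemma total_EC_is_vector_space: "is_vector_space (total_EC A n)"
  unfolding total_EC_def by (rule direct_sum_is_vector_space) (auto simp: EC_is_vector_space)

lemma total_EC_carrier: "carrier (total_EC A n) = ext n ` TC n"
proof (intro equalityI subsetI)
  fix y assume "y \<in> carrier (total_EC A n)"
  then have y: "y \<in> (\<Pi>\<^sub>E i\<in>tri n. carrier (case i of (p, q, r) \<Rightarrow> EC A p q r))"
    by (simp add: total_EC_def direct_sum_def)
  define x where "x = (\<lambda>i. if i \<in> tri n then y i else 0)"
  have yE: "y (p, q, r) \<in> E p q r" if "p + q + r = n" for p q r
    using PiE_mem[OF y, of "(p, q, r)"] that by simp
  then have "x \<in> TC n" by (auto simp: TC_def x_def E_closed(1))
  moreover have "ext n x = y"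
    using y by (auto simp: ext_def x_def fun_eq_iff PiE_def extensional_def)
  ultimately show "y \<in> ext n ` TC n" by blast
next
  fix y assume "y \<in> ext n ` TC n"
  then obtain x where x: "x \<in> TC n" "y = ext n x" by blast
  have "finite {i \<in> tri n. y i \<noteq> \<zero>\<^bsub>case i of (p, q, r) \<Rightarrow> EC A p q r\<^esub>}"
  proof (rule finite_subset)
    show "{i \<in> tri n. y i \<noteq> \<zero>\<^bsub>case i of (p, q, r) \<Rightarrow> EC A p q r\<^esub>} \<subseteq> {0..n} \<times> {0..n} \<times> {0..n}"
    proof (rule subsetI)
      fix i assume i: "i \<in> {i \<in> tri n. y i \<noteq> \<zero>\<^bsub>case i of (p, q, r) \<Rightarrow> EC A p q r\<^esub>}"
      obtain p q r where pqr: "i = (p, q, r)" by (cases i)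
      have *: "p + q + r = n" "x (p, q, r) \<noteq> 0" using i x(2) by (auto simp: pqr ext_def)
      then have "0 \<le> p \<and> p \<le> q \<and> 0 \<le> r" using E_zero[OF TCD(1)[OF x(1)], of p q r] by blast
      then show "i \<in> {0..n} \<times> {0..n} \<times> {0..n}" using *(1) by (simp add: pqr)
    qed
  qed simp
  moreover have "y \<in> (\<Pi>\<^sub>E i\<in>tri n. carrier (case i of (p, q, r) \<Rightarrow> EC A p q r))"
    using TCD(1)[OF x(1)] x(2) by (auto simp: ext_def)
  ultimately show "y \<in> carrier (total_EC A n)" by (simp add: total_EC_def direct_sum_def)
qed

lemma ext_eq_iff:
  assumes x: "x \<in> TC n" and y: "y \<in> TC n" shows "ext n x = ext n y \<longleftrightarrow> x = y"
proof
  assume eq: "ext n x = ext n y"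
  have "x i = y i" for i
  proof (cases "i \<in> tri n")
    case True
    then show ?thesis using fun_cong[OF eq, of i] by (simp add: ext_def)
  next
    case False
    obtain p q r where i: "i = (p, q, r)" by (cases i)
    then have "p + q + r \<noteq> n" using False by simp
    then show ?thesis using TCD(2)[OF x, of p q r] TCD(2)[OF y, of p q r] i by simp
  qed
  then show "x = y" by (rule HOL.ext)
qed simp

lemma ext_linear: "ext n \<in> linear_maps (tuples.space_on (TC n)) (total_EC A n)"
  unfolding linear_maps_def
proof (intro CollectI conjI ballI allI)
  fix x y c
  assume "x \<in> carrier (tuples.space_on (TC n))"
  then show "ext n x \<in> carrier (total_EC A n)" by (simp add: total_EC_carrier)
  show "ext n (x \<oplus>\<^bsub>tuples.space_on (TC n)\<^esub> y) = ext n x \<oplus>\<^bsub>total_EC A n\<^esub> ext n y"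
    by (rule HOL.ext) (auto simp: ext_def total_EC_def direct_sum_def)
  show "ext n (c \<odot>\<^bsub>tuples.space_on (TC n)\<^esub> x) = c \<odot>\<^bsub>total_EC A n\<^esub> ext n x"
    by (rule HOL.ext) (auto simp: ext_def total_EC_def direct_sum_def)
qed

lemma total_EC_diff_ext: "total_EC_diff A n (ext n x) = ext (n + 1) (D x)"
  by (rule HOL.ext) (auto simp: total_EC_diff_def ext_def D_def sgn_delta_def)

lemma total_EC_zero: "\<zero>\<^bsub>total_EC A n\<^esub> = ext n 0"
  by (rule HOL.ext) (auto simp: ext_def total_EC_def direct_sum_def)

lemma total_EC_diff_linear: "total_EC_diff A n \<in> linear_maps (total_EC A n) (total_EC A (n + 1))"
  unfolding linear_maps_def
proof (intro CollectI conjI ballI allI)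
  fix y z c assume "y \<in> carrier (total_EC A n)"
  then obtain x where x: "x \<in> TC n" "y = ext n x" by (auto simp: total_EC_carrier)
  then show "total_EC_diff A n y \<in> carrier (total_EC A (n + 1))"
    by (simp add: total_EC_diff_ext total_EC_carrier D_closed)
  note add = linear_mapsD(2)[OF ext_linear] and smult = linear_mapsD(3)[OF ext_linear]
  have e: "c \<odot>\<^bsub>total_EC A n\<^esub> ext n x = ext n (\<lambda>i. scaled c (x i))"
    "c \<odot>\<^bsub>total_EC A (n + 1)\<^esub> ext (n + 1) (D x) = ext (n + 1) (\<lambda>i. scaled c (D x i))"
    using smult[of x n c] smult[of "D x" "n + 1" c] x(1) D_closed[OF x(1)] by simp_all
  show "total_EC_diff A n (c \<odot>\<^bsub>total_EC A n\<^esub> y) = c \<odot>\<^bsub>total_EC A (n + 1)\<^esub> total_EC_diff A n y"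
    unfolding x(2) e total_EC_diff_ext D_linear(2)[OF x(1)] ..
  assume "z \<in> carrier (total_EC A n)"
  then obtain x' where x': "x' \<in> TC n" "z = ext n x'" unfolding total_EC_carrier by blast
  have e': "ext n x \<oplus>\<^bsub>total_EC A n\<^esub> ext n x' = ext n (x + x')"
    "ext (n + 1) (D x) \<oplus>\<^bsub>total_EC A (n + 1)\<^esub> ext (n + 1) (D x') = ext (n + 1) (D x + D x')"
    using add[of x n x'] add[of "D x" "n + 1" "D x'"] x(1) x'(1) D_closed by simp_all
  show "total_EC_diff A n (y \<oplus>\<^bsub>total_EC A n\<^esub> z) = total_EC_diff A n y \<oplus>\<^bsub>total_EC A (n + 1)\<^esub> total_EC_diff A n z"
    unfolding x(2) x'(2) e' total_EC_diff_ext D_linear(1)[OF x(1) x'(1)] ..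
qed

text \<open>This is the form of cyclic cohomology to which the convergence of the spectral sequence applies.\<close>

lemma HC_presentation:
  obtains \<pi> where "is_vector_space (HC A n)"
    "\<pi> \<in> linear_maps (tuples.space_on {x \<in> TC n. D x = 0}) (HC A n)"
    "\<pi> ` {x \<in> TC n. D x = 0} = carrier (HC A n)"
    "\<And>x. x \<in> TC n \<Longrightarrow> D x = 0 \<Longrightarrow> \<pi> x = \<zero>\<^bsub>HC A n\<^esub> \<longleftrightarrow> x \<in> D ` TC (n - 1)"
proof -
  let ?f = "total_EC_diff A (n - 1)" and ?g = "total_EC_diff A n"
  let ?U = "total_EC A (n - 1)" and ?V = "total_EC A n" and ?W = "total_EC A (n + 1)"
  let ?Z = "?V\<lparr>carrier := {x \<in> carrier ?V. ?g x = \<zero>\<^bsub>?W\<^esub>}\<rparr>"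
  let ?B = "?f ` carrier ?U"
  have f: "?f \<in> linear_maps ?U ?V" using total_EC_diff_linear[of "n - 1"] by simp
  have f_ext: "?f (ext (n - 1) x) = ext n (D x)" for x using total_EC_diff_ext[of "n - 1" x] by simp
  have gf: "?g (?f y) = \<zero>\<^bsub>?W\<^esub>" if y: "y \<in> carrier ?U" for y
  proof -
    obtain x where x: "x \<in> TC (n - 1)" "y = ext (n - 1) x" using y unfolding total_EC_carrier by blast
    then show ?thesis using D_D[OF x(1)] by (simp add: f_ext total_EC_diff_ext total_EC_zero)
  qed
  note coh = total_EC_is_vector_space total_EC_is_vector_space total_EC_is_vector_space f total_EC_diff_linear[of n]
  have Z: "is_vector_space ?Z" by (rule cocycles_is_vector_space[OF coh]) (rule gf)
  have B: "is_subspace ?B ?Z" by (rule coboundaries_is_subspace[OF coh]) (rule gf)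
  have HC: "HC A n = quotient_space ?Z ?B"
    unfolding HC_def cohomology_def by (rule cohomology_at_quotient[OF coh]) (rule gf)
  have B_eq: "?B = ext n ` D ` TC (n - 1)"
    unfolding total_EC_carrier image_image f_ext ..
  have ext_Z: "ext n x \<in> carrier ?Z \<longleftrightarrow> D x = 0" if x: "x \<in> TC n" for x
    using ext_eq_iff[OF D_closed[OF x], of 0] tuples.subspace_0[OF TC_subspace, of "n + 1"] x
    by (simp add: total_EC_carrier total_EC_diff_ext total_EC_zero)
  have Z_eq: "carrier ?Z = ext n ` {x \<in> TC n. D x = 0}"
  proof (intro equalityI subsetI)
    fix y assume y: "y \<in> carrier ?Z"
    then obtain x where "x \<in> TC n" "y = ext n x" by (auto simp: total_EC_carrier)
    then show "y \<in> ext n ` {x \<in> TC n. D x = 0}" using ext_Z[of x] y by blast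
  next
    fix y assume "y \<in> ext n ` {x \<in> TC n. D x = 0}"
    then show "y \<in> carrier ?Z" using ext_Z by blast
  qed
  let ?\<pi> = "\<lambda>x. ?B +>\<^bsub>?Z\<^esub> ext n x"
  show ?thesis
  proof (rule that[of ?\<pi>])
    show "is_vector_space (HC A n)" unfolding HC by (rule quotient_is_vector_space[OF Z B])
    have "ext n \<in> linear_maps (tuples.space_on {x \<in> TC n. D x = 0}) ?Z"
      using linear_maps_restrict[OF ext_linear[of n], of "{x \<in> TC n. D x = 0}" "carrier ?Z"] Z_eq by auto
    then show "?\<pi> \<in> linear_maps (tuples.space_on {x \<in> TC n. D x = 0}) (HC A n)"
      unfolding HC by (rule linear_maps_compose[OF _ coset_linear[OF Z B]])
    show "?\<pi> ` {x \<in> TC n. D x = 0} = carrier (HC A n)"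
      unfolding HC quotient_carrier[OF Z B] Z_eq image_image ..
    fix x assume x: "x \<in> TC n" "D x = 0"
    have "?\<pi> x = \<zero>\<^bsub>HC A n\<^esub> \<longleftrightarrow> ext n x \<in> ?B"
      unfolding HC quotient_zero[OF Z B]
      by (rule coset_eq_zero_iff[OF Z B]) (use ext_Z[OF x(1)] x(2) in blast)
    also have "\<dots> \<longleftrightarrow> x \<in> D ` TC (n - 1)"
      unfolding B_eq using ext_eq_iff[OF x(1)] D_closed[of _ "n - 1"] by auto
    finally show "?\<pi> x = \<zero>\<^bsub>HC A n\<^esub> \<longleftrightarrow> x \<in> D ` TC (n - 1)" .
  qed
qed

lemma converges_to_HC: "converges_to a fil.E_page fil.E_diff (HC A)"
proof -
  define P where "P n \<pi> \<longleftrightarrow> \<pi> \<in> linear_maps (tuples.space_on {x \<in> TC n. D x = 0}) (HC A n) \<and>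
      \<pi> ` {x \<in> TC n. D x = 0} = carrier (HC A n) \<and>
      (\<forall>x. x \<in> TC n \<longrightarrow> D x = 0 \<longrightarrow> (\<pi> x = \<zero>\<^bsub>HC A n\<^esub> \<longleftrightarrow> x \<in> D ` TC (n - 1)))" for n \<pi>
  have ex: "is_vector_space (HC A n) \<and> (\<exists>\<pi>. P n \<pi>)" for n
  proof -
    obtain \<pi> where h: "is_vector_space (HC A n)"
      "\<pi> \<in> linear_maps (tuples.space_on {x \<in> TC n. D x = 0}) (HC A n)"
      "\<pi> ` {x \<in> TC n. D x = 0} = carrier (HC A n)"
      "\<And>x. x \<in> TC n \<Longrightarrow> D x = 0 \<Longrightarrow> \<pi> x = \<zero>\<^bsub>HC A n\<^esub> \<longleftrightarrow> x \<in> D ` TC (n - 1)"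
      by (rule HC_presentation[of n]) blast
    have "P n \<pi>" unfolding P_def by (intro conjI allI impI h)
    then show ?thesis using h(1) by blast
  qed
  define \<pi> where "\<pi> n = (SOME \<pi>. P n \<pi>)" for n
  have "P n (\<pi> n)" for n unfolding \<pi>_def using ex[of n, THEN conjunct2] by (rule someI_ex)
  note P = this[unfolded P_def]
  show ?thesis
    by (rule fil.converges[of "HC A" \<pi>, OF ex[THEN conjunct1] P[THEN conjunct1]
          P[THEN conjunct2, THEN conjunct1] P[THEN conjunct2, THEN conjunct2, rule_format]])
qed

end

context dga
begin

section \<open>The second page\<close>

definition b_cocycles :: "int \<Rightarrow> int \<Rightarrow> int \<Rightarrow> ('a, 'k) cochain set" where
  "b_cocycles i q r = {f \<in> E i q r. bE i q r f = 0}"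

definition b_coboundaries :: "int \<Rightarrow> int \<Rightarrow> int \<Rightarrow> ('a, 'k) cochain set" where
  "b_coboundaries i q r = bE i (q - 1) r ` E i (q - 1) r"

abbreviation "b_cocycle_space i q r \<equiv> (EC A i q r)\<lparr>carrier := b_cocycles i q r\<rparr>"
abbreviation "cls i q r f \<equiv> b_coboundaries i q r +>\<^bsub>EC A i q r\<^esub> f"

lemma bE_linear_maps: "bE i q r \<in> linear_maps (EC A i q r) (EC A i (q + 1) r)"
  unfolding linear_maps_def using bE_closed bE_linear by simp

lemma bE_linear_maps': "bE i (q - 1) r \<in> linear_maps (EC A i (q - 1) r) (EC A i q r)"
  using bE_linear_maps[of i "q - 1" r] by simp

lemma bE_bE': "f \<in> E i (q - 1) r \<Longrightarrow> bE i q r (bE i (q - 1) r f) = \<zero>\<^bsub>EC A i (q + 1) r\<^esub>"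
  using bE_bE[of f i "q - 1" r] by simp

lemma b_cocycle_space_eq: "b_cocycle_space i q r = (EC A i q r)\<lparr>carrier := {f \<in> E i q r. bE i q r f = \<zero>\<^bsub>EC A i (q + 1) r\<^esub>}\<rparr>"
  by (simp add: b_cocycles_def)

lemma b_cocycle_space_is_vector_space: "is_vector_space (b_cocycle_space i q r)"
  unfolding b_cocycle_space_eq
  by (rule cocycles_is_vector_space[OF EC_is_vector_space EC_is_vector_space EC_is_vector_space
        bE_linear_maps' bE_linear_maps]) (rule bE_bE')

lemma b_coboundaries_is_subspace: "is_subspace (b_coboundaries i q r) (b_cocycle_space i q r)"
  unfolding b_cocycle_space_eq b_coboundaries_def
  by (rule coboundaries_is_subspace[OF EC_is_vector_space EC_is_vector_space EC_is_vector_space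
        bE_linear_maps' bE_linear_maps]) (rule bE_bE')

lemma b_coboundaries_is_subspace_EC: "is_subspace (b_coboundaries i q r) (EC A i q r)"
  unfolding b_coboundaries_def
  by (rule linear_image_is_subspace[OF EC_is_vector_space EC_is_vector_space bE_linear_maps'
        carrier_is_subspace[OF EC_is_vector_space]])

lemma b_coboundariesI: "u \<in> E i (q - 1) r \<Longrightarrow> bE i (q - 1) r u \<in> b_coboundaries i q r"
  by (auto simp: b_coboundaries_def)

lemma b_coboundaries_zero: "0 \<in> b_coboundaries i q r"
  using b_coboundariesI[OF E_closed(1), of i q r] by (simp add: E_map_zero)

lemma b_coboundaries_uminus: "f \<in> b_coboundaries i q r \<Longrightarrow> - f \<in> b_coboundaries i q r"
  using is_subspaceD(4)[OF EC_is_vector_space b_coboundaries_is_subspace_EC, of f i q r "-1"] by (simp add: fun_Compl_def)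

lemma hoch_space_EC: "0 \<le> i \<Longrightarrow> 0 \<le> r \<Longrightarrow> hoch_space A (nat r) (q - i) = EC A i q r"
  by (simp add: hoch_space_def EC_def)

lemma hoch_map_EC: "0 \<le> i \<Longrightarrow> 0 \<le> r \<Longrightarrow> hoch_map h (nat r) (q - i) = EC_map h i q r"
  by (auto simp: hoch_map_def EC_map_def fun_eq_iff)

lemma hoch_coboundaries_EC: "0 \<le> i \<Longrightarrow> 0 \<le> r \<Longrightarrow> hoch_coboundaries A (q - i) (nat r) = b_coboundaries i q r"
proof -
  assume i: "0 \<le> i" "0 \<le> r"
  have "q - i - 1 = (q - 1) - i" by simp
  then show ?thesis unfolding hoch_coboundaries_def b_coboundaries_def by (simp only: hoch_space_EC[OF i] hoch_map_EC[OF i])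
qed

lemma HHP_eq:
  assumes i: "0 \<le> i" "0 \<le> r"
  shows "HHP A (q - i) (nat r) = quotient_space (b_cocycle_space i q r) (b_coboundaries i q r)"
proof -
  have "q - i - 1 = (q - 1) - i" "q - i + 1 = (q + 1) - i" by simp_all
  then show ?thesis
    unfolding HHP_def cohomology_def
    by (simp only: hoch_space_EC[OF i] hoch_map_EC[OF i] cohomology_at_def b_cocycle_space_eq b_coboundaries_def)
qed

lemma HHP_is_vector_space: "0 \<le> i \<Longrightarrow> 0 \<le> r \<Longrightarrow> is_vector_space (HHP A (q - i) (nat r))"
  unfolding HHP_eq by (rule quotient_is_vector_space[OF b_cocycle_space_is_vector_space b_coboundaries_is_subspace])

lemma HHP_carrier: "0 \<le> i \<Longrightarrow> 0 \<le> r \<Longrightarrow> carrier (HHP A (q - i) (nat r)) = (\<lambda>f. cls i q r f) ` b_cocycles i q r"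
  unfolding HHP_eq using quotient_carrier[OF b_cocycle_space_is_vector_space b_coboundaries_is_subspace, of i q r] by simp

lemma HHP_zero: "0 \<le> i \<Longrightarrow> 0 \<le> r \<Longrightarrow> \<zero>\<^bsub>HHP A (q - i) (nat r)\<^esub> = b_coboundaries i q r"
  unfolding HHP_eq by (rule quotient_zero[OF b_cocycle_space_is_vector_space b_coboundaries_is_subspace])

lemma HHP_add: "0 \<le> i \<Longrightarrow> 0 \<le> r \<Longrightarrow> f \<in> b_cocycles i q r \<Longrightarrow> g \<in> b_cocycles i q r \<Longrightarrow>
    cls i q r f \<oplus>\<^bsub>HHP A (q - i) (nat r)\<^esub> cls i q r g = cls i q r (f + g)"
  unfolding HHP_eq using quotient_add[OF b_cocycle_space_is_vector_space b_coboundaries_is_subspace, of f i q r g] by simp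

lemma HHP_smult: "0 \<le> i \<Longrightarrow> 0 \<le> r \<Longrightarrow> f \<in> b_cocycles i q r \<Longrightarrow>
    c \<odot>\<^bsub>HHP A (q - i) (nat r)\<^esub> cls i q r f = cls i q r (scaled c f)"
  unfolding HHP_eq using quotient_smult[OF b_cocycle_space_is_vector_space b_coboundaries_is_subspace, of f i q r c] by simp

lemma cls_eq_zero_iff: "f \<in> b_cocycles i q r \<Longrightarrow> cls i q r f = b_coboundaries i q r \<longleftrightarrow> f \<in> b_coboundaries i q r"
  using coset_eq_zero_iff[OF b_cocycle_space_is_vector_space b_coboundaries_is_subspace, of f i q r] by simp

lemma HHP_B_cls:
  assumes i: "0 \<le> i" "0 \<le> r" and f: "f \<in> b_cocycles i q r"
  shows "HHP_B A (q - i) (nat r) (cls i q r f) = cls (i + 1) q r (BE i q r f)"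
proof -
  have i': "0 \<le> i + 1" using i by simp
  have idx: "q - i - 1 = q - (i + 1)" by simp
  have lin: "BE i q r \<in> linear_maps (b_cocycle_space i q r) (EC A (i + 1) q r)"
    unfolding linear_maps_def using BE_closed BE_linear by (simp add: b_cocycles_def)
  have "BE i q r ` b_coboundaries i q r \<subseteq> b_coboundaries (i + 1) q r"
  proof
    fix g assume "g \<in> BE i q r ` b_coboundaries i q r"
    then obtain u where u: "u \<in> E i (q - 1) r" "g = BE i q r (bE i (q - 1) r u)" by (auto simp: b_coboundaries_def)
    have "bE (i + 1) (q - 1) r (BE i (q - 1) r u) + g = 0" using bE_BE[OF u(1)] u(2) by simp
    then have "g = - bE (i + 1) (q - 1) r (BE i (q - 1) r u)" by (simp add: eq_neg_iff_add_eq_0 add.commute)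
    then show "g \<in> b_coboundaries (i + 1) q r" using b_coboundaries_uminus[OF b_coboundariesI[OF BE_closed[OF u(1)]]] by simp
  qed
  from induced_map_coset[OF b_cocycle_space_is_vector_space EC_is_vector_space b_coboundaries_is_subspace b_coboundaries_is_subspace_EC lin this]
  show ?thesis
    unfolding HHP_B_def idx hoch_space_EC[OF i' i(2)] hoch_coboundaries_EC[OF i' i(2)] hoch_map_EC[OF i]
    using f by simp
qed

lemma HHP_delta_cls:
  assumes i: "0 \<le> i" "0 \<le> r" and f: "f \<in> b_cocycles i q r"
  shows "HHP_delta A (q - i) (nat r) (cls i q r f) = cls i q (r + 1) (sgn_delta i q r f)"
proof -
  have i': "0 \<le> r + 1" using i by simp
  have idx: "nat r + 1 = nat (r + 1)" using i by simp
  have lin: "sgn_delta i q r \<in> linear_maps (b_cocycle_space i q r) (EC A i q (r + 1))"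
    unfolding linear_maps_def using sgn_delta_closed sgn_delta_linear by (simp add: b_cocycles_def)
  have "sgn_delta i q r ` b_coboundaries i q r \<subseteq> b_coboundaries i q (r + 1)"
  proof
    fix g assume "g \<in> sgn_delta i q r ` b_coboundaries i q r"
    then obtain u where u: "u \<in> E i (q - 1) r" "g = sgn_delta i q r (bE i (q - 1) r u)" by (auto simp: b_coboundaries_def)
    have "g + bE i (q - 1) (r + 1) (sgn_delta i (q - 1) r u) = 0" using bE_sgn_delta[OF u(1)] u(2) by simp
    then have "g = - bE i (q - 1) (r + 1) (sgn_delta i (q - 1) r u)" by (simp add: eq_neg_iff_add_eq_0)
    then show "g \<in> b_coboundaries i q (r + 1)" using b_coboundaries_uminus[OF b_coboundariesI[OF sgn_delta_closed[OF u(1)]]] by simp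
  qed
  from induced_map_coset[OF b_cocycle_space_is_vector_space EC_is_vector_space b_coboundaries_is_subspace b_coboundaries_is_subspace_EC lin this]
  show ?thesis
    unfolding HHP_delta_def idx hoch_space_EC[OF i(1) i'] hoch_coboundaries_EC[OF i(1) i'] hoch_map_EC[OF i]
    using f by (simp add: sgn_delta_def[abs_def])
qed

text \<open>An element of \<open>\<Oplus>HHP\<^sup>q\<^sub>*(A)\<close> in degree \<open>s\<close> is represented by a family of cocycles
  \<open>z\<^sub>i \<in> C\<^sup>q\<^sup>-\<^sup>i(A)\<^sup>s\<^sup>-\<^sup>i\<close>, or by the element of the total complex that has this family in the row \<open>q\<close>.
  The index \<open>i\<close> runs over all integers, but the spaces are zero unless \<open>0 \<le> i \<le> s\<close>. The differential of the total complex
  then gives both the differential of the family and the condition to consist of cocycles.\<close>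

definition cocycle_families :: "int \<Rightarrow> int \<Rightarrow> (int \<Rightarrow> ('a, 'k) cochain) set" where
  "cocycle_families q s = {z. \<forall>i. z i \<in> b_cocycles i q (s - i)}"

definition row :: "int \<Rightarrow> int \<Rightarrow> (int \<Rightarrow> ('a, 'k) cochain) \<Rightarrow> int \<times> int \<times> int \<Rightarrow> ('a, 'k) cochain" where
  "row q s z = (\<lambda>(i, q', r). if q' = q \<and> r = s - i then z i else 0)"

definition family_diff :: "int \<Rightarrow> int \<Rightarrow> (int \<Rightarrow> ('a, 'k) cochain) \<Rightarrow> int \<Rightarrow> ('a, 'k) cochain" where
  "family_diff q s z = (\<lambda>j. BE (j - 1) q (s + 1 - j) (z (j - 1)) + sgn_delta j q (s - j) (z j))"

lemma row_TC: "(\<And>i. z i \<in> E i q (s - i)) \<Longrightarrow> row q s z \<in> TC (s + q)"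
  by (auto simp: TC_def row_def E_closed(1))

lemma D_row: "D (row q s z) = row q (s + 1) (family_diff q s z) + row (q + 1) s (\<lambda>i. bE i q (s - i) (z i))"
proof (rule HOL.ext)
  fix t :: "int \<times> int \<times> int"
  obtain i q' r where t: "t = (i, q', r)" by (cases t)
  consider "q' = q" "r = s + 1 - i" | "q' = q + 1" "r = s - i" | "\<not> (q' = q \<and> r = s + 1 - i)" "\<not> (q' = q + 1 \<and> r = s - i)"
    by blast
  then show "D (row q s z) t = (row q (s + 1) (family_diff q s z) + row (q + 1) s (\<lambda>i. bE i q (s - i) (z i))) t"
  proof cases
    case 1
    have "s + 1 - i - 1 = s - i" by simp
    then show ?thesis using 1 by (simp add: t D_def row_def family_diff_def E_map_zero)
  next
    case 2
    then show ?thesis by (simp add: t D_def row_def E_map_zero sgn_delta_zero)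
  next
    case 3
    have "row q s z (i, q' - 1, r) = 0" "row q s z (i - 1, q', r) = 0" "row q s z (i, q', r - 1) = 0"
      using 3 by (auto simp: row_def)
    then have "D (row q s z) t = 0" by (simp add: t D_def E_map_zero sgn_delta_zero)
    then show ?thesis using 3 by (auto simp: t row_def)
  qed
qed

lemma cocycle_familiesD: "z \<in> cocycle_families q s \<Longrightarrow> z i \<in> E i q (s - i)" "z \<in> cocycle_families q s \<Longrightarrow> bE i q (s - i) (z i) = 0"
  by (auto simp: cocycle_families_def b_cocycles_def)

lemma row_zero: "row q s (\<lambda>i. 0) = 0"
  by (auto simp: row_def fun_eq_iff)

lemma D_row_family: "z \<in> cocycle_families q s \<Longrightarrow> D (row q s z) = row q (s + 1) (family_diff q s z)"
  by (simp add: D_row cocycle_familiesD(2) row_zero)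

text \<open>Both facts are read off from the two rows of \<open>D (D (row q s z)) = 0\<close>.\<close>

lemma family_diff_properties:
  assumes z: "z \<in> cocycle_families q s"
  shows "family_diff q s z \<in> cocycle_families q (s + 1)" and "family_diff q (s + 1) (family_diff q s z) = (\<lambda>i. 0)"
proof -
  have row: "row q s z \<in> TC (s + q)" by (rule row_TC) (rule cocycle_familiesD(1)[OF z])
  have DD: "row q (s + 1 + 1) (family_diff q (s + 1) (family_diff q s z))
      + row (q + 1) (s + 1) (\<lambda>i. bE i q (s + 1 - i) (family_diff q s z i)) = 0"
    using D_D[OF row] unfolding D_row_family[OF z] D_row[of q "s + 1" "family_diff q s z"] .
  have "family_diff q s z j \<in> E j q (s + 1 - j)" for j
    using TCD(1)[OF D_closed[OF row], of j q "s + 1 - j"] unfolding D_row_family[OF z] by (simp add: row_def)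
  moreover have "bE j q (s + 1 - j) (family_diff q s z j) = 0" for j
    using fun_cong[OF DD, of "(j, q + 1, s + 1 - j)"] by (simp add: row_def)
  ultimately show "family_diff q s z \<in> cocycle_families q (s + 1)" by (simp add: cocycle_families_def b_cocycles_def)
  show "family_diff q (s + 1) (family_diff q s z) = (\<lambda>i. 0)"
  proof (rule HOL.ext)
    fix j show "family_diff q (s + 1) (family_diff q s z) j = 0"
      using fun_cong[OF DD, of "(j, q, s + 1 + 1 - j)"] by (simp add: row_def)
  qed
qed

text \<open>Classes are taken for the indices of the direct sum only, as its elements are \<open>undefined\<close> at other
  indices.\<close>

definition family_class :: "int \<Rightarrow> int \<Rightarrow> (int \<Rightarrow> ('a, 'k) cochain) \<Rightarrow> int \<Rightarrow> ('a, 'k) cochain set" where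
  "family_class q s z = (\<lambda>i\<in>{0..s}. cls i q (s - i) (z i))"

lemma cocycle_families_closed:
  "(\<lambda>i. 0) \<in> cocycle_families q s" "z \<in> cocycle_families q s \<Longrightarrow> w \<in> cocycle_families q s \<Longrightarrow> z + w \<in> cocycle_families q s"
  "z \<in> cocycle_families q s \<Longrightarrow> (\<lambda>i. scaled c (z i)) \<in> cocycle_families q s"
proof -
  show "(\<lambda>i. 0) \<in> cocycle_families q s" by (simp add: cocycle_families_def b_cocycles_def E_closed(1) E_map_zero)
  show "z + w \<in> cocycle_families q s" if z: "z \<in> cocycle_families q s" and w: "w \<in> cocycle_families q s"
    using E_closed(2)[OF cocycle_familiesD(1)[OF z] cocycle_familiesD(1)[OF w]] bE_linear(1)[OF cocycle_familiesD(1)[OF z] cocycle_familiesD(1)[OF w]]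
      cocycle_familiesD(2)[OF z] cocycle_familiesD(2)[OF w] by (simp add: cocycle_families_def b_cocycles_def)
  show "(\<lambda>i. scaled c (z i)) \<in> cocycle_families q s" if z: "z \<in> cocycle_families q s"
    using E_closed(4)[OF cocycle_familiesD(1)[OF z]] bE_linear(2)[OF cocycle_familiesD(1)[OF z]] cocycle_familiesD(2)[OF z]
    by (simp add: cocycle_families_def b_cocycles_def fun_eq_iff)
qed

lemma cocycle_families_cocycle: "z \<in> cocycle_families q s \<Longrightarrow> z i \<in> b_cocycles i q (s - i)"
  by (simp add: cocycle_families_def)

lemma HHP_sum_is_vector_space: "is_vector_space (HHP_sum A q s)"
  unfolding HHP_sum_def by (rule direct_sum_is_vector_space) (auto intro: HHP_is_vector_space)

lemma HHP_sum_carrier: "carrier (HHP_sum A q s) = family_class q s ` cocycle_families q s"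
proof (intro equalityI subsetI)
  fix y assume "y \<in> carrier (HHP_sum A q s)"
  then have y: "y \<in> (\<Pi>\<^sub>E i\<in>{0..s}. carrier (HHP A (q - i) (nat (s - i))))"
    by (simp add: HHP_sum_def direct_sum_def)
  have "\<exists>f. f \<in> b_cocycles i q (s - i) \<and> (i \<in> {0..s} \<longrightarrow> y i = cls i q (s - i) f)" for i
  proof (cases "i \<in> {0..s}")
    case True
    then have "y i \<in> carrier (HHP A (q - i) (nat (s - i)))" using y by (rule PiE_mem[rotated])
    moreover have "0 \<le> i" "0 \<le> s - i" using True by simp_all
    ultimately show ?thesis unfolding HHP_carrier[OF \<open>0 \<le> i\<close> \<open>0 \<le> s - i\<close>] by blast
  next
    case False
    then show ?thesis using cocycle_families_cocycle[OF cocycle_families_closed(1)] by blast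
  qed
  then obtain z where z: "\<And>i. z i \<in> b_cocycles i q (s - i)" "\<And>i. i \<in> {0..s} \<Longrightarrow> y i = cls i q (s - i) (z i)"
    by metis
  have "y = family_class q s z"
    by (rule extensionalityI[of _ "{0..s}"]) (use y z(2) in \<open>auto simp: family_class_def PiE_def\<close>)
  moreover have "z \<in> cocycle_families q s" using z(1) by (simp add: cocycle_families_def)
  ultimately show "y \<in> family_class q s ` cocycle_families q s" by blast
next
  fix y assume "y \<in> family_class q s ` cocycle_families q s"
  then obtain z where z: "z \<in> cocycle_families q s" "y = family_class q s z" by blast
  have "cls i q (s - i) (z i) \<in> carrier (HHP A (q - i) (nat (s - i)))" if "i \<in> {0..s}" for i
    using HHP_carrier[of i "s - i" q] cocycle_families_cocycle[OF z(1)] that by auto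
  then have "family_class q s z \<in> (\<Pi>\<^sub>E i\<in>{0..s}. carrier (HHP A (q - i) (nat (s - i))))" by (auto simp: family_class_def)
  moreover have "finite {i \<in> {0..s}. family_class q s z i \<noteq> \<zero>\<^bsub>HHP A (q - i) (nat (s - i))\<^esub>}"
    by (rule finite_subset[of _ "{0..s}"]) auto
  ultimately show "y \<in> carrier (HHP_sum A q s)"
    unfolding z(2) HHP_sum_def direct_sum_def by simp
qed

lemma family_class_linear:
  assumes z: "z \<in> cocycle_families q s"
  shows "w \<in> cocycle_families q s \<Longrightarrow> family_class q s z \<oplus>\<^bsub>HHP_sum A q s\<^esub> family_class q s w = family_class q s (z + w)"
    and "c \<odot>\<^bsub>HHP_sum A q s\<^esub> family_class q s z = family_class q s (\<lambda>i. scaled c (z i))"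
proof -
  show "family_class q s z \<oplus>\<^bsub>HHP_sum A q s\<^esub> family_class q s w = family_class q s (z + w)" if w: "w \<in> cocycle_families q s"
    by (rule extensionalityI[of _ "{0..s}"])
       (simp_all add: family_class_def HHP_sum_def direct_sum_def HHP_add cocycle_families_cocycle[OF z] cocycle_families_cocycle[OF w])
  show "c \<odot>\<^bsub>HHP_sum A q s\<^esub> family_class q s z = family_class q s (\<lambda>i. scaled c (z i))"
    by (rule extensionalityI[of _ "{0..s}"])
       (simp_all add: family_class_def HHP_sum_def direct_sum_def HHP_smult cocycle_families_cocycle[OF z])
qed

lemma family_class_eq_zero_iff:
  assumes z: "z \<in> cocycle_families q s"
  shows "family_class q s z = \<zero>\<^bsub>HHP_sum A q s\<^esub> \<longleftrightarrow> (\<forall>i. z i \<in> b_coboundaries i q (s - i))"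
proof -
  have zero: "\<zero>\<^bsub>HHP_sum A q s\<^esub> = (\<lambda>i\<in>{0..s}. b_coboundaries i q (s - i))"
    by (rule extensionalityI[of _ "{0..s}"]) (simp_all add: HHP_sum_def direct_sum_def HHP_zero)
  have out: "z i \<in> b_coboundaries i q (s - i)" if "i \<notin> {0..s}" for i
  proof -
    have "z i = 0" by (rule E_zero[OF cocycle_familiesD(1)[OF z]]) (use that in auto)
    then show ?thesis by (simp add: b_coboundaries_zero)
  qed
  have "family_class q s z = \<zero>\<^bsub>HHP_sum A q s\<^esub> \<longleftrightarrow> (\<forall>i\<in>{0..s}. cls i q (s - i) (z i) = b_coboundaries i q (s - i))"
    unfolding zero family_class_def by (auto simp: restrict_def fun_eq_iff)
  also have "\<dots> \<longleftrightarrow> (\<forall>i\<in>{0..s}. z i \<in> b_coboundaries i q (s - i))"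
    using cls_eq_zero_iff[OF cocycle_families_cocycle[OF z]] by simp
  finally show ?thesis using out by blast
qed

lemma HHP_sum_diff_family_class:
  assumes z: "z \<in> cocycle_families q s"
  shows "HHP_sum_diff A q s (family_class q s z) = family_class q (s + 1) (family_diff q s z)"
proof (rule extensionalityI[of _ "{0..s + 1}"])
  fix j assume j: "j \<in> {0..s + 1}"
  then have j0: "0 \<le> j" "0 \<le> s + 1 - j" by simp_all
  let ?V = "HHP A (q - j) (nat (s + 1 - j))"
  have idx: "s - (j - 1) = s + 1 - j" by simp
  have zj: "z (j - 1) \<in> b_cocycles (j - 1) q (s + 1 - j)" using cocycle_families_cocycle[OF z, of "j - 1"] unfolding idx .
  have cls_0: "\<zero>\<^bsub>?V\<^esub> = cls j q (s + 1 - j) 0"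
    using cls_eq_zero_iff[of 0 j q "s + 1 - j"] cocycle_families_cocycle[OF cocycle_families_closed(1)[of q "s + 1"], of j] b_coboundaries_zero HHP_zero[OF j0, of q]
    by simp
  have one: "(if j - 1 \<in> {0..s} then HHP_B A (q - (j - 1)) (nat (s - (j - 1))) (family_class q s z (j - 1)) else \<zero>\<^bsub>?V\<^esub>)
      = cls j q (s + 1 - j) (BE (j - 1) q (s + 1 - j) (z (j - 1)))"
  proof (cases "j - 1 \<in> {0..s}")
    case True
    then have "0 \<le> j - 1" by simp
    then show ?thesis
      using HHP_B_cls[OF _ j0(2) zj] True unfolding family_class_def idx by (simp add: idx)
  next
    case False
    then have "z (j - 1) = 0" using j by (intro E_zero[OF cocycle_familiesD(1)[OF z]]) auto
    then show ?thesis unfolding if_not_P[OF False] cls_0 by (simp only: E_map_zero)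
  qed
  have two: "(if j \<in> {0..s} then HHP_delta A (q - j) (nat (s - j)) (family_class q s z j) else \<zero>\<^bsub>?V\<^esub>)
      = cls j q (s + 1 - j) (sgn_delta j q (s - j) (z j))"
  proof (cases "j \<in> {0..s}")
    case True
    then have "0 \<le> s - j" by simp
    note HHP_delta_cls[OF j0(1) this cocycle_families_cocycle[OF z, of j]]
    moreover have s1: "s - j + 1 = s + 1 - j" by simp
    ultimately show ?thesis using True unfolding family_class_def s1 by simp
  next
    case False
    then have "z j = 0" using j by (intro E_zero[OF cocycle_familiesD(1)[OF z]]) auto
    then show ?thesis unfolding if_not_P[OF False] cls_0 by (simp only: sgn_delta_zero)
  qed
  have B0: "BE (j - 1) q (s + 1 - j) (z (j - 1)) \<in> b_cocycles j q (s + 1 - j)"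
    and d0: "sgn_delta j q (s - j) (z j) \<in> b_cocycles j q (s + 1 - j)"
  proof -
    have zE: "z (j - 1) \<in> E (j - 1) q (s + 1 - j)" "bE (j - 1) q (s + 1 - j) (z (j - 1)) = 0" using zj by (auto simp: b_cocycles_def)
    have "bE (j - 1 + 1) q (s + 1 - j) (BE (j - 1) q (s + 1 - j) (z (j - 1))) = 0"
      using bE_BE[OF zE(1)] unfolding zE(2) E_map_zero by simp
    then show "BE (j - 1) q (s + 1 - j) (z (j - 1)) \<in> b_cocycles j q (s + 1 - j)"
      using BE_closed[OF zE(1)] by (simp add: b_cocycles_def)
    have s1: "s - j + 1 = s + 1 - j" by simp
    have "bE j q (s - j + 1) (sgn_delta j q (s - j) (z j)) = 0"
      using bE_sgn_delta[OF cocycle_familiesD(1)[OF z], of j] unfolding cocycle_familiesD(2)[OF z] sgn_delta_zero by simp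
    then show "sgn_delta j q (s - j) (z j) \<in> b_cocycles j q (s + 1 - j)"
      using sgn_delta_closed[OF cocycle_familiesD(1)[OF z], of j] unfolding s1 by (simp add: b_cocycles_def)
  qed
  have "HHP_sum_diff A q s (family_class q s z) j = cls j q (s + 1 - j) (BE (j - 1) q (s + 1 - j) (z (j - 1)))
      \<oplus>\<^bsub>?V\<^esub> cls j q (s + 1 - j) (sgn_delta j q (s - j) (z j))"
    unfolding HHP_sum_diff_def Let_def restrict_apply if_P[OF j] one two ..
  also have "\<dots> = family_class q (s + 1) (family_diff q s z) j"
    unfolding HHP_add[OF j0 B0 d0] family_class_def restrict_apply if_P[OF j] family_diff_def ..
  finally show "HHP_sum_diff A q s (family_class q s z) j = family_class q (s + 1) (family_diff q s z) j" .
qed (simp_all add: HHP_sum_diff_def family_class_def)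

lemma family_diff_linear:
  assumes z: "z \<in> cocycle_families q s"
  shows "w \<in> cocycle_families q s \<Longrightarrow> family_diff q s (z + w) = family_diff q s z + family_diff q s w"
    and "family_diff q s (\<lambda>i. scaled c (z i)) = (\<lambda>i. scaled c (family_diff q s z i))"
proof -
  have idx: "s - (j - 1) = s + 1 - j" for j by simp
  have E: "z (j - 1) \<in> E (j - 1) q (s + 1 - j)" if "z \<in> cocycle_families q s" for z j
    using cocycle_familiesD(1)[OF that, of "j - 1"] unfolding idx .
  show "family_diff q s (z + w) = family_diff q s z + family_diff q s w" if w: "w \<in> cocycle_families q s"
    by (rule HOL.ext) (simp add: family_diff_def BE_linear(1)[OF E[OF z] E[OF w]]
        sgn_delta_linear(1)[OF cocycle_familiesD(1)[OF z] cocycle_familiesD(1)[OF w]])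
  show "family_diff q s (\<lambda>i. scaled c (z i)) = (\<lambda>i. scaled c (family_diff q s z i))"
    by (rule HOL.ext) (simp add: family_diff_def BE_linear(2)[OF E[OF z]] sgn_delta_linear(2)[OF cocycle_familiesD(1)[OF z]]
        distrib_left fun_eq_iff)
qed

lemma HHP_sum_diff_linear: "HHP_sum_diff A q s \<in> linear_maps (HHP_sum A q s) (HHP_sum A q (s + 1))"
  unfolding linear_maps_def
proof (intro CollectI conjI ballI allI)
  fix x y c assume "x \<in> carrier (HHP_sum A q s)"
  then obtain z where z: "z \<in> cocycle_families q s" "x = family_class q s z" unfolding HHP_sum_carrier by blast
  note dz = family_diff_properties(1)[OF z(1)]
  show "HHP_sum_diff A q s x \<in> carrier (HHP_sum A q (s + 1))"
    unfolding z(2) HHP_sum_diff_family_class[OF z(1)] HHP_sum_carrier using dz by blast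
  show "HHP_sum_diff A q s (c \<odot>\<^bsub>HHP_sum A q s\<^esub> x) = c \<odot>\<^bsub>HHP_sum A q (s + 1)\<^esub> HHP_sum_diff A q s x"
    unfolding z(2) family_class_linear(2)[OF z(1)] HHP_sum_diff_family_class[OF z(1)] HHP_sum_diff_family_class[OF cocycle_families_closed(3)[OF z(1)]]
      family_diff_linear(2)[OF z(1)] family_class_linear(2)[OF dz] ..
  assume "y \<in> carrier (HHP_sum A q s)"
  then obtain w where w: "w \<in> cocycle_families q s" "y = family_class q s w" unfolding HHP_sum_carrier by blast
  note dw = family_diff_properties(1)[OF w(1)]
  show "HHP_sum_diff A q s (x \<oplus>\<^bsub>HHP_sum A q s\<^esub> y)
      = HHP_sum_diff A q s x \<oplus>\<^bsub>HHP_sum A q (s + 1)\<^esub> HHP_sum_diff A q s y"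
    unfolding z(2) w(2) family_class_linear(1)[OF z(1) w(1)] HHP_sum_diff_family_class[OF z(1)] HHP_sum_diff_family_class[OF w(1)]
      HHP_sum_diff_family_class[OF cocycle_families_closed(2)[OF z(1) w(1)]] family_diff_linear(1)[OF z(1) w(1)] family_class_linear(1)[OF dz dw] ..
qed

lemma FD: "w \<in> F s n \<Longrightarrow> w \<in> TC n" "w \<in> F s n \<Longrightarrow> i + r < s \<Longrightarrow> w (i, q, r) = 0"
  by (auto simp: F_def)

text \<open>The two lowest parts of the boundary of an element of filtration \<open>s\<close>: in filtration \<open>s\<close> only \<open>b\<close>
  acts on its leading row, and in filtration \<open>s + 1\<close> the maps \<open>B\<close> and \<open>\<delta>\<close> on the leading row meet
  \<open>b\<close> on the row below.\<close>

lemma D_leading: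
  assumes w: "w \<in> F s n"
  shows "D w (i, q + 1, s - i) = bE i q (s - i) (w (i, q, s - i))"
    and "D w (j, q, s + 1 - j) = bE j (q - 1) (s + 1 - j) (w (j, q - 1, s + 1 - j))
      + family_diff q s (\<lambda>i. w (i, q, s - i)) j"
proof -
  have "w (i - 1, q + 1, s - i) = 0" "w (i, q + 1, s - i - 1) = 0" using FD(2)[OF w] by simp_all
  then show "D w (i, q + 1, s - i) = bE i q (s - i) (w (i, q, s - i))"
    by (simp add: D_def E_map_zero sgn_delta_zero)
  have idx: "s + 1 - j - 1 = s - j" "s - (j - 1) = s + 1 - j" by simp_all
  show "D w (j, q, s + 1 - j) = bE j (q - 1) (s + 1 - j) (w (j, q - 1, s + 1 - j))
      + family_diff q s (\<lambda>i. w (i, q, s - i)) j"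
    unfolding D_def family_diff_def prod.case idx by (rule add.assoc)
qed

lemma F_I:
  assumes "w \<in> TC n" "\<And>i q r. i + q + r = n \<Longrightarrow> i + r < s \<Longrightarrow> w (i, q, r) = 0"
  shows "w \<in> F s n"
  using assms TCD(2)[OF assms(1)] unfolding F_def by blast

lemma row_F: "(\<And>i. z i \<in> E i q (s - i)) \<Longrightarrow> s' \<le> s \<Longrightarrow> row q s z \<in> F s' (s + q)"
  by (rule F_I[OF row_TC]) (auto simp: row_def)

text \<open>The map takes an element \<open>x\<close> of filtration \<open>p\<close> and total degree \<open>p + q\<close> to the class of its leading
  row, which lies in the row \<open>q\<close>. If the boundary of \<open>x\<close> has filtration \<open>p + 2\<close>, then its part in
  filtration \<open>p\<close> says that the leading row consists of \<open>b\<close>-cocycles, and its part in filtration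
  \<open>p + 1\<close> that their images under \<open>B \<plusminus> \<delta>\<close> are \<open>b\<close>-coboundaries. Conversely a family with
  these properties is completed by the row below, and a family that is a coboundary in the cohomology of
  \<open>\<Oplus>HHP\<^sup>q\<^sub>*(A)\<close> is the leading row of the boundary of an element with two rows.\<close>

theorem second_page:
  "isomorphic (fil.E_page 2 p q) (cohomology (HHP_sum A q) (HHP_sum_diff A q) p)"
proof -
  define n where "n = p + q"
  let ?f = "HHP_sum_diff A q (p - 1)" and ?g = "HHP_sum_diff A q p"
  let ?U = "HHP_sum A q (p - 1)" and ?V = "HHP_sum A q p" and ?W = "HHP_sum A q (p + 1)"
  let ?Z = "?V\<lparr>carrier := {x \<in> carrier ?V. ?g x = \<zero>\<^bsub>?W\<^esub>}\<rparr>"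
  let ?B = "?f ` carrier ?U"
  let ?H = "cohomology (HHP_sum A q) (HHP_sum_diff A q) p"
  have f: "?f \<in> linear_maps ?U ?V" using HHP_sum_diff_linear[of q "p - 1"] by simp
  have f_class: "?f (family_class q (p - 1) y) = family_class q p (family_diff q (p - 1) y)" if "y \<in> cocycle_families q (p - 1)" for y
    using HHP_sum_diff_family_class[OF that] by simp
  have df: "family_diff q (p - 1) y \<in> cocycle_families q p" "family_diff q p (family_diff q (p - 1) y) = (\<lambda>i. 0)" if "y \<in> cocycle_families q (p - 1)" for y
    using family_diff_properties[OF that] by simp_all
  have gf: "?g (?f x) = \<zero>\<^bsub>?W\<^esub>" if x: "x \<in> carrier ?U" for x
  proof -
    obtain y where y: "y \<in> cocycle_families q (p - 1)" "x = family_class q (p - 1) y" using x unfolding HHP_sum_carrier by blast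
    show ?thesis
      unfolding y(2) f_class[OF y(1)] HHP_sum_diff_family_class[OF df(1)[OF y(1)]] df(2)[OF y(1)]
        family_class_eq_zero_iff[OF cocycle_families_closed(1)] by (simp add: b_coboundaries_zero)
  qed
  note coh = HHP_sum_is_vector_space HHP_sum_is_vector_space HHP_sum_is_vector_space f HHP_sum_diff_linear[of q p]
  have Z: "is_vector_space ?Z" by (rule cocycles_is_vector_space[OF coh]) (rule gf)
  have B: "is_subspace ?B ?Z" by (rule coboundaries_is_subspace[OF coh]) (rule gf)
  have H: "?H = quotient_space ?Z ?B"
    unfolding cohomology_def by (rule cohomology_at_quotient[OF coh]) (rule gf)
  have class_Z: "family_class q p z \<in> carrier ?Z \<longleftrightarrow> (\<forall>j. family_diff q p z j \<in> b_coboundaries j q (p + 1 - j))" if z: "z \<in> cocycle_families q p" for z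
    using family_class_eq_zero_iff[OF family_diff_properties(1)[OF z]] HHP_sum_diff_family_class[OF z] z
    by (auto simp: HHP_sum_carrier)
  define lead where "lead s x = (\<lambda>i. x (i, q, s - i))" for s and x :: "int \<times> int \<times> int \<Rightarrow> ('a, 'k) cochain"
  have cyc: "x \<in> F p n" "D x \<in> F (p + 2) (n + 1)" if "x \<in> fil.approx_cycles 2 p n" for x
    using that by (auto simp: fil.approx_cycles_def)
  have lead_family: "lead s x \<in> cocycle_families q s" if x: "x \<in> F s m" and Dx: "D x \<in> F (s + 1) (m + 1)" for s m x
  proof -
    have "bE i q (s - i) (x (i, q, s - i)) = 0" for i
      using D_leading(1)[OF x, of i q] FD(2)[OF Dx, of i "s - i" "q + 1"] by simp
    then show ?thesis using TCD(1)[OF FD(1)[OF x]] by (simp add: lead_def cocycle_families_def b_cocycles_def)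
  qed
  have D_lead: "D x (j, q, s + 1 - j) = bE j (q - 1) (s + 1 - j) (x (j, q - 1, s + 1 - j)) + family_diff q s (lead s x) j"
    if "x \<in> F s m" for s m x j
    using D_leading(2)[OF that] by (simp add: lead_def)
  let ?\<phi> = "\<lambda>x. ?B +>\<^bsub>?Z\<^esub> family_class q p (lead p x)"
  have lead_cyc: "lead p x \<in> cocycle_families q p" "family_class q p (lead p x) \<in> carrier ?Z" if x: "x \<in> fil.approx_cycles 2 p n" for x
  proof -
    show lf: "lead p x \<in> cocycle_families q p"
      by (rule lead_family[OF cyc(1)[OF x]]) (rule fil.F_antimonoD[OF cyc(2)[OF x]], simp)
    have "family_diff q p (lead p x) j \<in> b_coboundaries j q (p + 1 - j)" for j
    proof -
      have "D x (j, q, p + 1 - j) = 0" by (rule FD(2)[OF cyc(2)[OF x]]) simp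
      then have "family_diff q p (lead p x) j = - bE j (q - 1) (p + 1 - j) (x (j, q - 1, p + 1 - j))"
        using D_lead[OF cyc(1)[OF x], of j] by (simp add: eq_neg_iff_add_eq_0 add.commute)
      then show ?thesis using b_coboundaries_uminus[OF b_coboundariesI[OF TCD(1)[OF FD(1)[OF cyc(1)[OF x]]]]] by simp
    qed
    then show "family_class q p (lead p x) \<in> carrier ?Z" using class_Z[OF lf] by blast
  qed
  have "isomorphic (quotient_space (tuples.space_on (fil.approx_cycles 2 p n)) (fil.approx_boundaries 2 p n)) ?H"
    unfolding H
  proof (rule first_isomorphism[OF fil.approx_cycles_space quotient_is_vector_space[OF Z B]])
    show "?\<phi> \<in> linear_maps (tuples.space_on (fil.approx_cycles 2 p n)) (quotient_space ?Z ?B)"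
    proof (rule linear_maps_compose[OF _ coset_linear[OF Z B]])
      have "lead p (x + y) = lead p x + lead p y" "lead p (\<lambda>i t. c * x i t) = (\<lambda>i. scaled c (lead p x i))" for x y c
        by (auto simp: lead_def fun_eq_iff)
      then show "(\<lambda>x. family_class q p (lead p x)) \<in> linear_maps (tuples.space_on (fil.approx_cycles 2 p n)) ?Z"
        unfolding linear_maps_def using lead_cyc family_class_linear[OF lead_cyc(1)] by simp
    qed
    show "?\<phi> ` carrier (tuples.space_on (fil.approx_cycles 2 p n)) = carrier (quotient_space ?Z ?B)"
      unfolding quotient_carrier[OF Z B]
    proof (intro equalityI subsetI)
      fix v assume "v \<in> (\<lambda>y. ?B +>\<^bsub>?Z\<^esub> y) ` carrier ?Z"
      then obtain y where y: "v = ?B +>\<^bsub>?Z\<^esub> y" "y \<in> carrier ?Z" by blast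
      then obtain z where z: "z \<in> cocycle_families q p" "y = family_class q p z" using HHP_sum_carrier by auto
      then have "\<forall>j. \<exists>u. u \<in> E j (q - 1) (p + 1 - j) \<and> family_diff q p z j = bE j (q - 1) (p + 1 - j) u"
        using class_Z[OF z(1)] y(2) unfolding b_coboundaries_def by blast
      then obtain u where u: "\<And>j. u j \<in> E j (q - 1) (p + 1 - j)"
          "\<And>j. family_diff q p z j = bE j (q - 1) (p + 1 - j) (u j)" by metis
      \<comment> \<open>Correct the row \<open>z\<close> in the row below, to make its boundary vanish up to filtration \<open>p + 2\<close>.\<close>
      define x where "x = row q p z - row (q - 1) (p + 1) u"
      have rz: "row q p z \<in> F p n" using row_F[of z q p p] cocycle_familiesD(1)[OF z(1)] by (simp add: n_def)
      have ru: "row (q - 1) (p + 1) u \<in> F (p + 1) n" using row_F[of u "q - 1" "p + 1" "p + 1"] u(1) by (simp add: n_def add.commute)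
      have xF: "x \<in> F p n"
        unfolding x_def by (rule tuples.subspace_diff[OF F_subspace rz]) (rule fil.F_antimonoD[OF ru], simp)
      have "D x = D (row q p z) - D (row (q - 1) (p + 1) u)"
        unfolding x_def by (rule fil.d_diff[OF FD(1)[OF rz] FD(1)[OF ru]])
      also have "\<dots> = - row (q - 1) (p + 1 + 1) (family_diff (q - 1) (p + 1) u)"
      proof -
        have "row q (p + 1) (family_diff q p z) = row (q - 1 + 1) (p + 1) (\<lambda>i. bE i (q - 1) (p + 1 - i) (u i))"
          using u(2) by (simp add: row_def fun_eq_iff)
        then show ?thesis unfolding D_row_family[OF z(1)] D_row[of "q - 1" "p + 1" u] by simp
      qed
      finally have Dx: "D x = - row (q - 1) (p + 1 + 1) (family_diff (q - 1) (p + 1) u)" .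
      have "D x \<in> F (p + 2) (n + 1)"
        by (rule F_I[OF D_closed[OF FD(1)[OF xF]]]) (auto simp: Dx row_def)
      then have xc: "x \<in> fil.approx_cycles 2 p n" using xF by (simp add: fil.approx_cycles_def)
      have "lead p x = z" by (auto simp: lead_def x_def row_def fun_eq_iff)
      then show "v \<in> ?\<phi> ` carrier (tuples.space_on (fil.approx_cycles 2 p n))"
        using xc y(1) z(2) by (intro image_eqI[of _ _ x]) simp_all
    qed (use lead_cyc in auto)
    fix x assume "x \<in> carrier (tuples.space_on (fil.approx_cycles 2 p n))"
    then have x: "x \<in> fil.approx_cycles 2 p n" by simp
    note xF = cyc(1)[OF x] and lf = lead_cyc(1)[OF x]
    have "?\<phi> x = \<zero>\<^bsub>quotient_space ?Z ?B\<^esub> \<longleftrightarrow> family_class q p (lead p x) \<in> ?B"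
      unfolding quotient_zero[OF Z B] by (rule coset_eq_zero_iff[OF Z B lead_cyc(2)[OF x]])
    also have "\<dots> \<longleftrightarrow> (\<exists>y\<in>cocycle_families q (p - 1). \<forall>i. lead p x i - family_diff q (p - 1) y i \<in> b_coboundaries i q (p - i))"
    proof -
      have "family_class q p (lead p x) = family_class q p (family_diff q (p - 1) y) \<longleftrightarrow> (\<forall>i. lead p x i - family_diff q (p - 1) y i \<in> b_coboundaries i q (p - i))"
        if y: "y \<in> cocycle_families q (p - 1)" for y
      proof -
        let ?w = "\<lambda>i. scaled (-1) (family_diff q (p - 1) y i)"
        note dy = df(1)[OF y] and V = HHP_sum_is_vector_space[of q p]
        have c: "family_class q p (lead p x) \<in> carrier ?V" "family_class q p (family_diff q (p - 1) y) \<in> carrier ?V"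
          using lf dy by (auto simp: HHP_sum_carrier)
        have "family_class q p (lead p x) = family_class q p (family_diff q (p - 1) y)
            \<longleftrightarrow> family_class q p (lead p x) \<ominus>\<^bsub>?V\<^esub> family_class q p (family_diff q (p - 1) y) = \<zero>\<^bsub>?V\<^esub>"
          using minus_eq_zero_iff[OF V c] by simp
        also have "family_class q p (lead p x) \<ominus>\<^bsub>?V\<^esub> family_class q p (family_diff q (p - 1) y) = family_class q p (lead p x + ?w)"
          unfolding a_minus_def vector_space_simps(12)[OF V c(2), symmetric] family_class_linear(2)[OF dy]
          by (rule family_class_linear(1)[OF lf cocycle_families_closed(3)[OF dy]])
        also have "family_class q p (lead p x + ?w) = \<zero>\<^bsub>?V\<^esub> \<longleftrightarrow> (\<forall>i. (lead p x + ?w) i \<in> b_coboundaries i q (p - i))"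
          by (rule family_class_eq_zero_iff[OF cocycle_families_closed(2)[OF lf cocycle_families_closed(3)[OF dy]]])
        also have "lead p x + ?w = (\<lambda>i. lead p x i - family_diff q (p - 1) y i)" by (simp add: fun_eq_iff)
        finally show ?thesis .
      qed
      moreover have "family_class q p (lead p x) \<in> ?B \<longleftrightarrow> (\<exists>y\<in>cocycle_families q (p - 1). family_class q p (lead p x) = family_class q p (family_diff q (p - 1) y))"
        unfolding HHP_sum_carrier image_image using f_class by (simp add: image_iff)
      ultimately show ?thesis by simp
    qed
    also have "\<dots> \<longleftrightarrow> x \<in> fil.approx_boundaries 2 p n"
    proof
      assume "\<exists>y\<in>cocycle_families q (p - 1). \<forall>i. lead p x i - family_diff q (p - 1) y i \<in> b_coboundaries i q (p - i)"
      then obtain y where y: "y \<in> cocycle_families q (p - 1)"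
          and "\<forall>i. \<exists>u. u \<in> E i (q - 1) (p - i) \<and> lead p x i - family_diff q (p - 1) y i = bE i (q - 1) (p - i) u"
        unfolding b_coboundaries_def by blast
      then obtain u where u: "\<And>i. u i \<in> E i (q - 1) (p - i)"
          "\<And>i. lead p x i - family_diff q (p - 1) y i = bE i (q - 1) (p - i) (u i)" by metis
      define w where "w = row q (p - 1) y + row (q - 1) p u"
      have ry: "row q (p - 1) y \<in> F (p - 1) (n - 1)"
        using row_F[of y q "p - 1" "p - 1"] cocycle_familiesD(1)[OF y] by (simp add: n_def algebra_simps)
      have ru: "row (q - 1) p u \<in> F p (n - 1)"
        using row_F[of u "q - 1" p p] u(1) by (simp add: n_def algebra_simps)
      have wF: "w \<in> F (p - 1) (n - 1)"
        unfolding w_def by (rule tuples.subspace_add[OF F_subspace ry]) (rule fil.F_antimonoD[OF ru], simp)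
      have "D w = D (row q (p - 1) y) + D (row (q - 1) p u)"
        unfolding w_def by (rule D_linear(1)[OF FD(1)[OF ry] FD(1)[OF ru]])
      also have "\<dots> = row q p (family_diff q (p - 1) y) + (row (q - 1) (p + 1) (family_diff (q - 1) p u)
          + row q p (\<lambda>i. bE i (q - 1) (p - i) (u i)))"
        using D_row_family[OF y] D_row[of "q - 1" p u] by simp
      finally have Dw: "D w = row q p (family_diff q (p - 1) y) + (row (q - 1) (p + 1) (family_diff (q - 1) p u)
          + row q p (\<lambda>i. bE i (q - 1) (p - i) (u i)))" .
      have DwT: "D w \<in> TC n" using D_closed[OF FD(1)[OF wF]] by simp
      have "D w \<in> F p n" by (rule F_I[OF DwT]) (auto simp: Dw row_def)
      then have wc: "w \<in> fil.approx_cycles 1 (p - 1) (n - 1)" using wF by (simp add: fil.approx_cycles_def)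
      have "x - D w \<in> F (p + 1) n"
      proof (rule F_I)
        show "x - D w \<in> TC n" by (rule tuples.subspace_diff[OF TC_subspace FD(1)[OF xF] DwT])
        fix i q' r assume *: "i + q' + r = n" "i + r < p + 1"
        show "(x - D w) (i, q', r) = 0"
        proof (cases "i + r = p")
          case True
          then have r: "r = p - i" "q' = q" using * by (simp_all add: n_def)
          have "x (i, q, p - i) = bE i (q - 1) (p - i) (u i) + family_diff q (p - 1) y i"
            using u(2)[of i] by (simp add: lead_def algebra_simps)
          then show ?thesis by (simp add: r Dw row_def)
        next
          case False
          then have "i + r < p" using * by simp
          then show ?thesis using FD(2)[OF xF, of i r q'] FD(2)[OF \<open>D w \<in> F p n\<close>, of i r q'] by simp
        qed
      qed
      moreover have "D (x - D w) = D x"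
        using fil.d_diff[OF FD(1)[OF xF] DwT] D_D[OF FD(1)[OF wF]] by simp
      ultimately have "x - D w \<in> fil.approx_cycles 1 (p + 1) n"
        using cyc(2)[OF x] by (simp add: fil.approx_cycles_def add.assoc)
      then show "x \<in> fil.approx_boundaries 2 p n"
        using fil.approx_boundariesI[of "x - D w" 2 p n w] wc by simp
    next
      assume "x \<in> fil.approx_boundaries 2 p n"
      then obtain v w where vw: "x = v + D w" "v \<in> fil.approx_cycles (2 - 1) (p + 1) n"
          "w \<in> fil.approx_cycles (2 - 1) (p - 2 + 1) (n - 1)"
        by (rule fil.approx_boundariesE)
      have v: "v \<in> F (p + 1) n" and w: "w \<in> F (p - 1) (n - 1)" "D w \<in> F p n"
        using vw(2,3) by (simp_all add: fil.approx_cycles_def)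
      have y: "lead (p - 1) w \<in> cocycle_families q (p - 1)" using lead_family[OF w(1)] w(2) by simp
      have "lead p x i - family_diff q (p - 1) (lead (p - 1) w) i \<in> b_coboundaries i q (p - i)" for i
      proof -
        have "lead p x i = D w (i, q, p - i)"
          using FD(2)[OF v, of i "p - i" q] by (simp add: lead_def vw(1))
        also have "\<dots> = bE i (q - 1) (p - i) (w (i, q - 1, p - i)) + family_diff q (p - 1) (lead (p - 1) w) i"
          using D_lead[OF w(1), of i] by simp
        finally show ?thesis using b_coboundariesI[OF TCD(1)[OF FD(1)[OF w(1)]]] by simp
      qed
      then show "\<exists>y\<in>cocycle_families q (p - 1). \<forall>i. lead p x i - family_diff q (p - 1) y i \<in> b_coboundaries i q (p - i)"
        using y by blast
    qed
    finally show "?\<phi> x = \<zero>\<^bsub>quotient_space ?Z ?B\<^esub> \<longleftrightarrow> x \<in> fil.approx_boundaries 2 p n" .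
  qed (use fil.approx_boundaries_subset in simp)
  then show ?thesis by (simp add: fil.E_page_def fil.page_def n_def)
qed

end

theorem theorem4p21:
  fixes A :: "('k::field_char_0, 'a::{ring, monoid_mult}) dga_data"
  assumes "dga A"
  shows "\<exists>(E :: nat \<Rightarrow> int \<Rightarrow> int \<Rightarrow> ('k, (int \<times> int \<times> int \<Rightarrow> ('a, 'k) cochain) set) module) d.
    spectral_sequence 2 E d \<and>
    (\<forall>p q. isomorphic (E 2 p q) (cohomology (HHP_sum A q) (HHP_sum_diff A q) p)) \<and>
    converges_to 2 E d (HC A)"
proof -
  interpret dga A by fact
  show ?thesis
    using fil.spectral_sequence_E second_page converges_to_HC by blast
qed

end
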